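(* Let $T\colon \mathbb{R}^d\times \mathcal{X}\to \mathcal{X}$ be a continuous action of $\mathbb{R}^d$ on a compact metric space $(\mathcal{X}, \mathbf{d})$ with $\overline{\mathrm{mdim}}_{\mathrm{M}}(\mathcal{X}, T, \mathbf{d}) < \infty$. Let $\lambda$ be a Borel probability measure on $\mathscr{M}^T(\mathcal{X})$ and define $\mu \in \mathscr{M}^T(\mathcal{X})$ by $\mu = \int_{\mathscr{M}^T(\mathcal{X})} \nu \, d\lambda(\nu)$. If $\mathrm{rdim}(\mathcal{X}, T, \mathbf{d}, \nu)$ exists for $\lambda$-almost every $\nu\in \mathscr{M}^T(\mathcal{X})$, then $\mathrm{rdim}(\mathcal{X}, T, \mathbf{d}, \mu)$ also exists and satisfies \[ \mathrm{rdim}(\mathcal{X}, T, \mathbf{d}, \mu) = \int_{\mathscr{M}^T(\mathcal{X})} \mathrm{rdim}(\mathcal{X}, T, \mathbf{d}, \nu) \, d\lambda(\nu). \]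
   Context: Conventions: $d$ is a positive integer, $\log=\log_2$, and $\mathbf{m}$ is Lebesgue measure on $\mathbb{R}^d$. $\mathscr{M}^T(\mathcal{X})$ is the set of $T$-invariant Borel probability measures on $\mathcal{X}$ with the weak$^*$ topology and its Borel $\sigma$-algebra; $\mu=\int\nu\,d\lambda(\nu)$ means $\mu(A)=\int \nu(A)\,d\lambda(\nu)$ for all Borel $A\subset\mathcal{X}$. Mutual information: for random variables $X,Y$ with values in finite sets, $I(X;Y)=H(X)+H(Y)-H(X,Y)$ where $H$ is Shannon entropy (base 2). For $X,Y$ with values in measurable spaces, $I(X;Y)$ is the supremum of $I(\alpha\circ X;\beta\circ Y)$ over all finite measurable partitions $\alpha,\beta$ of the two target spaces, where $\alpha\circ X$ is the index of the element of $\alpha$ containing $X$ (similarly $\beta\circ Y$). Rate distortion function: for $L>0$, $L^1([0,L)^d,\mathcal{X})$ is the space of measurable maps $[0,L)^d\to\mathcal{X}$ modulo $\mathbf{m}$-a.e. equality, with metric $D(f,g)=\int_{[0,L)^d}\mathbf{d}(f(u),g(u))\,d\mathbf{m}(u)$ and its Borel $\sigma$-algebra. For $\mu\in\mathscr{M}^T(\mathcal{X})$ and $\varepsilon>0$, $R_L(\mathbf{d},\mu,\varepsilon)$ is the infimum of $I(X;Y)$ over pairs of random variables $X,Y$ defined on a common probability space such that $X$ takes values in $\mathcal{X}$ with law $\mu$, and $Y=(Y_u)_{u\in[0,L)^d}$ takes values in $L^1([0,L)^d,\mathcal{X})$ with $\mathbb{E}\big(\frac{1}{L^d}\int_{[0,L)^d}\mathbf{d}(T^uX,Y_u)\,d\mathbf{m}(u)\big)<\varepsilon$.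 Set $R(\mathbf{d},\mu,\varepsilon)=\lim_{L\to\infty}R_L(\mathbf{d},\mu,\varepsilon)/L^d$; this limit exists, is finite, and equals $\inf_{L>0}R_L(\mathbf{d},\mu,\varepsilon)/L^d$. Rate distortion dimension: $\overline{\mathrm{rdim}}(\mathcal{X},T,\mathbf{d},\mu)$ and $\underline{\mathrm{rdim}}(\mathcal{X},T,\mathbf{d},\mu)$ are the $\limsup$ and $\liminf$ as $\varepsilon\to0$ of $\frac{R(\mathbf{d},\mu,\varepsilon)}{\log(1/\varepsilon)}$. When they coincide, one says $\mathrm{rdim}(\mathcal{X},T,\mathbf{d},\mu)$ exists and it denotes the common value. Upper metric mean dimension: $\#(\mathcal{X},\mathbf{d},\varepsilon)$ is the minimum $n$ such that $\mathcal{X}$ has an open cover by $n$ sets each of $\mathbf{d}$-diameter $<\varepsilon$; $\mathbf{d}_L(x,y)=\sup_{u\in[0,L)^d}\mathbf{d}(T^ux,T^uy)$; $S(\mathcal{X},T,\mathbf{d},\varepsilon)=\lim_{L\to\infty}\frac{\log\#(\mathcal{X},\mathbf{d}_L,\varepsilon)}{L^d}$ (the limit exists and is finite); $\overline{\mathrm{mdim}}_{\mathrm{M}}(\mathcal{X},T,\mathbf{d})=\limsup_{\varepsilon\to0}\frac{S(\mathcal{X},T,\mathbf{d},\varepsilon)}{\log(1/\varepsilon)}$. *)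

theory Defs
  imports "HOL-Probability.Probability"
begin

section \<open>Actions, invariant measures and the weak$^*$ topology\<close>

text \<open>
  The group is \<^typ>\<open>real ^ 'n\<close> with \<open>d = CARD('n)\<close>.  The phase space is a whole type, its metric
  is \<^const>\<open>dist\<close>, and its compactness is assumed as \<open>compact UNIV\<close>.
\<close>

definition continuous_action :: "(real ^ 'n \<Rightarrow> 'a::topological_space \<Rightarrow> 'a) \<Rightarrow> bool" where
  "continuous_action T \<longleftrightarrow>
     continuous_on UNIV (\<lambda>(u, x). T u x) \<and>
     (\<forall>x. T 0 x = x) \<and> (\<forall>u v x. T (u + v) x = T u (T v x))"

definition invariant_measures ::
    "(real ^ 'n \<Rightarrow> 'a::topological_space \<Rightarrow> 'a) \<Rightarrow> 'a measure set" where
  "invariant_measures T =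
     {\<nu>. prob_space \<nu> \<and> sets \<nu> = sets borel \<and> (\<forall>u. distr \<nu> borel (T u) = \<nu>)}"

definition weak_star_topology ::
    "(real ^ 'n \<Rightarrow> 'a::topological_space \<Rightarrow> 'a) \<Rightarrow> 'a measure topology" where
  "weak_star_topology T =
     topology_generated_by
       {{\<nu> \<in> invariant_measures T. (\<integral>x. f x \<partial>\<nu>) \<in> U} | (f :: 'a \<Rightarrow> real) U.
          continuous_on UNIV f \<and> open U}"

definition borel_of :: "'b topology \<Rightarrow> 'b measure" where
  "borel_of \<tau> = sigma (topspace \<tau>) {U. openin \<tau> U}"

text \<open>
  The measure \<open>A \<mapsto> \<integral> \<nu>(A) d\<lambda>(\<nu>)\<close>.  If this set function were not countably additive,
  \<^const>\<open>measure_of\<close> would return the zero measure, so any assertion that \<open>mixture \<Lambda>\<close>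
  is a probability measure includes that it is given by this formula.
\<close>

definition mixture :: "'a::topological_space measure measure \<Rightarrow> 'a measure" where
  "mixture \<Lambda> = measure_of UNIV (sets borel) (\<lambda>A. \<integral>\<^sup>+ \<nu>. emeasure \<nu> A \<partial>\<Lambda>)"


section \<open>Mutual information\<close>

text \<open>
  The mutual information of the library is the real-valued Kullback--Leibler integral, which is
  not meaningful when the information is infinite; hence the supremum over finite partitions.
\<close>

definition finite_mutual_information :: "'w measure \<Rightarrow> ('w \<Rightarrow> 'b) \<Rightarrow> ('w \<Rightarrow> 'c) \<Rightarrow> real" where
  "finite_mutual_information M X Y =
     prob_space.entropy M 2 (count_space (X ` space M)) X
     + prob_space.entropy M 2 (count_space (Y ` space M)) Y
     - prob_space.entropy M 2 (count_space ((\<lambda>\<omega>. (X \<omega>, Y \<omega>)) ` space M)) (\<lambda>\<omega>. (X \<omega>, Y \<omega>))"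

definition finite_partitions :: "'b measure \<Rightarrow> 'b set set set" where
  "finite_partitions N = {\<alpha>. finite \<alpha> \<and> \<alpha> \<subseteq> sets N \<and> partition_on (space N) \<alpha>}"

text \<open>The element of the partition containing \<open>x\<close>; it serves as its own index.\<close>

definition cell :: "'b set set \<Rightarrow> 'b \<Rightarrow> 'b set" where
  "cell \<alpha> x = (THE A. A \<in> \<alpha> \<and> x \<in> A)"

definition mutual_info ::
    "'w measure \<Rightarrow> 'b measure \<Rightarrow> 'c measure \<Rightarrow> ('w \<Rightarrow> 'b) \<Rightarrow> ('w \<Rightarrow> 'c) \<Rightarrow> ereal" where
  "mutual_info M S S' X Y =
     (SUP (\<alpha>, \<beta>) \<in> finite_partitions S \<times> finite_partitions S'.
        ereal (finite_mutual_information M (cell \<alpha> \<circ> X) (cell \<beta> \<circ> Y)))"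


section \<open>The space $L^1([0,L)^d, \mathcal{X})$\<close>

definition cube :: "real \<Rightarrow> (real ^ 'n) set" where
  "cube L = {u. \<forall>i. 0 \<le> u $ i \<and> u $ i < L}"

abbreviation cube_measure :: "real \<Rightarrow> (real ^ 'n) measure" where
  "cube_measure L \<equiv> restrict_space lborel (cube L)"

text \<open>
  An element is an equivalence class of functions on the whole of \<^typ>\<open>real ^ 'n\<close>; both
  measurability and the equivalence depend only on the values on the cube.  Using Borel instead
  of Lebesgue measurable maps gives the same classes up to modification on null sets.
\<close>

definition L1_space :: "real \<Rightarrow> (real ^ 'n \<Rightarrow> 'a::metric_space) set set" where
  "L1_space L =
     borel_measurable (cube_measure L) //
       {(f, g). f \<in> borel_measurable (cube_measure L) \<and> g \<in> borel_measurable (cube_measure L) \<and>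
                (AE u in cube_measure L. f u = g u)}"

definition L1_rep :: "(real ^ 'n \<Rightarrow> 'a) set \<Rightarrow> real ^ 'n \<Rightarrow> 'a" where
  "L1_rep F = (SOME f. f \<in> F)"

definition L1_dist ::
    "real \<Rightarrow> (real ^ 'n \<Rightarrow> 'a::metric_space) set \<Rightarrow> (real ^ 'n \<Rightarrow> 'a) set \<Rightarrow> real" where
  "L1_dist L F G = (\<integral>u. dist (L1_rep F u) (L1_rep G u) \<partial>cube_measure L)"

definition L1_borel :: "real \<Rightarrow> (real ^ 'n \<Rightarrow> 'a::metric_space) set measure" where
  "L1_borel L = borel_of (Metric_space.mtopology (L1_space L) (L1_dist L))"


section \<open>Rate distortion function and rate distortion dimension\<close>

text \<open>
  The probability spaces carrying \<open>X\<close> and \<open>Y\<close> range over all probability measures on the fixed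
  type of pairs \<open>(x, F)\<close>.  This loses nothing: the mutual information, the law of \<open>X\<close> and the
  expected distortion depend only on the joint law of \<open>(X, Y)\<close>, and every joint law is realised
  by the two projections.
\<close>

definition rate_distortion_cube ::
    "(real ^ 'n \<Rightarrow> 'a::metric_space \<Rightarrow> 'a) \<Rightarrow> 'a measure \<Rightarrow> real \<Rightarrow> real \<Rightarrow> ereal" where
  "rate_distortion_cube T \<mu> L \<epsilon> =
     Inf {mutual_info M borel (L1_borel L) X Y
          | (M :: ('a \<times> (real ^ 'n \<Rightarrow> 'a) set) measure) X Y.
            prob_space M \<and>
            X \<in> measurable M borel \<and> distr M borel X = \<mu> \<and>
            Y \<in> measurable M (L1_borel L) \<and>
            prob_space.expectation M
              (\<lambda>\<omega>. 1 / L ^ CARD('n) *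
                    (\<integral>u. dist (T u (X \<omega>)) (L1_rep (Y \<omega>) u) \<partial>cube_measure L)) < \<epsilon>}"

definition rate_distortion ::
    "(real ^ 'n \<Rightarrow> 'a::metric_space \<Rightarrow> 'a) \<Rightarrow> 'a measure \<Rightarrow> real \<Rightarrow> ereal" where
  "rate_distortion T \<mu> \<epsilon> =
     Lim at_top (\<lambda>L. rate_distortion_cube T \<mu> L \<epsilon> / ereal (L ^ CARD('n)))"

definition upper_rdim :: "(real ^ 'n \<Rightarrow> 'a::metric_space \<Rightarrow> 'a) \<Rightarrow> 'a measure \<Rightarrow> ereal" where
  "upper_rdim T \<mu> = Limsup (at_right 0) (\<lambda>\<epsilon>. rate_distortion T \<mu> \<epsilon> / ereal (log 2 (1 / \<epsilon>)))"

definition lower_rdim :: "(real ^ 'n \<Rightarrow> 'a::metric_space \<Rightarrow> 'a) \<Rightarrow> 'a measure \<Rightarrow> ereal" where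
  "lower_rdim T \<mu> = Liminf (at_right 0) (\<lambda>\<epsilon>. rate_distortion T \<mu> \<epsilon> / ereal (log 2 (1 / \<epsilon>)))"

definition rdim_exists :: "(real ^ 'n \<Rightarrow> 'a::metric_space \<Rightarrow> 'a) \<Rightarrow> 'a measure \<Rightarrow> bool" where
  "rdim_exists T \<mu> \<longleftrightarrow> upper_rdim T \<mu> = lower_rdim T \<mu>"

text \<open>Meaningful only where \<^const>\<open>rdim_exists\<close> holds; it is then the common value.\<close>

definition rdim :: "(real ^ 'n \<Rightarrow> 'a::metric_space \<Rightarrow> 'a) \<Rightarrow> 'a measure \<Rightarrow> ereal" where
  "rdim T \<mu> = upper_rdim T \<mu>"


section \<open>Upper metric mean dimension\<close>

text \<open>
  The metric is a parameter \<open>\<rho>\<close> because the definition is applied to \<open>d_L\<close>, which induces the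
  same topology as \<^const>\<open>dist\<close>.
\<close>

definition diam_wrt :: "('a \<Rightarrow> 'a \<Rightarrow> real) \<Rightarrow> 'a set \<Rightarrow> real" where
  "diam_wrt \<rho> S = (if S = {} then 0 else SUP (x, y) \<in> S \<times> S. \<rho> x y)"

definition covering_number :: "('a::topological_space \<Rightarrow> 'a \<Rightarrow> real) \<Rightarrow> real \<Rightarrow> nat" where
  "covering_number \<rho> \<epsilon> =
     (LEAST n. \<exists>\<U>. finite \<U> \<and> card \<U> = n \<and> (\<forall>U\<in>\<U>. open U \<and> diam_wrt \<rho> U < \<epsilon>) \<and> \<Union>\<U> = UNIV)"

definition dist_cube ::
    "(real ^ 'n \<Rightarrow> 'a::metric_space \<Rightarrow> 'a) \<Rightarrow> real \<Rightarrow> 'a \<Rightarrow> 'a \<Rightarrow> real" where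
  "dist_cube T L x y = (SUP u\<in>cube L. dist (T u x) (T u y))"

definition metric_entropy_rate ::
    "(real ^ 'n \<Rightarrow> 'a::metric_space \<Rightarrow> 'a) \<Rightarrow> real \<Rightarrow> ereal" where
  "metric_entropy_rate T \<epsilon> =
     Lim at_top (\<lambda>L. ereal (log 2 (real (covering_number (dist_cube T L) \<epsilon>)) / L ^ CARD('n)))"

definition upper_metric_mdim :: "(real ^ 'n \<Rightarrow> 'a::metric_space \<Rightarrow> 'a) \<Rightarrow> ereal" where
  "upper_metric_mdim T =
     Limsup (at_right 0) (\<lambda>\<epsilon>. metric_entropy_rate T \<epsilon> / ereal (log 2 (1 / \<epsilon>)))"

end

theory Submission
  imports Defs
begin

text \<open>
  An arbitrary coupling of input and output can be replaced by a finite test channel whose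
  information is measured against a fixed reference output law.  Information and distortion are
  then integrals of functions of the input, hence affine in the input law.  Tiling large cubes by
  translates of a channel, the rate \<open>R(\<nu>, \<epsilon>)\<close> becomes an infimum over one countable family of
  channels, for all invariant \<open>\<nu>\<close> at once.

  Upper bound \<open>R(\<mu>, \<epsilon>) \<le> \<integral> R(\<nu>, \<epsilon>) d\<Lambda>(\<nu>)\<close>: assign to each component \<open>\<nu>\<close> the first almost optimal
  channel of the family and truncate to finitely many of them, say \<open>K\<close>.  Recording which of them
  is used costs \<open>log K\<close> bits, which is negligible per unit volume as the cube grows.

  Lower bound: a channel with average distortion below \<open>\<epsilon>\<close> for \<open>\<mu>\<close> has distortion below \<open>K \<epsilon>\<close> on all
  components but a fraction \<open>1 / K\<close>, where the metric mean dimension supplies the uniform bound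
  \<open>R(\<nu>, \<epsilon>) \<le> C log (1 / \<epsilon>)\<close>; so \<open>\<integral> R(\<nu>, K \<epsilon>) d\<Lambda>(\<nu>) \<le> R(\<mu>, \<epsilon>) + C log (1 / \<epsilon>) / K\<close>.

  Dividing by \<open>log (1 / \<epsilon>)\<close> and letting \<open>\<epsilon> = 2\<^sup>-\<^sup>n\<close> tend to \<open>0\<close>, Fatou's lemma and its reverse show
  that the two bounds agree when the dimension of almost every component exists.
\<close>

subsection \<open>Mutual information of finite partitions\<close>

text \<open>A coupling that is good for one component says nothing about the others, and the mutual
  information of a fixed channel is concave, not affine, in the input law. Hence the reference law
  \<open>q\<close>: with the true output law in its place the average of
  \<open>log 2 (W / q)\<close> is the mutual information, with any other it is larger, so the
  infimum over channels is unchanged. Countability of the family replaces measurable selection: the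
  first suitable channel is a \<open>LEAST\<close>, and sublevel sets of the rate are countable
  unions.

  In the lower bound, a channel good on average may spend its distortion unevenly over the
  components, so rates are not compared at equal distortion. Raising the level from
  \<open>\<epsilon>\<close> to \<open>K * \<epsilon>\<close> is invisible after division by
  \<open>log 2 (1 / \<epsilon>)\<close>; for \<open>K = 2 ^ k\<close> it is a mere shift of the
  index.

  The information inequalities rest on one bound: \<open>a * ln (a / b)\<close> lies above
  \<open>a * ln r + a - r * b\<close>. The latter is linear in \<open>a\<close> and
  \<open>b\<close>, so it survives sums and integrals, and no conditional distributions are
  needed.\<close>

lemma mult_ln_ge_tangent:
  fixes a b r :: real
  assumes "0 \<le> a" "0 < b" "0 < r"
  shows "a * ln r + a - r * b \<le> a * ln (a / b)"
proof (cases "a = 0")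
  case True
  then show ?thesis using assms by simp
next
  case False
  then have a: "a > 0" using assms by simp
  \<comment> \<open>Equality holds at \<open>r = a / b\<close>, which is therefore the slope to aim
    at in applications.\<close>
  have "ln (r * b / a) \<le> r * b / a - 1"
    using assms a by (intro ln_le_minus_one) auto
  moreover have "ln (r * b / a) = ln r - ln (a / b)"
    using assms a by (simp add: ln_mult ln_div)
  ultimately have "a * (ln r - ln (a / b)) \<le> a * (r * b / a - 1)"
    using a by (simp add: mult_left_mono)
  then show ?thesis using a by (simp add: algebra_simps)
qed

text \<open>The index set \<open>C\<close> may exceed the range of \<open>f\<close>: values never
  taken contribute \<open>0 * log 2 0 = 0\<close>. Sums can thus run over a whole partition,
  including cells that are never hit.\<close>

lemma entropy_finite_range:
  assumes "prob_space M" "finite C" "\<And>\<omega>. \<omega> \<in> space M \<Longrightarrow> f \<omega> \<in> C"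
    and "\<And>c. c \<in> C \<Longrightarrow> {\<omega> \<in> space M. f \<omega> = c} \<in> sets M"
  shows "prob_space.entropy M 2 (count_space (f ` space M)) f =
    - (\<Sum>c\<in>C. measure M {\<omega> \<in> space M. f \<omega> = c} * log 2 (measure M {\<omega> \<in> space M. f \<omega> = c}))"
proof -
  interpret information_space M 2
    using assms(1) by (intro information_space.intro information_space_axioms.intro) auto
  have fin: "finite (f ` space M)"
    using assms(2,3) by (meson finite_subset image_subsetI)
  have "simple_function M f"
    unfolding simple_function_def
  proof (intro conjI fin ballI)
    fix c assume "c \<in> f ` space M"
    then have "c \<in> C" using assms(3) by auto
    moreover have "f -` {c} \<inter> space M = {\<omega> \<in> space M. f \<omega> = c}" by auto
    ultimately show "f -` {c} \<inter> space M \<in> sets M" using assms(4) by simp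
  qed
  then have "simple_distributed M f (\<lambda>c. measure M {\<omega> \<in> space M. f \<omega> = c})"
    by (rule simple_distributedI) (auto simp: measure_nonneg intro!: arg_cong[where f="measure M"])
  then have "entropy 2 (count_space (f ` space M)) f =
      - (\<Sum>c\<in>f ` space M. measure M {\<omega> \<in> space M. f \<omega> = c} * log 2 (measure M {\<omega> \<in> space M. f \<omega> = c}))"
    by (rule entropy_simple_distributed)
  also have "(\<Sum>c\<in>f ` space M. measure M {\<omega> \<in> space M. f \<omega> = c} * log 2 (measure M {\<omega> \<in> space M. f \<omega> = c})) =
      (\<Sum>c\<in>C. measure M {\<omega> \<in> space M. f \<omega> = c} * log 2 (measure M {\<omega> \<in> space M. f \<omega> = c}))"
  proof (rule sum.mono_neutral_left[OF assms(2)])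
    show "\<forall>c\<in>C - f ` space M. measure M {\<omega> \<in> space M. f \<omega> = c} * log 2 (measure M {\<omega> \<in> space M. f \<omega> = c}) = 0"
    proof
      fix c assume "c \<in> C - f ` space M"
      then have "{\<omega> \<in> space M. f \<omega> = c} = {}" by auto
      then show "measure M {\<omega> \<in> space M. f \<omega> = c} * log 2 (measure M {\<omega> \<in> space M. f \<omega> = c}) = 0"
        by (simp only: measure_empty mult_zero_left)
    qed
  qed (use assms(3) in auto)
  finally show ?thesis .
qed

lemma cell_eq_iff:
  assumes "partition_on \<Omega> \<alpha>" "x \<in> \<Omega>" "A \<in> \<alpha>"
  shows "cell \<alpha> x = A \<longleftrightarrow> x \<in> A"
proof -
  have ex1: "\<exists>!A. A \<in> \<alpha> \<and> x \<in> A"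
    using partition_onD1[OF assms(1)] partition_onD2[OF assms(1)] assms(2)
    by (auto simp: disjoint_def)
  then have "cell \<alpha> x \<in> \<alpha> \<and> x \<in> cell \<alpha> x"
    unfolding cell_def by (rule theI')
  with ex1 assms(3) show ?thesis by blast
qed

lemma cell_in:
  assumes "partition_on \<Omega> \<alpha>" "x \<in> \<Omega>"
  shows "cell \<alpha> x \<in> \<alpha>"
  using assms cell_eq_iff by (metis UnionE partition_onD1)

lemma sum_measure_partition:
  assumes "finite_measure M" "finite \<alpha>" "partition_on \<Omega> \<alpha>" "f \<in> space M \<rightarrow> \<Omega>"
    and "\<And>A. A \<in> \<alpha> \<Longrightarrow> {\<omega> \<in> space M. f \<omega> \<in> A \<and> \<omega> \<in> B} \<in> sets M"
  shows "(\<Sum>A\<in>\<alpha>. measure M {\<omega> \<in> space M. f \<omega> \<in> A \<and> \<omega> \<in> B}) = measure M {\<omega> \<in> space M. \<omega> \<in> B}"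
proof -
  interpret finite_measure M by fact
  have "disjoint_family_on (\<lambda>A. {\<omega> \<in> space M. f \<omega> \<in> A \<and> \<omega> \<in> B}) \<alpha>"
    using partition_onD2[OF assms(3)] by (auto simp: disjoint_family_on_def disjoint_def)
  then have "(\<Sum>A\<in>\<alpha>. measure M {\<omega> \<in> space M. f \<omega> \<in> A \<and> \<omega> \<in> B}) =
      measure M (\<Union>A\<in>\<alpha>. {\<omega> \<in> space M. f \<omega> \<in> A \<and> \<omega> \<in> B})"
    using assms(2,5) by (intro finite_measure_finite_Union[symmetric]) auto
  also have "(\<Union>A\<in>\<alpha>. {\<omega> \<in> space M. f \<omega> \<in> A \<and> \<omega> \<in> B}) = {\<omega> \<in> space M. \<omega> \<in> B}"
    using partition_onD1[OF assms(3)] assms(4) by (auto simp: Pi_iff)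
  finally show ?thesis .
qed

text \<open>Turns the three entropies of the definition into the relative entropy of the joint
  masses with respect to the product of the marginals, the form to which tangent bounds apply. The
  marginal identities are supplied for the data processing inequality.\<close>

lemma finite_mutual_information_cell:
  assumes "prob_space M"
    and X: "X \<in> measurable M S" and Y: "Y \<in> measurable M S'"
    and \<alpha>: "\<alpha> \<in> finite_partitions S" and \<beta>: "\<beta> \<in> finite_partitions S'"
  defines "c \<equiv> \<lambda>A B. measure M {\<omega> \<in> space M. X \<omega> \<in> A \<and> Y \<omega> \<in> B}"
    and "p \<equiv> \<lambda>A. measure M {\<omega> \<in> space M. X \<omega> \<in> A}"
    and "Q \<equiv> \<lambda>B. measure M {\<omega> \<in> space M. Y \<omega> \<in> B}"
  shows "finite_mutual_information M (cell \<alpha> \<circ> X) (cell \<beta> \<circ> Y) =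
    (\<Sum>A\<in>\<alpha>. \<Sum>B\<in>\<beta>. c A B * log 2 (c A B / (p A * Q B)))"
    and "\<And>A. A \<in> \<alpha> \<Longrightarrow> (\<Sum>B\<in>\<beta>. c A B) = p A"
    and "\<And>B. B \<in> \<beta> \<Longrightarrow> (\<Sum>A\<in>\<alpha>. c A B) = Q B"
proof -
  interpret prob_space M by fact
  have \<alpha>': "finite \<alpha>" "\<alpha> \<subseteq> sets S" "partition_on (space S) \<alpha>"
    and \<beta>': "finite \<beta>" "\<beta> \<subseteq> sets S'" "partition_on (space S') \<beta>"
    using \<alpha> \<beta> by (auto simp: finite_partitions_def)
  have XS: "X \<omega> \<in> space S" and YS: "Y \<omega> \<in> space S'" if "\<omega> \<in> space M" for \<omega>
    using that X Y by (auto simp: measurable_space)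
  have mX: "{\<omega> \<in> space M. X \<omega> \<in> A} \<in> sets M" if "A \<in> \<alpha>" for A
    using that \<alpha>'(2) measurable_sets[OF X, of A] by (auto simp: vimage_def Int_def conj_commute)
  have mY: "{\<omega> \<in> space M. Y \<omega> \<in> B} \<in> sets M" if "B \<in> \<beta>" for B
    using that \<beta>'(2) measurable_sets[OF Y, of B] by (auto simp: vimage_def Int_def conj_commute)
  have mXY: "{\<omega> \<in> space M. X \<omega> \<in> A \<and> Y \<omega> \<in> B} \<in> sets M" if "A \<in> \<alpha>" "B \<in> \<beta>" for A B
  proof -
    have "{\<omega> \<in> space M. X \<omega> \<in> A \<and> Y \<omega> \<in> B} = {\<omega> \<in> space M. X \<omega> \<in> A} \<inter> {\<omega> \<in> space M. Y \<omega> \<in> B}"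
      by auto
    then show ?thesis using mX[OF that(1)] mY[OF that(2)] by (simp only: sets.Int)
  qed
  have cX: "{\<omega> \<in> space M. (cell \<alpha> \<circ> X) \<omega> = A} = {\<omega> \<in> space M. X \<omega> \<in> A}" if "A \<in> \<alpha>" for A
    using cell_eq_iff[OF \<alpha>'(3) XS that] by auto
  have cY: "{\<omega> \<in> space M. (cell \<beta> \<circ> Y) \<omega> = B} = {\<omega> \<in> space M. Y \<omega> \<in> B}" if "B \<in> \<beta>" for B
    using cell_eq_iff[OF \<beta>'(3) YS that] by auto
  have cXY: "{\<omega> \<in> space M. ((cell \<alpha> \<circ> X) \<omega>, (cell \<beta> \<circ> Y) \<omega>) = (A, B)} =
      {\<omega> \<in> space M. X \<omega> \<in> A \<and> Y \<omega> \<in> B}" if "A \<in> \<alpha>" "B \<in> \<beta>" for A B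
    using cell_eq_iff[OF \<alpha>'(3) XS that(1)] cell_eq_iff[OF \<beta>'(3) YS that(2)] by auto
  have HX: "prob_space.entropy M 2 (count_space ((cell \<alpha> \<circ> X) ` space M)) (cell \<alpha> \<circ> X) =
      - (\<Sum>A\<in>\<alpha>. p A * log 2 (p A))"
    by (subst entropy_finite_range[OF assms(1) \<alpha>'(1)])
      (auto simp: p_def cX[unfolded o_def] mX cell_in[OF \<alpha>'(3) XS])
  have HY: "prob_space.entropy M 2 (count_space ((cell \<beta> \<circ> Y) ` space M)) (cell \<beta> \<circ> Y) =
      - (\<Sum>B\<in>\<beta>. Q B * log 2 (Q B))"
    by (subst entropy_finite_range[OF assms(1) \<beta>'(1)])
      (auto simp: Q_def cY[unfolded o_def] mY cell_in[OF \<beta>'(3) YS])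
  have HXY: "prob_space.entropy M 2 (count_space ((\<lambda>\<omega>. ((cell \<alpha> \<circ> X) \<omega>, (cell \<beta> \<circ> Y) \<omega>)) ` space M))
       (\<lambda>\<omega>. ((cell \<alpha> \<circ> X) \<omega>, (cell \<beta> \<circ> Y) \<omega>)) = - (\<Sum>(A, B)\<in>\<alpha> \<times> \<beta>. c A B * log 2 (c A B))"
  proof (subst entropy_finite_range[where C="\<alpha> \<times> \<beta>"])
    show "finite (\<alpha> \<times> \<beta>)" using \<alpha>' \<beta>' by auto
    show "((cell \<alpha> \<circ> X) \<omega>, (cell \<beta> \<circ> Y) \<omega>) \<in> \<alpha> \<times> \<beta>" if "\<omega> \<in> space M" for \<omega>
      using that by (auto simp: cell_in[OF \<alpha>'(3) XS] cell_in[OF \<beta>'(3) YS])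
    show "{\<omega> \<in> space M. ((cell \<alpha> \<circ> X) \<omega>, (cell \<beta> \<circ> Y) \<omega>) = z} \<in> sets M" if zab: "z \<in> \<alpha> \<times> \<beta>" for z
    proof -
      obtain A B where z: "z = (A, B)" "A \<in> \<alpha>" "B \<in> \<beta>" using zab by auto
      show ?thesis unfolding z(1) cXY[OF z(2,3)] by (rule mXY[OF z(2,3)])
    qed
    show "- (\<Sum>z\<in>\<alpha> \<times> \<beta>. prob {\<omega> \<in> space M. ((cell \<alpha> \<circ> X) \<omega>, (cell \<beta> \<circ> Y) \<omega>) = z} *
        log 2 (prob {\<omega> \<in> space M. ((cell \<alpha> \<circ> X) \<omega>, (cell \<beta> \<circ> Y) \<omega>) = z})) =
        - (\<Sum>(A, B)\<in>\<alpha> \<times> \<beta>. c A B * log 2 (c A B))"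
    proof (intro arg_cong[where f=uminus] sum.cong refl)
      fix z assume "z \<in> \<alpha> \<times> \<beta>"
      then obtain A B where z: "z = (A, B)" "A \<in> \<alpha>" "B \<in> \<beta>" by auto
      show "prob {\<omega> \<in> space M. ((cell \<alpha> \<circ> X) \<omega>, (cell \<beta> \<circ> Y) \<omega>) = z} *
        log 2 (prob {\<omega> \<in> space M. ((cell \<alpha> \<circ> X) \<omega>, (cell \<beta> \<circ> Y) \<omega>) = z}) =
        (case z of (A, B) \<Rightarrow> c A B * log 2 (c A B))"
        unfolding z(1) cXY[OF z(2,3)] c_def by simp
    qed
  qed (fact assms(1))
  show sB: "(\<Sum>B\<in>\<beta>. c A B) = p A" if "A \<in> \<alpha>" for A
  proof -
    have "(\<Sum>B\<in>\<beta>. measure M {\<omega> \<in> space M. Y \<omega> \<in> B \<and> \<omega> \<in> {\<omega>. X \<omega> \<in> A}}) =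
        measure M {\<omega> \<in> space M. \<omega> \<in> {\<omega>. X \<omega> \<in> A}}"
      by (rule sum_measure_partition[OF finite_measure_axioms \<beta>'(1,3)])
        (use YS mXY[OF that] in \<open>auto simp: conj_commute\<close>)
    then show ?thesis by (simp add: c_def p_def conj_commute)
  qed
  show sA: "(\<Sum>A\<in>\<alpha>. c A B) = Q B" if "B \<in> \<beta>" for B
  proof -
    have "(\<Sum>A\<in>\<alpha>. measure M {\<omega> \<in> space M. X \<omega> \<in> A \<and> \<omega> \<in> {\<omega>. Y \<omega> \<in> B}}) =
        measure M {\<omega> \<in> space M. \<omega> \<in> {\<omega>. Y \<omega> \<in> B}}"
      by (rule sum_measure_partition[OF finite_measure_axioms \<alpha>'(1,3)])
        (use XS mXY[OF _ that] in \<open>auto simp: conj_commute\<close>)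
    then show ?thesis by (simp add: c_def Q_def)
  qed
  \<comment> \<open>If \<open>c A B\<close> is positive, both marginals dominate it and the
    logarithm splits; if it is zero, every term vanishes, whatever the marginals are.\<close>
  have trm: "c A B * log 2 (c A B / (p A * Q B)) = c A B * log 2 (c A B) - c A B * log 2 (p A) - c A B * log 2 (Q B)"
    if "A \<in> \<alpha>" "B \<in> \<beta>" for A B
  proof (cases "c A B = 0")
    case False
    then have "c A B > 0" by (simp add: c_def zero_less_measure_iff)
    moreover have "c A B \<le> p A" "c A B \<le> Q B"
      using mX mY that by (auto simp: c_def p_def Q_def intro!: finite_measure_mono)
    ultimately show ?thesis by (simp add: log_divide log_mult algebra_simps)
  qed simp
  have "(\<Sum>A\<in>\<alpha>. \<Sum>B\<in>\<beta>. c A B * log 2 (c A B / (p A * Q B))) =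
      (\<Sum>A\<in>\<alpha>. \<Sum>B\<in>\<beta>. c A B * log 2 (c A B)) - (\<Sum>A\<in>\<alpha>. \<Sum>B\<in>\<beta>. c A B * log 2 (p A))
      - (\<Sum>A\<in>\<alpha>. \<Sum>B\<in>\<beta>. c A B * log 2 (Q B))"
    by (simp add: trm sum_subtractf)
  also have "(\<Sum>A\<in>\<alpha>. \<Sum>B\<in>\<beta>. c A B * log 2 (p A)) = (\<Sum>A\<in>\<alpha>. p A * log 2 (p A))"
    using sB by (simp add: sum_distrib_right[symmetric])
  also have "(\<Sum>A\<in>\<alpha>. \<Sum>B\<in>\<beta>. c A B * log 2 (Q B)) = (\<Sum>B\<in>\<beta>. Q B * log 2 (Q B))"
    by (subst sum.swap) (use sA in \<open>simp add: sum_distrib_right[symmetric]\<close>)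
  finally show "finite_mutual_information M (cell \<alpha> \<circ> X) (cell \<beta> \<circ> Y) =
    (\<Sum>A\<in>\<alpha>. \<Sum>B\<in>\<beta>. c A B * log 2 (c A B / (p A * Q B)))"
    unfolding finite_mutual_information_def HX HY HXY
    by (simp add: sum.cartesian_product)
qed

lemma (in Metric_space) mball_in_sets_borel_of: "mball x r \<in> sets (borel_of mtopology)"
proof -
  have "{U. openin mtopology U} \<subseteq> Pow (topspace mtopology)"
    using openin_subset by blast
  then show ?thesis
    unfolding borel_of_def by (simp add: sigma_sets.Basic)
qed

lemma emeasure_ennreal_finite: "finite_measure M \<Longrightarrow> emeasure M A = ennreal (measure M A)"
  by (simp add: finite_measure.emeasure_eq_measure)

subsection \<open>Cubes and their tilings\<close>

lemma cube_sets [measurable, simp]: "cube L \<in> sets borel"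
proof -
  have "cube L = (\<Inter>i. {u. 0 \<le> u $ i} \<inter> {u. u $ i < L})" by (auto simp: cube_def)
  also have "\<dots> \<in> sets borel"
    using closed_halfspace_component_ge_cart[of 0] open_halfspace_component_lt_cart[of _ L]
    by (intro sets.finite_INT sets.Int borel_closed borel_open) auto
  finally show ?thesis .
qed

lemma emeasure_cube:
  assumes "0 \<le> L"
  shows "emeasure lborel (cube L :: (real ^ 'n) set) = ennreal (L ^ CARD('n))"
proof -
  let ?b = "(\<chi> i. L) :: real ^ 'n"
  have box: "box 0 ?b \<subseteq> cube L" "cube L \<subseteq> cbox 0 ?b"
    by (auto simp: cube_def mem_box_cart less_imp_le)
  have "emeasure lborel (cbox 0 ?b) = ennreal (L ^ CARD('n))"
  proof -
    have "cbox 0 ?b \<noteq> {}" using assms by (auto simp: interval_ne_empty_cart)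
    then have "measure lborel (cbox 0 ?b) = (\<Prod>i\<in>UNIV. ?b $ i - 0 $ i)"
      by (rule content_cbox_cart)
    moreover have "emeasure lborel (cbox 0 ?b) = ennreal (measure lborel (cbox 0 ?b))"
      by (rule emeasure_eq_ennreal_measure) (use emeasure_lborel_cbox_finite[of 0 ?b] in auto)
    ultimately show ?thesis by simp
  qed
  moreover have "emeasure lborel (box 0 ?b) = emeasure lborel (cbox 0 ?b)"
    by (simp add: emeasure_lborel_box_eq emeasure_lborel_cbox_eq)
  moreover have "emeasure lborel (box 0 ?b) \<le> emeasure lborel (cube L :: (real ^ 'n) set)"
    "emeasure lborel (cube L :: (real ^ 'n) set) \<le> emeasure lborel (cbox 0 ?b)"
    using emeasure_mono[OF box(1), of lborel] emeasure_mono[OF box(2), of lborel] by simp_all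
  ultimately show ?thesis by (metis order_antisym)
qed

lemma measure_cube: "0 \<le> L \<Longrightarrow> measure lborel (cube L :: (real ^ 'n) set) = L ^ CARD('n)"
  using emeasure_cube[of L, where 'n='n] by (simp add: measure_def)

definition grid :: "nat \<Rightarrow> real \<Rightarrow> (real ^ 'n) set" where
  "grid N L = (\<lambda>k. \<chi> i. L * real (k i)) ` (PiE UNIV (\<lambda>_. {..<N}))"

lemma finite_grid [simp]: "finite (grid N L :: (real ^ 'n) set)"
  unfolding grid_def by (intro finite_imageI finite_PiE) auto

lemma card_grid:
  assumes "0 < L"
  shows "card (grid N L :: (real ^ 'n) set) = N ^ CARD('n)"
proof -
  have "inj_on (\<lambda>k. \<chi> i. L * real (k i) :: real ^ 'n) (PiE UNIV (\<lambda>_. {..<N}))"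
    using assms by (auto simp: inj_on_def vec_eq_iff fun_eq_iff)
  then show ?thesis unfolding grid_def by (simp add: card_image card_PiE)
qed

lemma grid_le:
  assumes "0 \<le> L" "v \<in> grid N L"
  shows "0 \<le> v $ i" "v $ i \<le> (real N - 1) * L"
proof -
  obtain k where k: "v = (\<chi> i. L * real (k i))" "k i < N"
    using assms(2) by (auto simp: grid_def)
  then have "real (k i) \<le> real N - 1" by linarith
  from mult_right_mono[OF this assms(1)] show "0 \<le> v $ i" "v $ i \<le> (real N - 1) * L"
    using k assms(1) by (auto simp: mult.commute)
qed

text \<open>Half-open cubes tile exactly: the tile of \<open>u\<close> is found by rounding down
  each \<open>u $ i / L\<close>, and no boundary set is left over.\<close>

lemma cube_tiling:
  assumes "0 < L"
  shows "(cube (real N * L) :: (real ^ 'n) set) = (\<Union>v\<in>grid N L. (+) v ` cube L)"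
    and "disjoint_family_on (\<lambda>v. (+) v ` cube L) (grid N L :: (real ^ 'n) set)"
proof -
  show "(cube (real N * L) :: (real ^ 'n) set) = (\<Union>v\<in>grid N L. (+) v ` cube L)"
  proof (intro subset_antisym subsetI)
    fix u :: "real ^ 'n" assume u: "u \<in> cube (real N * L)"
    define k where "k i = nat \<lfloor>u $ i / L\<rfloor>" for i
    have k: "k i < N" "0 \<le> u $ i - L * real (k i)" "u $ i - L * real (k i) < L" for i
    proof -
      have u0: "0 \<le> u $ i / L" "u $ i / L < real N"
        using u assms by (auto simp: cube_def field_simps)
      then have "real (k i) \<le> u $ i / L" "u $ i / L < real (k i) + 1"
        by (auto simp: k_def)
      then show "0 \<le> u $ i - L * real (k i)" "u $ i - L * real (k i) < L"
        using assms by (auto simp: field_simps)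
      show "k i < N" using u0 \<open>real (k i) \<le> u $ i / L\<close> by linarith
    qed
    have "(\<chi> i. L * real (k i)) \<in> grid N L"
      unfolding grid_def using k(1) by auto
    moreover have "u = (\<chi> i. L * real (k i)) + (u - (\<chi> i. L * real (k i)))" by simp
    moreover have "u - (\<chi> i. L * real (k i)) \<in> cube L"
      using k by (auto simp: cube_def)
    ultimately show "u \<in> (\<Union>v\<in>grid N L. (+) v ` cube L)" by blast
  next
    fix u :: "real ^ 'n" assume "u \<in> (\<Union>v\<in>grid N L. (+) v ` cube L)"
    then obtain v w where v: "v \<in> grid N L" and w: "w \<in> cube L" and u: "u = v + w" by auto
    have "0 \<le> u $ i \<and> u $ i < real N * L" for i
    proof -
      have "0 \<le> w $ i" "w $ i < L" using w by (auto simp: cube_def)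
      with grid_le[OF less_imp_le[OF assms] v, of i] show ?thesis by (simp add: u algebra_simps)
    qed
    then show "u \<in> cube (real N * L)" by (simp add: cube_def)
  qed
  show "disjoint_family_on (\<lambda>v. (+) v ` cube L) (grid N L :: (real ^ 'n) set)"
  proof (unfold disjoint_family_on_def, intro ballI impI)
    fix v v' :: "real ^ 'n" assume v: "v \<in> grid N L" "v' \<in> grid N L" "v \<noteq> v'"
    obtain k k' where k: "v = (\<chi> i. L * real (k i))" "v' = (\<chi> i. L * real (k' i))"
      using v by (auto simp: grid_def)
    show "(+) v ` cube L \<inter> (+) v' ` cube L = {}"
    proof (rule ccontr)
      assume "(+) v ` cube L \<inter> (+) v' ` cube L \<noteq> {}"
      then obtain w w' where w: "w \<in> cube L" "w' \<in> cube L" "v + w = v' + w'" by auto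
      have "k i = k' i" for i
      proof -
        have e: "L * real (k i) + w $ i = L * real (k' i) + w' $ i"
          using arg_cong[OF w(3), of "\<lambda>u. u $ i"] k by simp
        have "0 \<le> w $ i" "w $ i < L" "0 \<le> w' $ i" "w' $ i < L"
          using w by (auto simp: cube_def)
        then have "\<bar>L * (real (k i) - real (k' i))\<bar> < L" using e by (simp add: right_diff_distrib)
        then have "\<bar>real (k i) - real (k' i)\<bar> < 1"
          using assms by (simp add: abs_mult)
        then show ?thesis by linarith
      qed
      then show False using v(3) k by simp
    qed
  qed
qed

lemma cube_mono: "L \<le> L' \<Longrightarrow> cube L \<subseteq> cube L'"
  unfolding cube_def by (auto intro: less_le_trans)

subsection \<open>Finite test channels\<close>

text \<open>A compact metric space is Polish; the sort \<open>polish_space\<close> records this at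
  the level of types. Its second countability makes the Borel sigma-algebra of a product the product
  of the Borel sigma-algebras.\<close>

locale compact_action =
  fixes T :: "real ^ 'n \<Rightarrow> 'a::polish_space \<Rightarrow> 'a"
  assumes compact_UNIV: "compact (UNIV :: 'a set)"
    and action: "continuous_action T"
begin

lemma T_add: "T (u + v) x = T u (T v x)"
  using action by (auto simp: continuous_action_def)

lemma continuous_T: "continuous_on UNIV (\<lambda>z. T (fst z) (snd z))"
  using action by (simp add: continuous_action_def case_prod_unfold)

lemma continuous_T_snd: "continuous_on UNIV (T u)"
  using continuous_on_compose2[OF continuous_T continuous_on_Pair[OF continuous_on_const continuous_on_id]]
  by simp

lemma T_measurable2 [measurable (raw)]:
  assumes [measurable]: "f \<in> measurable M borel" "g \<in> measurable M borel"
  shows "(\<lambda>x. T (f x) (g x)) \<in> measurable M borel"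
proof -
  have "(\<lambda>z. T (fst z) (snd z)) \<in> measurable (borel \<Otimes>\<^sub>M borel) borel"
    unfolding borel_prod by (rule borel_measurable_continuous_onI[OF continuous_T])
  from measurable_compose[OF measurable_Pair[OF assms] this] show ?thesis by simp
qed

section \<open>Distortion of a fixed codeword over a region\<close>

definition diam_space :: real where "diam_space = diameter (UNIV :: 'a set)"

lemma dist_le_diam: "dist (x :: 'a) y \<le> diam_space"
  unfolding diam_space_def using diameter_bounded_bound[OF compact_imp_bounded[OF compact_UNIV]] by auto

lemma diam_space_nonneg: "0 \<le> diam_space"
  using dist_le_diam[of undefined undefined] by simp

text \<open>Integrated over a region and not averaged over a cube, so that it is additive over
  disjoint regions. Division by the volume is deferred.\<close>

definition dcost :: "(real ^ 'n) set \<Rightarrow> 'a \<Rightarrow> (real ^ 'n \<Rightarrow> 'a) \<Rightarrow> real" where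
  "dcost A x y = (LINT u:A|lborel. dist (T u x) (y u))"

definition region :: "(real ^ 'n) set \<Rightarrow> bool" where
  "region A \<longleftrightarrow> A \<in> sets borel \<and> emeasure lborel A < \<infinity>"

lemma regionD [measurable_dest]: "region A \<Longrightarrow> A \<in> sets borel"
  by (simp add: region_def)

lemma region_empty: "region {}" by (simp add: region_def)

lemma region_Un: "region A \<Longrightarrow> region B \<Longrightarrow> region (A \<union> B)"
  by (auto simp: region_def intro!: order.strict_trans1[OF emeasure_subadditive] ennreal_add_less_top)

lemma region_Diff: "region A \<Longrightarrow> B \<in> sets borel \<Longrightarrow> region (A - B)"
  unfolding region_def
  by (metis Diff_subset emeasure_mono order.strict_trans1 sets.Diff sets_lborel)

lemma region_cube: "region (cube L)"
proof -
  have "emeasure lborel (cube L :: (real ^ 'n) set) \<le> emeasure lborel (cube (max L 0) :: (real ^ 'n) set)"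
    by (intro emeasure_mono cube_mono) auto
  also have "\<dots> < \<infinity>" by (subst emeasure_cube) auto
  finally show ?thesis by (simp add: region_def)
qed

lemma region_translate:
  assumes "region A"
  shows "region ((+) v ` A)" "emeasure lborel ((+) v ` A) = emeasure lborel A"
proof -
  have eq: "(+) v ` A = (\<lambda>u. - v + u) -` A" by (force simp: image_iff)
  have m: "(\<lambda>u. - v + u) -` A \<in> sets borel"
    using assms measurable_sets[of "\<lambda>u. - v + u" borel borel A] by (auto simp: region_def)
  have "emeasure lborel A = emeasure (distr lborel borel ((+) (- v))) A"
    by (simp add: lborel_distr_plus)
  also have "\<dots> = emeasure lborel ((\<lambda>u. - v + u) -` A)"
    using assms by (subst emeasure_distr) (auto simp: region_def)
  finally show "emeasure lborel ((+) v ` A) = emeasure lborel A" by (simp add: eq)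
  then show "region ((+) v ` A)" using assms m eq by (simp add: region_def)
qed

lemma dcost_integrable:
  assumes "region A" and [measurable]: "y \<in> borel_measurable borel"
  shows "set_integrable lborel A (\<lambda>u. dist (T u x) (y u))"
proof (rule set_integrable_bound[where f="\<lambda>_. diam_space"])
  show "set_integrable lborel A (\<lambda>_. diam_space)"
    using assms by (auto simp: set_integrable_def region_def)
  show "set_borel_measurable lborel A (\<lambda>u. dist (T u x) (y u))"
    using assms(1) by (auto simp: set_borel_measurable_def)
qed (use dist_le_diam diam_space_nonneg in \<open>auto intro!: AE_I2\<close>)

lemma dcost_nonneg: "0 \<le> dcost A x y"
  unfolding dcost_def set_lebesgue_integral_def by (intro Bochner_Integration.integral_nonneg) auto

lemma dcost_le:
  assumes "region A" "y \<in> borel_measurable borel"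
  shows "dcost A x y \<le> diam_space * measure lborel A"
proof -
  have "dcost A x y \<le> (LINT u:A|lborel. diam_space)"
    unfolding dcost_def using assms dist_le_diam
    by (intro set_integral_mono dcost_integrable) (auto simp: set_integrable_def region_def)
  also have "\<dots> = diam_space * measure lborel A"
    using assms by (subst set_integral_const) (auto simp: region_def)
  finally show ?thesis .
qed

lemma dcost_measurable [measurable]:
  assumes [measurable]: "region A" "y \<in> borel_measurable borel"
  shows "(\<lambda>x. dcost A x y) \<in> borel_measurable borel"
  unfolding dcost_def set_lebesgue_integral_def by measurable

lemma dcost_Un:
  assumes "region A" "region B" "A \<inter> B = {}"
    and "y1 \<in> borel_measurable borel" "y2 \<in> borel_measurable borel"
  shows "dcost (A \<union> B) x (\<lambda>u. if u \<in> A then y1 u else y2 u) = dcost A x y1 + dcost B x y2"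
proof -
  have m: "(\<lambda>u. if u \<in> A then y1 u else y2 u) \<in> borel_measurable borel"
    using assms by (intro measurable_If_set) (auto simp: region_def)
  have "dcost (A \<union> B) x (\<lambda>u. if u \<in> A then y1 u else y2 u) =
      (LINT u:A|lborel. dist (T u x) (if u \<in> A then y1 u else y2 u)) +
      (LINT u:B|lborel. dist (T u x) (if u \<in> A then y1 u else y2 u))"
    unfolding dcost_def using dcost_integrable[OF assms(1) m] dcost_integrable[OF assms(2) m] assms(3)
    by (intro set_integral_Un) auto
  also have "(LINT u:A|lborel. dist (T u x) (if u \<in> A then y1 u else y2 u)) = dcost A x y1"
    unfolding dcost_def set_lebesgue_integral_def by (intro Bochner_Integration.integral_cong) (auto simp: indicator_def)
  also have "(LINT u:B|lborel. dist (T u x) (if u \<in> A then y1 u else y2 u)) = dcost B x y2"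
    unfolding dcost_def set_lebesgue_integral_def using assms(3)
    by (intro Bochner_Integration.integral_cong) (auto simp: indicator_def)
  finally show ?thesis .
qed

text \<open>A substitution moves the translation from the region to the input, by the action law.
  This is how a channel on one tile is carried to all others.\<close>

lemma dcost_translate:
  assumes "region A" and [measurable]: "y \<in> borel_measurable borel"
  shows "dcost ((+) v ` A) x (\<lambda>u. y (u - v)) = dcost A (T v x) y"
proof -
  have [measurable]: "(+) v ` A \<in> sets borel" using region_translate(1)[OF assms(1)] by (rule regionD)
  have "dcost ((+) v ` A) x (\<lambda>u. y (u - v)) =
      (\<integral>u. indicator ((+) v ` A) u *\<^sub>R dist (T u x) (y (u - v)) \<partial>distr lborel borel ((+) v))"
    unfolding dcost_def set_lebesgue_integral_def by (simp add: lborel_distr_plus)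
  also have "\<dots> = (\<integral>u. indicator ((+) v ` A) (v + u) *\<^sub>R dist (T (v + u) x) (y (v + u - v)) \<partial>lborel)"
    by (rule integral_distr) auto
  also have "\<dots> = dcost A (T v x) y"
    unfolding dcost_def set_lebesgue_integral_def
    by (intro Bochner_Integration.integral_cong refl)
      (auto simp: indicator_def T_add[of _ v] add.commute[of v] image_iff)
  finally show ?thesis .
qed

text \<open>
  A finite test channel with transition weights \<open>W i x\<close>, codewords \<open>y i\<close> and a reference output
  distribution \<open>q\<close>.  Measuring the information against \<open>q\<close> instead of the true output
  distribution makes it the integral of a function of the input, hence affine in the input law.
\<close>

definition chan :: "(real ^ 'n) set \<Rightarrow> ('a \<Rightarrow> real) \<Rightarrow> ('a \<Rightarrow> real) \<Rightarrow> bool" where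
  "chan A j c \<longleftrightarrow> (\<exists>(m::nat) W q y.
     (\<forall>i<m. W i \<in> borel_measurable borel \<and> (\<forall>x. 0 \<le> W i x) \<and> 0 < q i \<and> y i \<in> borel_measurable borel) \<and>
     (\<forall>x. (\<Sum>i<m. W i x) = 1) \<and> (\<Sum>i<m. q i) \<le> 1 \<and>
     j = (\<lambda>x. \<Sum>i<m. W i x * log 2 (W i x / q i)) \<and>
     c = (\<lambda>x. \<Sum>i<m. W i x * dcost A x (y i)))"

text \<open>Admits any finite index set, as product channels require; the definition uses initial
  segments of \<open>nat\<close> because it cannot quantify over a type.\<close>

lemma chanI:
  assumes "finite I"
    and "\<And>i. i \<in> I \<Longrightarrow> W i \<in> borel_measurable borel" "\<And>i x. i \<in> I \<Longrightarrow> 0 \<le> W i x"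
    and "\<And>i. i \<in> I \<Longrightarrow> 0 < q i" "\<And>i. i \<in> I \<Longrightarrow> y i \<in> borel_measurable borel"
    and "\<And>x. (\<Sum>i\<in>I. W i x) = 1" "(\<Sum>i\<in>I. q i) \<le> 1"
    and "\<And>x. j x = (\<Sum>i\<in>I. W i x * log 2 (W i x / q i))"
    and "\<And>x. c x = (\<Sum>i\<in>I. W i x * dcost A x (y i))"
  shows "chan A j c"
proof -
  obtain h where h: "bij_betw h {..<card I} I"
    using ex_bij_betw_nat_finite[OF assms(1)] by (auto simp: atLeast0LessThan)
  have hI: "h i \<in> I" if "i < card I" for i using h that by (auto simp: bij_betw_def)
  have s: "(\<Sum>i<card I. F (h i)) = sum F I" for F :: "'b \<Rightarrow> real"
    by (rule sum.reindex_bij_betw[OF h])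
  show ?thesis unfolding chan_def
    using assms hI
    by (intro exI[of _ "card I"] exI[of _ "\<lambda>i. W (h i)"] exI[of _ "\<lambda>i. q (h i)"] exI[of _ "\<lambda>i. y (h i)"])
      (auto simp: s[of "\<lambda>i. W i _ * log 2 (W i _ / q i)"] s[of "\<lambda>i. W i _ * dcost A _ (y i)"]
        s[of "\<lambda>i. W i _"] s[of q])
qed

text \<open>One letter with reference weight one has information
  \<open>1 * log 2 (1 / 1) = 0\<close>. Such a channel fills leftover volume and stands in for
  omitted channels, where the diameter bound on its cost is all that matters.\<close>

lemma chan_trivial:
  assumes "region A"
  shows "\<exists>c. chan A (\<lambda>_. 0) c"
  by (rule exI[of _ "\<lambda>x. dcost A x (\<lambda>_. undefined)"],
      rule chanI[of "{()}" "\<lambda>_ _. 1" "\<lambda>_. 1" "\<lambda>_ _. undefined"]) simp_all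

lemma chan_bounded:
  assumes "chan A j c" "region A"
  shows "j \<in> borel_measurable borel" "c \<in> borel_measurable borel"
    "\<And>x. 0 \<le> j x" "\<exists>K. \<forall>x. j x \<le> K" "\<And>x. 0 \<le> c x" "\<And>x. c x \<le> diam_space * measure lborel A"
proof -
  obtain m :: nat and W q y where W: "\<And>i. i < m \<Longrightarrow> W i \<in> borel_measurable borel"
      "\<And>i x. i < m \<Longrightarrow> 0 \<le> W i x" "\<And>i. i < m \<Longrightarrow> 0 < q i" "\<And>i. i < m \<Longrightarrow> y i \<in> borel_measurable borel"
      "\<And>x. (\<Sum>i<m. W i x) = 1" "(\<Sum>i<m. q i) \<le> 1"
    and j: "j = (\<lambda>x. \<Sum>i<m. W i x * log 2 (W i x / q i))"
    and c: "c = (\<lambda>x. \<Sum>i<m. W i x * dcost A x (y i))"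
    using assms(1) unfolding chan_def by blast
  show "j \<in> borel_measurable borel" "c \<in> borel_measurable borel"
    unfolding j c using W dcost_measurable[OF assms(2)]
    by (auto intro!: borel_measurable_sum borel_measurable_times borel_measurable_log borel_measurable_divide
        simp: borel_measurable_const)
  have W1: "W i x \<le> 1" if "i < m" for i x
    using member_le_sum[of i "{..<m}" "\<lambda>i. W i x"] W(2,5) that by auto
  show "0 \<le> j x" for x
  proof -
    \<comment> \<open>The tangent with \<open>r = 1\<close> bounds each term below by
      \<open>W i x - q i\<close>; the weights sum to one and \<open>q\<close> to at most
      one.\<close>
    have "(\<Sum>i<m. W i x - q i) \<le> (\<Sum>i<m. W i x * ln (W i x / q i))"
      using mult_ln_ge_tangent[of "W _ x" "q _" 1] W by (intro sum_mono) auto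
    moreover have "(\<Sum>i<m. W i x - q i) \<ge> 0" using W(5,6) by (simp add: sum_subtractf)
    moreover have "j x = (\<Sum>i<m. W i x * ln (W i x / q i)) / ln 2"
      by (simp add: j log_def sum_divide_distrib)
    ultimately show ?thesis by simp
  qed
  \<comment> \<open>Positivity of the \<open>q i\<close> and \<open>W i x \<le> 1\<close> bound the
    information uniformly in \<open>x\<close>; this makes \<open>j\<close> integrable against every
    finite measure.\<close>
  have "j x \<le> (\<Sum>i<m. \<bar>log 2 (1 / q i)\<bar>)" for x
    unfolding j
  proof (rule sum_mono)
    fix i assume "i \<in> {..<m}"
    then have i: "i < m" by simp
    show "W i x * log 2 (W i x / q i) \<le> \<bar>log 2 (1 / q i)\<bar>"
    proof (cases "W i x = 0")
      case False
      then have pos: "W i x > 0" using W(2)[OF i, of x] by simp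
      have "log 2 (W i x / q i) \<le> log 2 (1 / q i)"
        using pos W(3)[OF i] W1[OF i, of x] by (simp add: log_le_cancel_iff divide_right_mono)
      then have "W i x * log 2 (W i x / q i) \<le> W i x * \<bar>log 2 (1 / q i)\<bar>"
        using pos by (intro mult_left_mono) auto
      also have "\<dots> \<le> 1 * \<bar>log 2 (1 / q i)\<bar>" using W1[OF i] by (intro mult_right_mono) auto
      finally show ?thesis by simp
    qed simp
  qed
  then show "\<exists>K. \<forall>x. j x \<le> K" by blast
  show "0 \<le> c x" for x unfolding c using W(2) dcost_nonneg by (intro sum_nonneg mult_nonneg_nonneg) auto
  show "c x \<le> diam_space * measure lborel A" for x
  proof -
    have "c x \<le> (\<Sum>i<m. W i x * (diam_space * measure lborel A))"
      unfolding c using W dcost_le[OF assms(2)] by (intro sum_mono mult_left_mono) auto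
    also have "\<dots> = diam_space * measure lborel A"
      using W(5)[of x] by (simp add: sum_distrib_right[symmetric])
    finally show ?thesis .
  qed
qed

lemma chan_integrable:
  assumes "chan A j c" "region A" "finite_measure \<rho>" "sets \<rho> = sets borel"
  shows "integrable \<rho> j" "integrable \<rho> c"
proof -
  interpret finite_measure \<rho> by fact
  note b = chan_bounded[OF assms(1,2)]
  obtain K where "\<And>x. j x \<le> K" using b(4) by blast
  then show "integrable \<rho> j" using b(1,3) assms(4)
    by (intro integrable_const_bound[of _ K]) (auto simp: measurable_cong_sets[OF assms(4) refl])
  show "integrable \<rho> c" using b(2,5,6) assms(4)
    by (intro integrable_const_bound[of _ "diam_space * measure lborel A"])
      (auto simp: measurable_cong_sets[OF assms(4) refl])
qed

text \<open>Given the input, the two regions are coded independently. The reference law is a product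
  as well, so the logarithms add even though the two outputs depend on each other through
  \<open>x\<close>.\<close>

lemma chan_Un:
  assumes "chan A j1 c1" "chan B j2 c2" "region A" "region B" "A \<inter> B = {}"
  shows "chan (A \<union> B) (\<lambda>x. j1 x + j2 x) (\<lambda>x. c1 x + c2 x)"
proof -
  obtain m :: nat and W q y where W: "\<And>i. i < m \<Longrightarrow> W i \<in> borel_measurable borel"
      "\<And>i x. i < m \<Longrightarrow> 0 \<le> W i x" "\<And>i. i < m \<Longrightarrow> 0 < q i" "\<And>i. i < m \<Longrightarrow> y i \<in> borel_measurable borel"
      "\<And>x. (\<Sum>i<m. W i x) = 1" "(\<Sum>i<m. q i) \<le> 1"
    and j1: "j1 = (\<lambda>x. \<Sum>i<m. W i x * log 2 (W i x / q i))"
    and c1: "c1 = (\<lambda>x. \<Sum>i<m. W i x * dcost A x (y i))"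
    using assms(1) unfolding chan_def by blast
  obtain n :: nat and V p z where V: "\<And>i. i < n \<Longrightarrow> V i \<in> borel_measurable borel"
      "\<And>i x. i < n \<Longrightarrow> 0 \<le> V i x" "\<And>i. i < n \<Longrightarrow> 0 < p i" "\<And>i. i < n \<Longrightarrow> z i \<in> borel_measurable borel"
      "\<And>x. (\<Sum>i<n. V i x) = 1" "(\<Sum>i<n. p i) \<le> 1"
    and j2: "j2 = (\<lambda>x. \<Sum>i<n. V i x * log 2 (V i x / p i))"
    and c2: "c2 = (\<lambda>x. \<Sum>i<n. V i x * dcost B x (z i))"
    using assms(2) unfolding chan_def by blast
  have sp: "(\<Sum>(i, k)\<in>{..<m} \<times> {..<n}. f i * g k) = sum f {..<m} * sum g {..<n}" for f g :: "nat \<Rightarrow> real"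
    by (simp add: sum_product sum.cartesian_product)
  \<comment> \<open>Each summand involves one letter only; the other is summed out because the
    weights of a channel add up to one.\<close>
  have split: "(\<Sum>(i, k)\<in>{..<m} \<times> {..<n}. W i x * V k x * (f i + g k)) =
      (\<Sum>i<m. W i x * f i) + (\<Sum>k<n. V k x * g k)" for x and f g :: "nat \<Rightarrow> real"
  proof -
    have "(\<Sum>(i, k)\<in>{..<m} \<times> {..<n}. W i x * V k x * (f i + g k)) =
        (\<Sum>(i, k)\<in>{..<m} \<times> {..<n}. (W i x * f i) * V k x) + (\<Sum>(i, k)\<in>{..<m} \<times> {..<n}. W i x * (V k x * g k))"
      by (simp add: sum.distrib[symmetric] case_prod_unfold algebra_simps)
    then show ?thesis unfolding sp using W(5) V(5) by simp
  qed
  show ?thesis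
  proof (rule chanI[where I="{..<m} \<times> {..<n}" and W="\<lambda>(i, k) x. W i x * V k x" and q="\<lambda>(i, k). q i * p k"
        and y="\<lambda>(i, k) u. if u \<in> A then y i u else z k u"])
    show "(\<Sum>i\<in>{..<m} \<times> {..<n}. (case i of (i, k) \<Rightarrow> \<lambda>x. W i x * V k x) x) = 1" for x
      using sp[of "\<lambda>i. W i x" "\<lambda>k. V k x"] W(5) V(5) by (simp add: case_prod_unfold)
    have "sum q {..<m} * sum p {..<n} \<le> 1 * 1"
      using W V by (intro mult_mono) (auto intro!: sum_nonneg simp: less_imp_le)
    then show "(\<Sum>(i, k)\<in>{..<m} \<times> {..<n}. q i * p k) \<le> 1" using sp by simp
    show "(case i of (i, k) \<Rightarrow> \<lambda>u. if u \<in> A then y i u else z k u) \<in> borel_measurable borel"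
      if "i \<in> {..<m} \<times> {..<n}" for i
      using that W(4) V(4) assms(3) by (auto intro!: measurable_If_set simp: region_def)
    show "j1 x + j2 x = (\<Sum>i\<in>{..<m} \<times> {..<n}. (case i of (i, k) \<Rightarrow> \<lambda>x. W i x * V k x) x *
        log 2 ((case i of (i, k) \<Rightarrow> \<lambda>x. W i x * V k x) x / (case i of (i, k) \<Rightarrow> q i * p k)))" for x
    proof -
      have "j1 x + j2 x = (\<Sum>(i, k)\<in>{..<m} \<times> {..<n}. W i x * V k x * (log 2 (W i x / q i) + log 2 (V k x / p k)))"
        unfolding j1 j2 split ..
      also have "\<dots> = (\<Sum>(i, k)\<in>{..<m} \<times> {..<n}. W i x * V k x * log 2 (W i x * V k x / (q i * p k)))"
      proof (intro sum.cong refl, unfold case_prod_unfold)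
        fix z assume "z \<in> {..<m} \<times> {..<n}"
        then obtain i k where z: "z = (i, k)" and ik: "i < m" "k < n" by auto
        have "log 2 (W i x / q i) + log 2 (V k x / p k) = log 2 (W i x * V k x / (q i * p k))"
          if "W i x \<noteq> 0" "V k x \<noteq> 0"
        proof -
          have "0 < W i x" "0 < V k x" using that W(2)[OF ik(1), of x] V(2)[OF ik(2), of x] by auto
          then show ?thesis
            using W(3)[OF ik(1)] V(3)[OF ik(2)] by (simp add: log_mult log_divide)
        qed
        then show "W (fst z) x * V (snd z) x * (log 2 (W (fst z) x / q (fst z)) + log 2 (V (snd z) x / p (snd z))) =
            W (fst z) x * V (snd z) x * log 2 (W (fst z) x * V (snd z) x / (q (fst z) * p (snd z)))"
          unfolding z fst_conv snd_conv by (metis mult_eq_0_iff)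
      qed
      finally show ?thesis by (simp add: case_prod_unfold)
    qed
    show "c1 x + c2 x = (\<Sum>i\<in>{..<m} \<times> {..<n}. (case i of (i, k) \<Rightarrow> \<lambda>x. W i x * V k x) x *
        dcost (A \<union> B) x (case i of (i, k) \<Rightarrow> \<lambda>u. if u \<in> A then y i u else z k u))" for x
    proof -
      have "c1 x + c2 x = (\<Sum>(i, k)\<in>{..<m} \<times> {..<n}. W i x * V k x * (dcost A x (y i) + dcost B x (z k)))"
        unfolding c1 c2 split ..
      also have "\<dots> = (\<Sum>(i, k)\<in>{..<m} \<times> {..<n}. W i x * V k x *
          dcost (A \<union> B) x (\<lambda>u. if u \<in> A then y i u else z k u))"
        using dcost_Un[OF assms(3-5)] W(4) V(4) by (intro sum.cong refl) auto
      finally show ?thesis by (simp add: case_prod_unfold)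
    qed
  qed (use W V in \<open>auto intro!: borel_measurable_times\<close>)
qed

lemma chan_translate:
  assumes "chan A j c" "region A"
  shows "chan ((+) v ` A) (\<lambda>x. j (T v x)) (\<lambda>x. c (T v x))"
proof -
  obtain m :: nat and W q y where W: "\<And>i. i < m \<Longrightarrow> W i \<in> borel_measurable borel"
      "\<And>i x. i < m \<Longrightarrow> 0 \<le> W i x" "\<And>i. i < m \<Longrightarrow> 0 < q i" "\<And>i. i < m \<Longrightarrow> y i \<in> borel_measurable borel"
      "\<And>x. (\<Sum>i<m. W i x) = 1" "(\<Sum>i<m. q i) \<le> 1"
    and j: "j = (\<lambda>x. \<Sum>i<m. W i x * log 2 (W i x / q i))"
    and c: "c = (\<lambda>x. \<Sum>i<m. W i x * dcost A x (y i))"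
    using assms(1) unfolding chan_def by blast
  have Tv: "T v \<in> borel_measurable borel" by measurable
  show ?thesis
  proof (rule chanI[where I="{..<m}" and W="\<lambda>i x. W i (T v x)" and q=q and y="\<lambda>i u. y i (u - v)"])
    show "(\<lambda>x. W i (T v x)) \<in> borel_measurable borel" if "i \<in> {..<m}" for i
      by (rule measurable_compose[OF Tv W(1)]) (use that in simp)
    show "(\<lambda>u. y i (u - v)) \<in> borel_measurable borel" if "i \<in> {..<m}" for i
    proof (rule measurable_compose[OF _ W(4)])
      show "(\<lambda>u. u - v) \<in> borel_measurable borel" by measurable
    qed (use that in simp)
    show "c (T v x) = (\<Sum>i<m. W i (T v x) * dcost ((+) v ` A) x (\<lambda>u. y i (u - v)))" for x
      unfolding c by (intro sum.cong refl) (simp add: dcost_translate[OF assms(2) W(4)])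
    show "j (T v x) = (\<Sum>i<m. W i (T v x) * log 2 (W i (T v x) / q i))" for x
      unfolding j ..
  qed (simp_all add: W)
qed

lemma chan_UN:
  assumes "finite V" "disjoint_family_on (\<lambda>v. (+) v ` A) V" "chan A j c" "region A"
  shows "chan (\<Union>v\<in>V. (+) v ` A) (\<lambda>x. \<Sum>v\<in>V. j (T v x)) (\<lambda>x. \<Sum>v\<in>V. c (T v x)) \<and> region (\<Union>v\<in>V. (+) v ` A)"
  using assms(1,2)
proof (induction V rule: finite_induct)
  case empty
  have "chan {} (\<lambda>_. 0) (\<lambda>_. 0)"
    by (rule chanI[of "{()}" "\<lambda>_ _. 1" "\<lambda>_. 1" "\<lambda>_ _. undefined"])
      (auto simp: dcost_def set_lebesgue_integral_def)
  then show ?case by (simp add: region_empty)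
next
  case (insert v V)
  have IH: "chan (\<Union>v\<in>V. (+) v ` A) (\<lambda>x. \<Sum>v\<in>V. j (T v x)) (\<lambda>x. \<Sum>v\<in>V. c (T v x))"
    "region (\<Union>v\<in>V. (+) v ` A)"
    using insert by (auto simp: disjoint_family_on_def)
  have "(+) v ` A \<inter> (\<Union>v\<in>V. (+) v ` A) = {}"
    using insert.prems insert.hyps by (fastforce simp: disjoint_family_on_def)
  from chan_Un[OF chan_translate[OF assms(3,4)] IH(1) region_translate(1)[OF assms(4)] IH(2) this]
    region_Un[OF region_translate(1)[OF assms(4)] IH(2)]
  show ?case using insert by simp
qed

text \<open>The total mass is left free because the pieces of a mixture are invariant measures of
  mass at most one.\<close>

definition invariant_finite :: "'a measure \<Rightarrow> bool" where
  "invariant_finite \<rho> \<longleftrightarrow> finite_measure \<rho> \<and> sets \<rho> = sets borel \<and> (\<forall>u. distr \<rho> borel (T u) = \<rho>)"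

lemma invariant_integral:
  assumes "invariant_finite \<rho>" "f \<in> borel_measurable borel"
  shows "(\<integral>x. f (T u x) \<partial>\<rho>) = (\<integral>x. f x \<partial>\<rho> :: real)"
proof -
  have s: "sets \<rho> = sets borel" and d: "distr \<rho> borel (T u) = \<rho>"
    using assms(1) by (auto simp: invariant_finite_def)
  have "T u \<in> borel_measurable borel" by measurable
  then have "T u \<in> measurable \<rho> borel" by (simp add: measurable_cong_sets[OF s refl])
  from integral_distr[OF this assms(2)] d show ?thesis by simp
qed

text \<open>By invariance all translates of the channel have the same integrals, so
  \<open>N ^ CARD('n)\<close> tiles multiply both. The collar outside the tiles receives the
  one-letter channel: no information, and cost at most the diameter times its volume. The new
  channel is chosen before \<open>\<rho>\<close>.\<close>

lemma chan_tile:
  assumes "chan (cube L\<^sub>0) j c" "0 < L\<^sub>0" "real N * L\<^sub>0 \<le> L"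
  obtains j' c' where "chan (cube L) j' c'"
    "\<And>\<rho>. invariant_finite \<rho> \<Longrightarrow> (\<integral>x. j' x \<partial>\<rho>) = real N ^ CARD('n) * (\<integral>x. j x \<partial>\<rho>)"
    "\<And>\<rho>. invariant_finite \<rho> \<Longrightarrow> (\<integral>x. c' x \<partial>\<rho>) \<le> real N ^ CARD('n) * (\<integral>x. c x \<partial>\<rho>) +
        diam_space * (L ^ CARD('n) - (real N * L\<^sub>0) ^ CARD('n)) * measure \<rho> UNIV"
proof -
  let ?V = "grid N L\<^sub>0 :: (real ^ 'n) set"
  have tiles: "chan (cube (real N * L\<^sub>0)) (\<lambda>x. \<Sum>v\<in>?V. j (T v x)) (\<lambda>x. \<Sum>v\<in>?V. c (T v x))"
  proof -
    have eq: "(\<Union>v\<in>?V. (+) v ` cube L\<^sub>0) = cube (real N * L\<^sub>0)"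
      by (rule cube_tiling(1)[OF assms(2), symmetric])
    have "chan (\<Union>v\<in>?V. (+) v ` cube L\<^sub>0) (\<lambda>x. \<Sum>v\<in>?V. j (T v x)) (\<lambda>x. \<Sum>v\<in>?V. c (T v x))"
      by (rule conjunct1[OF chan_UN[OF finite_grid cube_tiling(2)[OF assms(2)] assms(1) region_cube]])
    then show ?thesis unfolding eq .
  qed
  let ?R = "cube L - cube (real N * L\<^sub>0) :: (real ^ 'n) set"
  have R: "region ?R" by (intro region_Diff region_cube) auto
  obtain c0 where c0: "chan ?R (\<lambda>_. 0) c0" using chan_trivial[OF R] by blast
  have "cube (real N * L\<^sub>0) \<union> ?R = cube L" using cube_mono[OF assms(3)] by auto
  with chan_Un[OF tiles c0 region_cube R]
  have ch: "chan (cube L) (\<lambda>x. \<Sum>v\<in>?V. j (T v x)) (\<lambda>x. (\<Sum>v\<in>?V. c (T v x)) + c0 x)" by auto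
  have N0: "0 \<le> real N * L\<^sub>0" using assms(2) by simp
  have mR: "measure lborel ?R = L ^ CARD('n) - (real N * L\<^sub>0) ^ CARD('n)"
  proof -
    have "emeasure lborel (cube L :: (real ^ 'n) set) \<noteq> \<infinity>"
      using region_cube[of L] by (simp add: region_def)
    from measure_Diff[OF this _ _ cube_mono[OF assms(3)]] show ?thesis
      using measure_cube[where 'n='n, OF N0] measure_cube[where 'n='n, of L] assms(3) N0 by simp
  qed
  note b = chan_bounded[OF assms(1) region_cube]
  show ?thesis
  proof (rule that[OF ch])
    fix \<rho> assume \<rho>: "invariant_finite \<rho>"
    then interpret finite_measure \<rho> by (simp add: invariant_finite_def)
    have s: "sets \<rho> = sets borel" using \<rho> by (simp add: invariant_finite_def)
    have i: "integrable \<rho> (\<lambda>x. j (T v x))" "integrable \<rho> (\<lambda>x. c (T v x))" for v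
      using chan_integrable[OF chan_translate[OF assms(1) region_cube] region_translate(1)[OF region_cube]
        finite_measure_axioms s] by auto
    have card: "real (card ?V) = real N ^ CARD('n)" by (simp add: card_grid[OF assms(2)])
    show "(\<integral>x. (\<Sum>v\<in>?V. j (T v x)) \<partial>\<rho>) = real N ^ CARD('n) * (\<integral>x. j x \<partial>\<rho>)"
      using i by (simp add: invariant_integral[OF \<rho> b(1)] card)
    have "(\<integral>x. c0 x \<partial>\<rho>) \<le> (\<integral>x. diam_space * measure lborel ?R \<partial>\<rho>)"
      by (intro integral_mono chan_integrable(2)[OF c0 R finite_measure_axioms s]) (auto intro: chan_bounded(6)[OF c0 R])
    also have "\<dots> = diam_space * (L ^ CARD('n) - (real N * L\<^sub>0) ^ CARD('n)) * measure \<rho> UNIV"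
      using mR sets_eq_imp_space_eq[OF s] by simp
    finally show "(\<integral>x. (\<Sum>v\<in>?V. c (T v x)) + c0 x \<partial>\<rho>) \<le> real N ^ CARD('n) * (\<integral>x. c x \<partial>\<rho>) +
        diam_space * (L ^ CARD('n) - (real N * L\<^sub>0) ^ CARD('n)) * measure \<rho> UNIV"
      using i chan_integrable(2)[OF c0 R finite_measure_axioms s]
      by (simp add: invariant_integral[OF \<rho> b(2)] card Bochner_Integration.integral_add)
  qed
qed

end

subsection \<open>Achievability\<close>

text \<open>Supplies the joint law of a coupling that is assembled from one piece per
  letter.\<close>

lemma sum_of_measures:
  fixes \<nu> :: "'i \<Rightarrow> 'b measure"
  assumes "finite I" "\<And>i. i \<in> I \<Longrightarrow> sets (\<nu> i) = sets S"
  obtains M where "sets M = sets S" "\<And>A. A \<in> sets S \<Longrightarrow> emeasure M A = (\<Sum>i\<in>I. emeasure (\<nu> i) A)"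
    "\<And>f. f \<in> borel_measurable S \<Longrightarrow> (\<integral>\<^sup>+x. f x \<partial>M) = (\<Sum>i\<in>I. \<integral>\<^sup>+x. f x \<partial>\<nu> i)"
proof -
  define M where "M = measure_of (space S) (sets S) (\<lambda>A. \<Sum>i\<in>I. emeasure (\<nu> i) A)"
  have sM: "sets M = sets S" and spM: "space M = space S" by (simp_all add: M_def)
  have e: "emeasure M A = (\<Sum>i\<in>I. emeasure (\<nu> i) A)" if "A \<in> sets S" for A
    unfolding M_def
  proof (rule emeasure_measure_of_sigma[OF sets.sigma_algebra_axioms _ _ that])
    show "positive (sets S) (\<lambda>A. \<Sum>i\<in>I. emeasure (\<nu> i) A)" by (simp add: positive_def)
    show "countably_additive (sets S) (\<lambda>A. \<Sum>i\<in>I. emeasure (\<nu> i) A)"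
      unfolding countably_additive_def
    proof (intro allI impI)
      fix A :: "nat \<Rightarrow> 'b set" assume A: "range A \<subseteq> sets S" "disjoint_family A"
      have "(\<Sum>n. \<Sum>i\<in>I. emeasure (\<nu> i) (A n)) = (\<Sum>i\<in>I. \<Sum>n. emeasure (\<nu> i) (A n))"
        by (rule suminf_sum) simp
      also have "\<dots> = (\<Sum>i\<in>I. emeasure (\<nu> i) (\<Union>n. A n))"
        using A assms(2) by (intro sum.cong refl suminf_emeasure) auto
      finally show "(\<Sum>n. \<Sum>i\<in>I. emeasure (\<nu> i) (A n)) = (\<Sum>i\<in>I. emeasure (\<nu> i) (\<Union>(range A)))" .
    qed
  qed
  have "(\<integral>\<^sup>+x. f x \<partial>M) = (\<Sum>i\<in>I. \<integral>\<^sup>+x. f x \<partial>\<nu> i)" if f: "f \<in> borel_measurable S" for f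
    using f
  proof (induction rule: borel_measurable_induct)
    case (cong f g)
    have "(\<integral>\<^sup>+x. g x \<partial>M) = (\<integral>\<^sup>+x. f x \<partial>M)"
      using cong spM by (intro nn_integral_cong) auto
    moreover have "(\<integral>\<^sup>+x. g x \<partial>\<nu> i) = (\<integral>\<^sup>+x. f x \<partial>\<nu> i)" if "i \<in> I" for i
      using cong sets_eq_imp_space_eq[OF assms(2)[OF that]] by (intro nn_integral_cong) auto
    ultimately show ?case using cong by simp
  next
    case (set A)
    then show ?case using e[OF set] assms(2) sM by simp
  next
    case (mult f c)
    then show ?case
      using sM assms(2) by (simp add: nn_integral_cmult sum_distrib_left cong: measurable_cong_sets)
  next
    case (add f g)
    then show ?case
      using sM assms(2) by (simp add: nn_integral_add sum.distrib cong: measurable_cong_sets)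
  next
    case (seq u)
    have m: "u n \<in> borel_measurable M" "i \<in> I \<Longrightarrow> u n \<in> borel_measurable (\<nu> i)" for n i
      using seq(1) sM assms(2) by (auto cong: measurable_cong_sets)
    have "(\<integral>\<^sup>+x. (SUP n. u n) x \<partial>M) = (\<integral>\<^sup>+x. (SUP n. u n x) \<partial>M)"
      by (simp add: image_comp)
    also have "\<dots> = (SUP n. \<integral>\<^sup>+x. u n x \<partial>M)"
      by (rule nn_integral_monotone_convergence_SUP[OF seq(3) m(1)])
    also have "\<dots> = (SUP n. \<Sum>i\<in>I. \<integral>\<^sup>+x. u n x \<partial>\<nu> i)" by (simp only: seq.IH)
    also have "\<dots> = (\<Sum>i\<in>I. SUP n. \<integral>\<^sup>+x. u n x \<partial>\<nu> i)"
    proof (rule ennreal_SUP_sum)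
      show "incseq (\<lambda>n. \<integral>\<^sup>+x. u n x \<partial>\<nu> i)" for i
        using seq(3) by (auto simp: incseq_def le_fun_def intro!: nn_integral_mono)
    qed
    also have "\<dots> = (\<Sum>i\<in>I. \<integral>\<^sup>+x. (SUP n. u n x) \<partial>\<nu> i)"
      using nn_integral_monotone_convergence_SUP[OF seq(3) m(2)] by simp
    finally show ?case by (simp add: image_comp)
  qed
  then show thesis using that[OF sM] e by simp
qed

text \<open>
  Tangent-line form of the data processing inequality: \<open>s z A\<close> is the mass of the cell \<open>A\<close> under
  the input measure of the letter \<open>z\<close>, \<open>e z A\<close> the joint mass of \<open>A\<close> and \<open>z\<close>, and \<open>t z A\<close> the
  information accumulated on them.
\<close>

lemma data_processing_le:
  fixes e s t :: "'z \<Rightarrow> 'b \<Rightarrow> real" and q :: "'z \<Rightarrow> real"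
  assumes fin: "finite \<alpha>" "finite \<beta>" "finite I" and h: "\<And>z. z \<in> I \<Longrightarrow> h z \<in> \<beta>"
    and e: "\<And>z A. z \<in> I \<Longrightarrow> A \<in> \<alpha> \<Longrightarrow> 0 \<le> e z A" and q: "\<And>z. z \<in> I \<Longrightarrow> 0 \<le> q z" "(\<Sum>z\<in>I. q z) \<le> 1"
    and c: "\<And>A B. A \<in> \<alpha> \<Longrightarrow> B \<in> \<beta> \<Longrightarrow> c A B = (\<Sum>z\<in>{z \<in> I. h z = B}. e z A)"
    and p: "\<And>A. A \<in> \<alpha> \<Longrightarrow> (\<Sum>B\<in>\<beta>. c A B) = p A"
    and Q: "\<And>B. B \<in> \<beta> \<Longrightarrow> (\<Sum>A\<in>\<alpha>. c A B) = Q B"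
    and one: "(\<Sum>A\<in>\<alpha>. p A) = 1"
    and s: "\<And>z A. z \<in> I \<Longrightarrow> A \<in> \<alpha> \<Longrightarrow> s z A \<le> p A"
    and tangent: "\<And>z A r. z \<in> I \<Longrightarrow> A \<in> \<alpha> \<Longrightarrow> 0 < r \<Longrightarrow> e z A * ln r + e z A - r * (s z A * q z) \<le> t z A"
    and zero: "\<And>z A. z \<in> I \<Longrightarrow> A \<in> \<alpha> \<Longrightarrow> e z A = 0 \<Longrightarrow> 0 \<le> t z A"
  shows "(\<Sum>A\<in>\<alpha>. \<Sum>B\<in>\<beta>. c A B * ln (c A B / (p A * Q B))) \<le> (\<Sum>z\<in>I. \<Sum>A\<in>\<alpha>. t z A)"
proof -
  define G where "G B = (\<Sum>z\<in>{z \<in> I. h z = B}. q z)" for B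
  have c0: "0 \<le> c A B" if "A \<in> \<alpha>" "B \<in> \<beta>" for A B
    unfolding c[OF that] using that e by (intro sum_nonneg) auto
  have cp: "c A B \<le> p A" if "A \<in> \<alpha>" "B \<in> \<beta>" for A B
    unfolding p[OF that(1), symmetric] using that c0 fin by (intro member_le_sum) auto
  have cQ: "c A B \<le> Q B" if "A \<in> \<alpha>" "B \<in> \<beta>" for A B
    unfolding Q[OF that(2), symmetric] using that c0 fin
    by (intro member_le_sum[where f="\<lambda>A. c A B"]) auto
  have G0: "0 \<le> G B" for B unfolding G_def using q by (auto intro: sum_nonneg)
  \<comment> \<open>The slope is the ratio \<open>c A B / (p A * Q B)\<close> of the coarse cell,
    used for all letters of \<open>B\<close> at once. Summing the tangents then recovers the coarse
    term, the only loss being the replacement of \<open>s z A\<close> by \<open>p A\<close>.\<close>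
  have key: "c A B * ln (c A B / (p A * Q B)) + c A B - c A B / Q B * G B \<le>
      (\<Sum>z\<in>{z \<in> I. h z = B}. t z A)" if AB: "A \<in> \<alpha>" "B \<in> \<beta>" for A B
  proof (cases "c A B = 0")
    case True
    then have "e z A = 0" if "z \<in> I" "h z = B" for z
      using True c[OF AB] sum_nonneg_eq_0_iff[of "{z \<in> I. h z = B}" "\<lambda>z. e z A"] that fin e AB by auto
    then show ?thesis using True zero AB by (auto intro!: sum_nonneg)
  next
    case False
    then have pos: "0 < c A B" using c0[OF AB] by simp
    then have pQ: "0 < p A" "0 < Q B" using cp[OF AB] cQ[OF AB] by auto
    let ?r = "c A B / (p A * Q B)"
    have r: "0 < ?r" using pos pQ by simp
    have "c A B * ln ?r + c A B - ?r * (p A * G B) \<le>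
        (\<Sum>z\<in>{z \<in> I. h z = B}. e z A * ln ?r + e z A - ?r * (s z A * q z))"
    proof -
      have "(\<Sum>z\<in>{z \<in> I. h z = B}. s z A * q z) \<le> p A * G B"
        unfolding G_def sum_distrib_left using s q AB by (intro sum_mono mult_right_mono) auto
      from mult_left_mono[OF this less_imp_le[OF r]] show ?thesis
        by (simp add: sum.distrib sum_subtractf sum_distrib_left sum_distrib_right c[OF AB])
    qed
    also have "\<dots> \<le> (\<Sum>z\<in>{z \<in> I. h z = B}. t z A)"
      using tangent[OF _ AB(1) r] by (intro sum_mono) auto
    finally show ?thesis using pQ by (simp add: field_simps)
  qed
  have "(\<Sum>A\<in>\<alpha>. \<Sum>B\<in>\<beta>. c A B / Q B * G B) = (\<Sum>B\<in>\<beta>. (\<Sum>A\<in>\<alpha>. c A B) / Q B * G B)"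
    by (subst sum.swap) (simp add: sum_divide_distrib sum_distrib_right)
  also have "\<dots> \<le> (\<Sum>B\<in>\<beta>. G B)"
    using G0 by (intro sum_mono) (simp add: Q)
  also have "\<dots> = (\<Sum>z\<in>I. q z)"
    unfolding G_def using fin h by (intro sum.group) auto
  finally have G1: "(\<Sum>A\<in>\<alpha>. \<Sum>B\<in>\<beta>. c A B / Q B * G B) \<le> 1" using q(2) by simp
  have "(\<Sum>A\<in>\<alpha>. \<Sum>B\<in>\<beta>. c A B * ln (c A B / (p A * Q B)) + c A B - c A B / Q B * G B) \<le>
      (\<Sum>A\<in>\<alpha>. \<Sum>B\<in>\<beta>. \<Sum>z\<in>{z \<in> I. h z = B}. t z A)"
    using key by (intro sum_mono) auto
  also have "\<dots> = (\<Sum>A\<in>\<alpha>. \<Sum>z\<in>I. t z A)"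
    using fin h by (intro sum.cong refl sum.group) auto
  also have "\<dots> = (\<Sum>z\<in>I. \<Sum>A\<in>\<alpha>. t z A)" by (rule sum.swap)
  finally show ?thesis using G1 p one by (simp add: sum.distrib sum_subtractf)
qed

section \<open>Codewords as elements of the quotient space\<close>

definition L1_class :: "real \<Rightarrow> (real ^ 'n \<Rightarrow> 'a::metric_space) \<Rightarrow> (real ^ 'n \<Rightarrow> 'a) set" where
  "L1_class L y = {(f, g). f \<in> borel_measurable (cube_measure L) \<and> g \<in> borel_measurable (cube_measure L) \<and>
                (AE u in cube_measure L. f u = g u)} `` {y}"

lemma equiv_L1:
  "equiv (borel_measurable (cube_measure L))
    {(f, g). f \<in> borel_measurable (cube_measure L) \<and> g \<in> borel_measurable (cube_measure L) \<and>
                (AE u in cube_measure L. f u = g u)}"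
proof (rule equivI)
  let ?B = "borel_measurable (cube_measure L)"
  let ?r = "{(f, g). f \<in> ?B \<and> g \<in> ?B \<and> (AE u in cube_measure L. f u = g u)}"
  show "trans ?r"
  proof (rule transI)
    fix f g h assume "(f, g) \<in> ?r" "(g, h) \<in> ?r"
    then have m: "f \<in> ?B" "h \<in> ?B" and ae: "AE u in cube_measure L. f u = g u" "AE u in cube_measure L. g u = h u"
      by auto
    from ae have "AE u in cube_measure L. f u = h u" by eventually_elim simp
    with m show "(f, h) \<in> ?r" by simp
  qed
  show "sym ?r"
  proof (rule symI)
    fix f g assume "(f, g) \<in> ?r"
    then have m: "f \<in> ?B" "g \<in> ?B" and ae: "AE u in cube_measure L. f u = g u" by auto
    from ae have "AE u in cube_measure L. g u = f u" by eventually_elim simp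
    with m show "(g, f) \<in> ?r" by simp
  qed
qed (auto simp: refl_on_def)

lemma L1_class_in: "y \<in> borel_measurable (cube_measure L) \<Longrightarrow> L1_class L y \<in> L1_space L"
  unfolding L1_class_def L1_space_def by (rule quotientI)

lemma L1_rep_in:
  assumes "F \<in> L1_space L"
  shows "L1_rep F \<in> F"
proof -
  have "F \<noteq> {}" using in_quotient_imp_non_empty[OF equiv_L1] assms unfolding L1_space_def .
  then show ?thesis unfolding L1_rep_def by (simp add: some_in_eq)
qed

lemma L1_rep_measurable: "F \<in> L1_space L \<Longrightarrow> L1_rep F \<in> borel_measurable (cube_measure L)"
  using in_quotient_imp_subset[OF equiv_L1] L1_rep_in unfolding L1_space_def by blast

lemma L1_rep_class:
  assumes "y \<in> borel_measurable (cube_measure L)"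
  shows "AE u in cube_measure L. L1_rep (L1_class L y) u = y u"
proof -
  have "L1_rep (L1_class L y) \<in> L1_class L y" by (rule L1_rep_in[OF L1_class_in[OF assms]])
  moreover have "AE u in cube_measure L. y u = g u" if "g \<in> L1_class L y" for g
    using that by (simp add: L1_class_def)
  ultimately have "AE u in cube_measure L. y u = L1_rep (L1_class L y) u" by blast
  then show ?thesis by eventually_elim simp
qed

lemma L1_space_eqI:
  assumes "F \<in> L1_space L" "G \<in> L1_space L" "AE u in cube_measure L. L1_rep F u = L1_rep G u"
  shows "F = G"
proof (rule quotient_eqI[OF equiv_L1, of F L G "L1_rep F" "L1_rep G"])
qed (use assms L1_rep_in L1_rep_measurable in \<open>auto simp: L1_space_def\<close>)

context compact_action
begin

lemma finite_cube_measure: "finite_measure (cube_measure L :: (real ^ 'n) measure)"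
  using region_cube[of L] by (intro finite_measureI) (simp add: emeasure_restrict_space space_restrict_space region_def)

lemma dist_integrable_cube:
  assumes "f \<in> borel_measurable (cube_measure L)" "g \<in> borel_measurable (cube_measure L)"
  shows "integrable (cube_measure L :: (real ^ 'n) measure) (\<lambda>u. dist (f u) (g u :: 'a))"
proof -
  interpret finite_measure "cube_measure L :: (real ^ 'n) measure" by (rule finite_cube_measure)
  show ?thesis
    using assms dist_le_diam by (intro integrable_const_bound[of _ diam_space] AE_I2) auto
qed

lemma Metric_space_L1: "Metric_space (L1_space L :: (real ^ 'n \<Rightarrow> 'a) set set) (L1_dist L)"
proof
  fix F G H :: "(real ^ 'n \<Rightarrow> 'a) set"
  show "0 \<le> L1_dist L F G" unfolding L1_dist_def by simp
  show "L1_dist L F G = L1_dist L G F" unfolding L1_dist_def by (simp add: dist_commute)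
  assume F: "F \<in> L1_space L" and G: "G \<in> L1_space L"
  note i = dist_integrable_cube[OF L1_rep_measurable L1_rep_measurable]
  show "L1_dist L F G = 0 \<longleftrightarrow> F = G"
  proof
    assume "L1_dist L F G = 0"
    then have "AE u in cube_measure L. dist (L1_rep F u) (L1_rep G u) = 0"
      unfolding L1_dist_def by (subst (asm) integral_nonneg_eq_0_iff_AE[OF i[OF F G]]) auto
    then show "F = G" using L1_space_eqI[OF F G] by simp
  qed (simp add: L1_dist_def)
  assume H: "H \<in> L1_space L"
  have "L1_dist L F H \<le> (\<integral>u. dist (L1_rep F u) (L1_rep G u) + dist (L1_rep G u) (L1_rep H u) \<partial>cube_measure L)"
    unfolding L1_dist_def by (intro integral_mono Bochner_Integration.integrable_add i F G H dist_triangle)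
  also have "\<dots> = L1_dist L F G + L1_dist L G H"
    unfolding L1_dist_def by (intro Bochner_Integration.integral_add i F G H)
  finally show "L1_dist L F H \<le> L1_dist L F G + L1_dist L G H" .
qed

lemma space_L1_borel: "space (L1_borel L :: (real ^ 'n \<Rightarrow> 'a) set measure) = L1_space L"
proof -
  interpret Metric_space "L1_space L :: (real ^ 'n \<Rightarrow> 'a) set set" "L1_dist L" by (rule Metric_space_L1)
  have "{U. openin mtopology U} \<subseteq> Pow (topspace mtopology)" using openin_subset by blast
  then show ?thesis unfolding L1_borel_def borel_of_def by (subst space_measure_of) auto
qed

text \<open>Counterpart of \<open>dcost (cube L)\<close> for an element of the quotient, evaluated
  at the representative chosen by \<open>L1_rep\<close>; every Borel function that agrees with it
  almost everywhere on the cube gives the same value.\<close>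

definition rcost :: "real \<Rightarrow> 'a \<Rightarrow> (real ^ 'n \<Rightarrow> 'a) set \<Rightarrow> real" where
  "rcost L x F = (\<integral>u. dist (T u x) (L1_rep F u) \<partial>cube_measure L)"

lemma T_measurable_cube: "(\<lambda>u. T u x) \<in> borel_measurable (cube_measure L)"
  by (rule measurable_restrict_space1) simp

lemma rcost_AE:
  assumes y: "y \<in> borel_measurable borel" and F: "F \<in> L1_space L"
    and eq: "AE u in cube_measure L. L1_rep F u = y u"
  shows "rcost L x F = dcost (cube L) x y"
proof -
  have y': "y \<in> borel_measurable (cube_measure L)" using y by (intro measurable_restrict_space1) simp
  have "rcost L x F = (\<integral>u. dist (T u x) (y u) \<partial>cube_measure L)"
    unfolding rcost_def
    using eq y' L1_rep_measurable[OF F] T_measurable_cube[of x L]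
    by (intro integral_cong_AE borel_measurable_dist) (auto elim: eventually_mono)
  also have "\<dots> = dcost (cube L) x y"
    unfolding dcost_def set_lebesgue_integral_def by (rule integral_restrict_space) simp
  finally show ?thesis .
qed

lemma rcost_class:
  assumes "y \<in> borel_measurable borel"
  shows "rcost L x (L1_class L y) = dcost (cube L) x y"
proof -
  have "y \<in> borel_measurable (cube_measure L)" using assms by (intro measurable_restrict_space1) simp
  then show ?thesis using assms L1_class_in L1_rep_class by (intro rcost_AE) auto
qed

text \<open>A representative is measurable on the cube only; the constant extension outside makes it
  a codeword in the sense of \<open>chan\<close>, which asks for Borel maps on the whole
  group.\<close>

lemma L1_space_borel_rep:
  assumes F: "F \<in> L1_space L"
  obtains y where "y \<in> borel_measurable borel" "\<And>u. u \<in> cube L \<Longrightarrow> y u = L1_rep F u"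
    "\<And>x. rcost L x F = dcost (cube L) x y"
proof -
  define y where "y u = (if u \<in> cube L then L1_rep F u else undefined)" for u
  have "cube L \<inter> space lborel \<in> sets (lborel :: (real ^ 'n) measure)" by simp
  then have m: "y \<in> borel_measurable borel"
    using L1_rep_measurable[OF F] unfolding y_def
    by (subst (asm) measurable_restrict_space_iff[where c=undefined]) auto
  moreover have "AE u in cube_measure L. L1_rep F u = y u"
    by (rule AE_I2) (auto simp: y_def space_restrict_space)
  ultimately show thesis using that[OF m] rcost_AE[OF m F] by (simp add: y_def)
qed

text \<open>Lipschitz dependence on the codeword, by the triangle inequality; this is what justifies
  quantising the output.\<close>

lemma rcost_diff_le:
  assumes "F \<in> L1_space L" "G \<in> L1_space L"
  shows "rcost L x F \<le> rcost L x G + L1_dist L G F"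
proof -
  note m = T_measurable_cube[of x L] L1_rep_measurable[OF assms(1)] L1_rep_measurable[OF assms(2)]
  have "rcost L x F \<le> (\<integral>u. dist (T u x) (L1_rep G u) + dist (L1_rep G u) (L1_rep F u) \<partial>cube_measure L)"
    unfolding rcost_def by (intro integral_mono Bochner_Integration.integrable_add dist_integrable_cube m dist_triangle)
  also have "\<dots> = rcost L x G + L1_dist L G F"
    unfolding L1_dist_def rcost_def by (intro Bochner_Integration.integral_add dist_integrable_cube m)
  finally show ?thesis .
qed

lemma rcost_nonneg: "0 \<le> rcost L x F"
  unfolding rcost_def by simp

lemma rcost_le:
  assumes "F \<in> L1_space L" "0 \<le> L"
  shows "rcost L x F \<le> diam_space * L ^ CARD('n)"
proof -
  obtain y where y: "y \<in> borel_measurable borel" "\<And>x. rcost L x F = dcost (cube L) x y"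
    using L1_space_borel_rep[OF assms(1)] by metis
  show ?thesis
    unfolding y(2) using dcost_le[OF region_cube[of L] y(1), where x=x] by (simp add: measure_cube[OF assms(2)])
qed

text \<open>The input is drawn from one of \<open>K\<close> pieces, and piece \<open>k\<close> uses
  its own channel. A letter is a pair \<open>(k, i)\<close> with reference weight
  \<open>q k i / K\<close>; the division by \<open>K\<close> costs \<open>log 2 K\<close> bits. The
  piece need not be a function of the input, so the pieces may overlap: data processing uses only
  that each \<open>\<rho> k\<close> is dominated by \<open>\<mu>\<close>.\<close>

lemma rate_distortion_cube_le:
  fixes \<rho> :: "nat \<Rightarrow> 'a measure"
  assumes L: "0 < L" and ch: "\<And>k. k < K \<Longrightarrow> chan (cube L) (j k) (c k)"
    and \<rho>: "\<And>k. k < K \<Longrightarrow> finite_measure (\<rho> k)" "\<And>k. k < K \<Longrightarrow> sets (\<rho> k) = sets borel"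
    and \<mu>: "prob_space \<mu>" "sets \<mu> = sets borel"
    and sum: "\<And>A. A \<in> sets borel \<Longrightarrow> emeasure \<mu> A = (\<Sum>k<K. emeasure (\<rho> k) A)"
    and cost: "(\<Sum>k<K. \<integral>x. c k x \<partial>\<rho> k) < \<epsilon> * L ^ CARD('n)"
  shows "rate_distortion_cube T \<mu> L \<epsilon> \<le> ereal ((\<Sum>k<K. \<integral>x. j k x \<partial>\<rho> k) + log 2 (real K))"
proof -
  interpret \<mu>: prob_space \<mu> by fact
  have sp\<mu>: "space \<mu> = UNIV" using sets_eq_imp_space_eq[OF \<mu>(2)] by simp
  have sp\<rho>: "space (\<rho> k) = UNIV" if "k < K" for k using sets_eq_imp_space_eq[OF \<rho>(2)[OF that]] by simp
  have K0: "0 < K"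
    using sum[of UNIV] \<mu>.emeasure_space_1 sp\<mu> by (cases "K = 0") auto
  define P where "P k m W q y \<longleftrightarrow>
     (\<forall>i<m. W i \<in> borel_measurable borel \<and> (\<forall>x. 0 \<le> W i x) \<and> 0 < q i \<and> y i \<in> borel_measurable borel) \<and>
     (\<forall>x. (\<Sum>i<m. W i x) = 1) \<and> (\<Sum>i<m. q i) \<le> 1 \<and>
     j k = (\<lambda>x. \<Sum>i<m. W i x * log 2 (W i x / q i)) \<and>
     c k = (\<lambda>x. \<Sum>i<m. W i x * dcost (cube L) x (y i))"
    for k and m :: nat and W :: "nat \<Rightarrow> 'a \<Rightarrow> real" and q :: "nat \<Rightarrow> real" and y :: "nat \<Rightarrow> real ^ 'n \<Rightarrow> 'a"
  have "\<forall>k. k < K \<longrightarrow> (\<exists>m W q y. P k m W q y)" using ch by (simp add: chan_def P_def)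
  then obtain m W q y where "\<forall>k. k < K \<longrightarrow> P k (m k) (W k) (q k) (y k)" by metis
  then have P: "P k (m k) (W k) (q k) (y k)" if "k < K" for k using that by blast
  define I where "I = Sigma {..<K} (\<lambda>k. {..<m k})"
  define w where "w z = W (fst z) (snd z)" for z
  define r where "r z = \<rho> (fst z)" for z :: "nat \<times> nat"
  define yy where "yy z = y (fst z) (snd z)" for z
  define F where "F z = L1_class L (yy z)" for z
  define qq where "qq z = q (fst z) (snd z) / real K" for z
  have finI: "finite I" by (simp add: I_def)
  have Sk: "(\<Sum>z\<in>I. G z) = (\<Sum>k<K. \<Sum>i<m k. G (k, i))" for G :: "nat \<times> nat \<Rightarrow> real"
    using sum.Sigma[of "{..<K}" "\<lambda>k. {..<m k}" "\<lambda>k i. G (k, i)"] by (simp add: I_def case_prod_unfold)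
  have w: "w z \<in> borel_measurable borel" "0 \<le> w z x" if "z \<in> I" for z x
    using that P by (auto simp: I_def w_def P_def)
  have w1: "(\<Sum>i<m k. w (k, i) x) = 1" if "k < K" for k x
    using P[OF that] by (simp add: w_def P_def)
  have wle: "w z x \<le> 1" if "z \<in> I" for z x
  proof -
    have "w (fst z, snd z) x \<le> (\<Sum>i<m (fst z). w (fst z, i) x)"
      using that w(2) by (intro member_le_sum[of _ _ "\<lambda>i. w (fst z, i) x"]) (auto simp: I_def)
    then show ?thesis using w1 that by (auto simp: I_def)
  qed
  have y: "yy z \<in> borel_measurable borel" if "z \<in> I" for z
    using that P by (auto simp: I_def yy_def P_def)
  have qq: "0 < qq z" if "z \<in> I" for z using that P K0 by (auto simp: I_def qq_def P_def)
  have qq1: "(\<Sum>z\<in>I. qq z) \<le> 1"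
  proof -
    have "(\<Sum>z\<in>I. qq z) = (\<Sum>k<K. (\<Sum>i<m k. q k i) / real K)"
      unfolding Sk qq_def by (simp add: sum_divide_distrib)
    also have "\<dots> \<le> (\<Sum>k<K. 1 / real K)"
      using P by (intro sum_mono divide_right_mono) (auto simp: P_def)
    finally show ?thesis using K0 by simp
  qed
  have r: "finite_measure (r z)" "sets (r z) = sets borel" "space (r z) = UNIV" if "z \<in> I" for z
    using that \<rho> sp\<rho> by (auto simp: I_def r_def)
  have wr: "w z \<in> borel_measurable (r z)" if "z \<in> I" for z
    using w(1)[OF that] by (simp add: measurable_cong_sets[OF r(2)[OF that] refl])
  have wint: "integrable (r z) (\<lambda>x. f x * w z x)" if z: "z \<in> I"
    and f: "f \<in> borel_measurable borel" "\<And>x. 0 \<le> f x" "\<And>x. f x \<le> b" for z f b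
  proof -
    interpret finite_measure "r z" using r(1)[OF z] .
    have "f \<in> borel_measurable (r z)" using f(1) by (simp add: measurable_cong_sets[OF r(2)[OF z] refl])
    moreover have "f x * w z x \<le> b * 1" for x
      using f(2,3)[of x] w(2)[OF z, of x] wle[OF z, of x] by (intro mult_mono) (auto intro: order_trans)
    ultimately show ?thesis
      using wr[OF z] f(2) w(2)[OF z] by (intro integrable_const_bound[of _ b] AE_I2) auto
  qed
  have F: "F z \<in> L1_space L" if "z \<in> I" for z
    unfolding F_def by (intro L1_class_in measurable_restrict_space1) (simp add: y[OF that])
  \<comment> \<open>Only finitely many codewords occur, so they carry the discrete sigma-algebra;
    \<open>snd\<close> is then measurable into \<open>L1_borel L\<close> without any argument about
    the metric.\<close>
  define S where "S = (borel :: 'a measure) \<Otimes>\<^sub>M count_space (F ` I)"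
  have spS: "space S = UNIV \<times> F ` I" by (simp add: S_def space_pair_measure)
  \<comment> \<open>The part of the joint law that belongs to the letter \<open>z\<close>: the input
    has density \<open>w z\<close>, the output is constantly \<open>F z\<close>.\<close>
  define \<nu> where "\<nu> z = distr (density (r z) (\<lambda>x. ennreal (w z x))) S (\<lambda>x. (x, F z))" for z
  have pm: "(\<lambda>x. (x, F z)) \<in> measurable (density (r z) (\<lambda>x. ennreal (w z x))) S" if "z \<in> I" for z
  proof -
    have "(\<lambda>x. (x, F z)) \<in> measurable borel S"
      unfolding S_def using that by (intro measurable_Pair measurable_const) auto
    then show ?thesis using r(2)[OF that] by (simp cong: measurable_cong_sets)
  qed
  obtain M where sM: "sets M = sets S" and nM: "\<And>f. f \<in> borel_measurable S \<Longrightarrow> (\<integral>\<^sup>+x. f x \<partial>M) = (\<Sum>z\<in>I. \<integral>\<^sup>+x. f x \<partial>\<nu> z)"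
    using sum_of_measures[OF finI, of \<nu> S] by (metis \<nu>_def sets_distr)
  have spM: "space M = UNIV \<times> F ` I" using sets_eq_imp_space_eq[OF sM] spS by simp
  have nn: "(\<integral>\<^sup>+\<omega>. ennreal (f \<omega>) \<partial>M) = ennreal (\<Sum>z\<in>I. \<integral>x. f (x, F z) * w z x \<partial>r z)"
    if f: "f \<in> borel_measurable S" "\<And>\<omega>. 0 \<le> f \<omega>" "\<And>x z. z \<in> I \<Longrightarrow> f (x, F z) \<le> b" for f b
  proof -
    have fz: "(\<lambda>x. f (x, F z)) \<in> borel_measurable borel" if "z \<in> I" for z
    proof (rule measurable_compose[OF _ f(1)])
      show "(\<lambda>x. (x, F z)) \<in> measurable borel S"
        unfolding S_def using that by (intro measurable_Pair measurable_const) auto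
    qed
    have "(\<integral>\<^sup>+\<omega>. ennreal (f \<omega>) \<partial>M) = (\<Sum>z\<in>I. \<integral>\<^sup>+x. ennreal (f x) \<partial>\<nu> z)"
      using f(1) by (intro nM) auto
    also have "\<dots> = (\<Sum>z\<in>I. ennreal (\<integral>x. f (x, F z) * w z x \<partial>r z))"
    proof (rule sum.cong[OF refl])
      fix z assume z: "z \<in> I"
      have "(\<integral>\<^sup>+x. ennreal (f x) \<partial>\<nu> z) = (\<integral>\<^sup>+x. ennreal (f (x, F z)) \<partial>density (r z) (\<lambda>x. ennreal (w z x)))"
        unfolding \<nu>_def using f(1) by (intro nn_integral_distr pm z) auto
      also have "\<dots> = (\<integral>\<^sup>+x. ennreal (w z x) * ennreal (f (x, F z)) \<partial>r z)"
        using wr[OF z] fz[OF z] r(2)[OF z]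
        by (intro nn_integral_density) (auto cong: measurable_cong_sets)
      also have "\<dots> = (\<integral>\<^sup>+x. ennreal (f (x, F z) * w z x) \<partial>r z)"
        using f(2) w(2)[OF z] by (intro nn_integral_cong) (simp add: ennreal_mult'[symmetric] mult.commute)
      also have "\<dots> = ennreal (\<integral>x. f (x, F z) * w z x \<partial>r z)"
        using wint[OF z fz[OF z] f(2) f(3)[OF z]] f(2) w(2)[OF z]
        by (intro nn_integral_eq_integral) auto
      finally show "(\<integral>\<^sup>+x. ennreal (f x) \<partial>\<nu> z) = ennreal (\<integral>x. f (x, F z) * w z x \<partial>r z)" .
    qed
    also have "\<dots> = ennreal (\<Sum>z\<in>I. \<integral>x. f (x, F z) * w z x \<partial>r z)"
      using f(2) w(2) by (intro sum_ennreal Bochner_Integration.integral_nonneg) auto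
    finally show ?thesis .
  qed
  have em: "emeasure M C = ennreal (\<Sum>z\<in>I. \<integral>x. indicator C (x, F z) * w z x \<partial>r z)" if "C \<in> sets S" for C
    using nn[of "indicator C" 1] that sM by (simp add: ennreal_indicator)
  \<comment> \<open>For functions of the input alone the weights of piece \<open>k\<close> sum out.
    Applied to indicators, this identifies the input law as \<open>\<mu>\<close>.\<close>
  have em1: "(\<Sum>z\<in>I. \<integral>x. f x * w z x \<partial>r z) = (\<Sum>k<K. \<integral>x. f x \<partial>\<rho> k)"
    if f: "f \<in> borel_measurable borel" "\<And>x. 0 \<le> f x" "\<And>x. f x \<le> b" for f b
    unfolding Sk
  proof (rule sum.cong[OF refl])
    fix k assume "k \<in> {..<K}"
    then have k: "k < K" by simp
    have "(\<Sum>i<m k. \<integral>x. f x * w (k, i) x \<partial>r (k, i)) = (\<integral>x. (\<Sum>i<m k. f x * w (k, i) x) \<partial>\<rho> k)"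
      using wint[OF _ f] k by (subst Bochner_Integration.integral_sum) (auto simp: I_def r_def)
    also have "\<dots> = (\<integral>x. f x \<partial>\<rho> k)" using w1[OF k] by (simp add: sum_distrib_left[symmetric])
    finally show "(\<Sum>i<m k. \<integral>x. f x * w (k, i) x \<partial>r (k, i)) = (\<integral>x. f x \<partial>\<rho> k)" .
  qed
  have \<mu>A: "measure \<mu> A = (\<Sum>k<K. measure (\<rho> k) A)" if "A \<in> sets borel" for A
  proof -
    have "ennreal (measure \<mu> A) = (\<Sum>k<K. ennreal (measure (\<rho> k) A))"
      using sum[OF that] \<mu>.emeasure_eq_measure finite_measure.emeasure_eq_measure[OF \<rho>(1)] by simp
    also have "\<dots> = ennreal (\<Sum>k<K. measure (\<rho> k) A)" by (rule sum_ennreal) simp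
    finally show ?thesis by (simp add: sum_nonneg)
  qed
  have ind: "(\<integral>x. indicator A x \<partial>\<rho> k) = measure (\<rho> k) A" if "k < K" "A \<in> sets borel" for A k
    using that \<rho>(2) sp\<rho> by simp
  have emA: "emeasure M {\<omega> \<in> space M. fst \<omega> \<in> A} = ennreal (measure \<mu> A)" if A: "A \<in> sets borel" for A
  proof -
    have "{\<omega> \<in> space M. fst \<omega> \<in> A} = A \<times> F ` I" using spM by auto
    moreover have "A \<times> F ` I \<in> sets S" unfolding S_def using A by (intro pair_measureI) auto
    moreover have "(\<Sum>z\<in>I. \<integral>x. indicator (A \<times> F ` I) (x, F z) * w z x \<partial>r z) = (\<Sum>z\<in>I. \<integral>x. indicator A x * w z x \<partial>r z)"
      by (intro sum.cong refl Bochner_Integration.integral_cong) (auto simp: indicator_def)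
    moreover have "\<dots> = measure \<mu> A"
      using em1[of "indicator A" 1] A ind by (simp add: \<mu>A)
    ultimately show ?thesis using em by simp
  qed
  have probM: "prob_space M"
  proof
    have "space M = {\<omega> \<in> space M. fst \<omega> \<in> UNIV}" by auto
    then show "emeasure M (space M) = 1" using emA[of UNIV] \<mu>.prob_space sp\<mu> by simp
  qed
  interpret M: prob_space M by fact
  have fstM: "fst \<in> measurable M borel"
    using measurable_fst[of "borel :: 'a measure" "count_space (F ` I)"] sM by (simp add: S_def cong: measurable_cong_sets)
  have sndM: "snd \<in> measurable M (L1_borel L)"
  proof -
    have "snd \<in> measurable S (count_space (F ` I))" unfolding S_def by (rule measurable_snd)
    moreover have "(\<lambda>G. G) \<in> measurable (count_space (F ` I)) (L1_borel L)"
      using F by (auto simp: space_L1_borel)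
    ultimately have "snd \<in> measurable S (L1_borel L)" by (rule measurable_compose)
    then show ?thesis using sM by (simp cong: measurable_cong_sets)
  qed
  have dM: "distr M borel fst = \<mu>"
  proof (rule measure_eqI)
    fix A assume "A \<in> sets (distr M borel fst)"
    then have A: "A \<in> sets borel" by simp
    have "fst -` A \<inter> space M = {\<omega> \<in> space M. fst \<omega> \<in> A}" by auto
    then show "emeasure (distr M borel fst) A = emeasure \<mu> A"
      using emA[OF A] \<mu>.emeasure_eq_measure by (simp add: emeasure_distr[OF fstM A])
  qed (use \<mu> in simp)
  have Ld: "0 < L ^ CARD('n)" using L by simp
  define g where "g \<omega> = 1 / L ^ CARD('n) * rcost L (fst \<omega>) (snd \<omega>)" for \<omega> :: "'a \<times> (real ^ 'n \<Rightarrow> 'a) set"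
  have gz: "g (x, F z) = dcost (cube L) x (yy z) / L ^ CARD('n)" if "z \<in> I" for x z
    using rcost_class[OF y[OF that]] by (simp add: g_def F_def)
  have g0: "0 \<le> g \<omega>" for \<omega> using Ld rcost_nonneg by (simp add: g_def)
  \<comment> \<open>A case split over the finitely many outputs reduces joint measurability to that
    of \<open>dcost\<close> for a fixed codeword.\<close>
  have gm: "g \<in> borel_measurable S"
    unfolding S_def
  proof (rule measurable_compose_countable'[where f="\<lambda>G \<omega>. g (fst \<omega>, G)" and g=snd and I="F ` I", simplified prod.collapse])
    fix G assume "G \<in> F ` I"
    then obtain z where z: "z \<in> I" "G = F z" by auto
    have "(\<lambda>x. dcost (cube L) x (yy z) / L ^ CARD('n)) \<in> borel_measurable borel"
      using dcost_measurable[OF region_cube y[OF z(1)]] by measurable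
    from measurable_compose[OF measurable_fst this]
    show "(\<lambda>\<omega>. g (fst \<omega>, G)) \<in> borel_measurable (borel \<Otimes>\<^sub>M count_space (F ` I))"
      unfolding z(2) gz[OF z(1)] .
  qed (use finI in \<open>auto intro: countable_finite\<close>)
  have gb: "g (x, F z) \<le> diam_space" if "z \<in> I" for x z
    using rcost_le[OF F[OF that] less_imp_le[OF L], of x] Ld by (simp add: g_def field_simps)
  have "M.expectation g = enn2real (\<integral>\<^sup>+\<omega>. ennreal (g \<omega>) \<partial>M)"
    using gm sM g0 by (intro integral_eq_nn_integral) (auto cong: measurable_cong_sets)
  also have "\<dots> = (\<Sum>z\<in>I. \<integral>x. g (x, F z) * w z x \<partial>r z)"
    using g0 w(2) nn[OF gm g0 gb]
    by (subst enn2real_ennreal[symmetric]) (auto intro!: sum_nonneg Bochner_Integration.integral_nonneg)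
  also have "\<dots> = (\<Sum>k<K. (\<integral>x. c k x \<partial>\<rho> k) / L ^ CARD('n))"
    unfolding Sk
  proof (rule sum.cong[OF refl])
    fix k assume "k \<in> {..<K}"
    then have k: "k < K" by simp
    have "(\<Sum>i<m k. \<integral>x. g (x, F (k, i)) * w (k, i) x \<partial>r (k, i)) =
        (\<Sum>i<m k. \<integral>x. dcost (cube L) x (yy (k, i)) * w (k, i) x / L ^ CARD('n) \<partial>\<rho> k)"
      using gz k by (intro sum.cong refl Bochner_Integration.integral_cong) (auto simp: I_def r_def)
    also have "\<dots> = (\<Sum>i<m k. \<integral>x. dcost (cube L) x (yy (k, i)) * w (k, i) x \<partial>\<rho> k) / L ^ CARD('n)"
      by (simp add: sum_divide_distrib)
    also have "(\<Sum>i<m k. \<integral>x. dcost (cube L) x (yy (k, i)) * w (k, i) x \<partial>\<rho> k) =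
        (\<integral>x. (\<Sum>i<m k. dcost (cube L) x (yy (k, i)) * w (k, i) x) \<partial>\<rho> k)"
    proof (rule Bochner_Integration.integral_sum[symmetric])
      fix i assume "i \<in> {..<m k}"
      then have z: "(k, i) \<in> I" using k by (simp add: I_def)
      have "dcost (cube L) x (yy (k, i)) \<le> diam_space * measure lborel (cube L :: (real ^ 'n) set)" for x
        by (rule dcost_le[OF region_cube y[OF z]])
      from wint[OF z dcost_measurable[OF region_cube y[OF z]] dcost_nonneg this]
      show "integrable (\<rho> k) (\<lambda>x. dcost (cube L) x (yy (k, i)) * w (k, i) x)" by (simp add: r_def)
    qed
    also have "\<dots> = (\<integral>x. c k x \<partial>\<rho> k)"
      using P[OF k] by (simp add: P_def w_def yy_def mult.commute)
    finally show "(\<Sum>i<m k. \<integral>x. g (x, F (k, i)) * w (k, i) x \<partial>r (k, i)) = (\<integral>x. c k x \<partial>\<rho> k) / L ^ CARD('n)" .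
  qed
  also have "\<dots> < \<epsilon>" using cost Ld by (simp add: sum_divide_distrib[symmetric] divide_less_eq)
  finally have exp: "M.expectation g < \<epsilon>" .
  have "mutual_info M borel (L1_borel L) fst snd \<le> ereal ((\<Sum>k<K. \<integral>x. j k x \<partial>\<rho> k) + log 2 (real K))"
    unfolding mutual_info_def
  proof (rule SUP_least, clarify)
    fix \<alpha> :: "'a set set" and \<beta> :: "(real ^ 'n \<Rightarrow> 'a) set set set"
    assume \<alpha>: "\<alpha> \<in> finite_partitions borel" and \<beta>: "\<beta> \<in> finite_partitions (L1_borel L)"
    have \<alpha>': "finite \<alpha>" "\<alpha> \<subseteq> sets borel" "partition_on UNIV \<alpha>"
      and \<beta>': "finite \<beta>" "\<beta> \<subseteq> sets (L1_borel L)" "partition_on (L1_space L) \<beta>"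
      using \<alpha> \<beta> by (auto simp: finite_partitions_def space_L1_borel)
    note FM = finite_mutual_information_cell[OF probM fstM sndM \<alpha> \<beta>]
    define e where "e z A = (\<integral>x. indicator A x * w z x \<partial>r z)" for z A
    define t where "t z A = (\<integral>x. indicator A x * (w z x * ln (w z x / qq z)) \<partial>r z)" for z A
    have tm: "(\<lambda>x. w z x * ln (w z x / qq z)) \<in> borel_measurable (r z)" if "z \<in> I" for z
      using wr[OF that] by measurable
    have tint: "integrable (r z) (\<lambda>x. indicator A x * (w z x * ln (w z x / qq z)))" if z: "z \<in> I" and A: "A \<in> sets borel" for z A
    proof -
      interpret finite_measure "r z" using r(1)[OF z] .
      have b: "\<bar>w z x * ln (w z x / qq z)\<bar> \<le> 1 + qq z + \<bar>ln (1 / qq z)\<bar>" for x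
      proof (cases "w z x = 0")
        case False
        then have pos: "0 < w z x" using w(2)[OF z, of x] by simp
        have "w z x - qq z \<le> w z x * ln (w z x / qq z)"
          using mult_ln_ge_tangent[of "w z x" "qq z" 1] w(2)[OF z] qq[OF z] by simp
        moreover have "w z x * ln (w z x / qq z) \<le> 1 * \<bar>ln (1 / qq z)\<bar>"
        proof -
          have "ln (w z x / qq z) \<le> ln (1 / qq z)"
            using pos qq[OF z] wle[OF z, of x] by (simp add: divide_right_mono)
          then have "w z x * ln (w z x / qq z) \<le> w z x * \<bar>ln (1 / qq z)\<bar>"
            using pos by (intro mult_left_mono) auto
          also have "\<dots> \<le> 1 * \<bar>ln (1 / qq z)\<bar>" using wle[OF z] by (intro mult_right_mono) auto
          finally show ?thesis .
        qed
        ultimately show ?thesis using pos qq[OF z] by linarith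
      qed (use qq[OF z] in simp)
      have "indicator A \<in> borel_measurable (r z)" using A r(2)[OF z] by simp
      from borel_measurable_times[OF this tm[OF z]] show ?thesis
        using b by (intro integrable_const_bound[of _ "1 + qq z + \<bar>ln (1 / qq z)\<bar>"] AE_I2)
          (auto simp: indicator_def intro: order_trans[OF abs_ge_zero])
    qed
    have eint: "integrable (r z) (\<lambda>x. indicator A x * w z x)" if z: "z \<in> I" and A: "A \<in> sets borel" for z A
      using wint[OF z, of "indicator A" 1] A by simp
    have e0: "0 \<le> e z A" if "z \<in> I" for z A
      unfolding e_def using w(2)[OF that] by (intro Bochner_Integration.integral_nonneg) simp
    \<comment> \<open>Several letters may have the same class \<open>F z\<close>. They then lie in
      the same cell, so grouping the letters by \<open>cell \<beta> (F z)\<close> counts them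
      correctly.\<close>
    have cAB: "measure M {\<omega> \<in> space M. fst \<omega> \<in> A \<and> snd \<omega> \<in> B} = (\<Sum>z\<in>{z \<in> I. cell \<beta> (F z) = B}. e z A)"
      if A: "A \<in> \<alpha>" and B: "B \<in> \<beta>" for A B
    proof -
      have "{\<omega> \<in> space M. fst \<omega> \<in> A \<and> snd \<omega> \<in> B} = A \<times> (B \<inter> F ` I)" using spM by auto
      moreover have "A \<times> (B \<inter> F ` I) \<in> sets S"
        unfolding S_def using A \<alpha>'(2) by (intro pair_measureI) auto
      moreover have "(\<Sum>z\<in>I. \<integral>x. indicator (A \<times> (B \<inter> F ` I)) (x, F z) * w z x \<partial>r z) =
          (\<Sum>z\<in>I. if cell \<beta> (F z) = B then e z A else 0)"
      proof (intro sum.cong refl)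
        fix z assume z: "z \<in> I"
        have "cell \<beta> (F z) = B \<longleftrightarrow> F z \<in> B" by (rule cell_eq_iff[OF \<beta>'(3) F[OF z] B])
        then show "(\<integral>x. indicator (A \<times> (B \<inter> F ` I)) (x, F z) * w z x \<partial>r z) = (if cell \<beta> (F z) = B then e z A else 0)"
          using z by (auto simp: e_def indicator_def intro!: Bochner_Integration.integral_cong)
      qed
      moreover have "\<dots> = (\<Sum>z\<in>{z \<in> I. cell \<beta> (F z) = B}. e z A)"
        by (rule sum.inter_filter[OF finI, symmetric])
      ultimately have "emeasure M {\<omega> \<in> space M. fst \<omega> \<in> A \<and> snd \<omega> \<in> B} = ennreal (\<Sum>z\<in>{z \<in> I. cell \<beta> (F z) = B}. e z A)"
        using em by simp
      then show ?thesis using e0 unfolding measure_def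
        by (simp only:) (subst enn2real_ennreal, auto intro!: sum_nonneg)
    qed
    have pA: "measure M {\<omega> \<in> space M. fst \<omega> \<in> A} = measure \<mu> A" if "A \<in> sets borel" for A
      using emA[OF that] by (simp add: measure_def)
    have part: "(\<Sum>A\<in>\<alpha>. indicator A x) = (1 :: real)" for x
    proof -
      have "(\<Sum>A\<in>\<alpha>. indicator A x) = (\<Sum>A\<in>\<alpha>. if A = cell \<alpha> x then 1 else (0::real))"
        using cell_eq_iff[OF \<alpha>'(3)] by (intro sum.cong refl) (auto simp: indicator_def)
      then show ?thesis using cell_in[OF \<alpha>'(3)] \<alpha>'(1) by simp
    qed
    have tsum: "(\<Sum>A\<in>\<alpha>. t z A) = (\<integral>x. w z x * ln (w z x / qq z) \<partial>r z)" if z: "z \<in> I" for z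
    proof -
      have "(\<Sum>A\<in>\<alpha>. t z A) = (\<integral>x. (\<Sum>A\<in>\<alpha>. indicator A x * (w z x * ln (w z x / qq z))) \<partial>r z)"
        unfolding t_def using tint[OF z] \<alpha>'(2) by (intro Bochner_Integration.integral_sum[symmetric]) auto
      then show ?thesis by (simp add: sum_distrib_right[symmetric] part)
    qed
    have "(\<Sum>A\<in>\<alpha>. \<Sum>B\<in>\<beta>. measure M {\<omega> \<in> space M. fst \<omega> \<in> A \<and> snd \<omega> \<in> B} *
        ln (measure M {\<omega> \<in> space M. fst \<omega> \<in> A \<and> snd \<omega> \<in> B} /
          (measure M {\<omega> \<in> space M. fst \<omega> \<in> A} * measure M {\<omega> \<in> space M. snd \<omega> \<in> B}))) \<le> (\<Sum>z\<in>I. \<Sum>A\<in>\<alpha>. t z A)"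
    proof (rule data_processing_le[OF \<alpha>'(1) \<beta>'(1) finI, where h="\<lambda>z. cell \<beta> (F z)" and e=e and q=qq
          and s="\<lambda>z A. measure (r z) A"])
      show "(\<Sum>A\<in>\<alpha>. measure M {\<omega> \<in> space M. fst \<omega> \<in> A}) = 1"
      proof -
        have "(\<Sum>A\<in>\<alpha>. measure \<mu> {\<omega> \<in> space \<mu>. \<omega> \<in> A \<and> \<omega> \<in> UNIV}) = measure \<mu> {\<omega> \<in> space \<mu>. \<omega> \<in> UNIV}"
          using \<alpha>' \<mu>(2) sp\<mu> by (intro sum_measure_partition[OF \<mu>.finite_measure_axioms]) auto
        then have "(\<Sum>A\<in>\<alpha>. measure \<mu> A) = 1" using \<mu>.prob_space sp\<mu> by simp
        then show ?thesis using pA \<alpha>'(2) by (metis (no_types, lifting) subsetD sum.cong)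
      qed
      show "measure (r z) A \<le> measure M {\<omega> \<in> space M. fst \<omega> \<in> A}" if "z \<in> I" "A \<in> \<alpha>" for z A
      proof -
        have "measure (\<rho> (fst z)) A \<le> (\<Sum>k<K. measure (\<rho> k) A)"
          using that by (intro member_le_sum[where f="\<lambda>k. measure (\<rho> k) A"]) (auto simp: I_def)
        then show ?thesis using pA \<mu>A \<alpha>'(2) that by (auto simp: r_def)
      qed
      \<comment> \<open>The pointwise tangent of slope \<open>b\<close>, integrated over
        \<open>A\<close>: since \<open>qq z\<close> does not depend on the input, integration only
        produces the factor \<open>measure (r z) A\<close>.\<close>
      show "e z A * ln b + e z A - b * (measure (r z) A * qq z) \<le> t z A" if z: "z \<in> I" and A: "A \<in> \<alpha>" and b: "0 < b" for z A b
      proof -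
        interpret finite_measure "r z" using r(1)[OF z] .
        have A': "A \<in> sets borel" using A \<alpha>'(2) by auto
        have Ai: "integrable (r z) (indicator A :: 'a \<Rightarrow> real)"
          using A' r(2)[OF z] by (simp add: integrable_indicator_iff emeasure_eq_measure)
        have "e z A * ln b + e z A - b * (measure (r z) A * qq z) =
            (\<integral>x. (indicator A x * w z x) * ln b + indicator A x * w z x - indicator A x * (b * qq z) \<partial>r z)"
          using eint[OF z A'] Ai A' r(2,3)[OF z] by (simp add: e_def Bochner_Integration.integral_diff Bochner_Integration.integral_add algebra_simps)
        also have "\<dots> \<le> t z A"
          unfolding t_def
        proof (rule integral_mono)
          show "integrable (r z) (\<lambda>x. (indicator A x * w z x) * ln b + indicator A x * w z x - indicator A x * (b * qq z))"
            using eint[OF z A'] Ai by (intro Bochner_Integration.integrable_diff Bochner_Integration.integrable_add integrable_mult_left)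
          show "integrable (r z) (\<lambda>x. indicator A x * (w z x * ln (w z x / qq z)))" by (rule tint[OF z A'])
          fix x
          show "(indicator A x * w z x) * ln b + indicator A x * w z x - indicator A x * (b * qq z)
              \<le> indicator A x * (w z x * ln (w z x / qq z))"
            using mult_ln_ge_tangent[OF w(2)[OF z] qq[OF z] b, of x] by (auto simp: indicator_def)
        qed
        finally show ?thesis .
      qed
      show "0 \<le> t z A" if z: "z \<in> I" and A: "A \<in> \<alpha>" and e: "e z A = 0" for z A
      proof -
        have A': "A \<in> sets borel" using A \<alpha>'(2) by auto
        have "AE x in r z. indicator A x * w z x = 0"
          using e integral_nonneg_eq_0_iff_AE[OF eint[OF z A']] w(2)[OF z] by (simp add: e_def)
        then have "AE x in r z. indicator A x * (w z x * ln (w z x / qq z)) = 0"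
          by eventually_elim auto
        then have "t z A = 0" unfolding t_def by (rule integral_eq_zero_AE)
        then show ?thesis by simp
      qed
    qed (use FM(2,3) cAB e0 qq1 qq cell_in[OF \<beta>'(3) F] in \<open>auto intro: less_imp_le\<close>)
    also have "(\<Sum>z\<in>I. \<Sum>A\<in>\<alpha>. t z A) = (\<Sum>z\<in>I. \<integral>x. w z x * ln (w z x / qq z) \<partial>r z)"
      by (intro sum.cong refl tsum)
    also have "\<dots> = ln 2 * ((\<Sum>k<K. \<integral>x. j k x \<partial>\<rho> k) + log 2 (real K))"
    proof -
      have "(\<Sum>z\<in>I. \<integral>x. w z x * ln (w z x / qq z) \<partial>r z) =
          (\<Sum>k<K. ln 2 * (\<integral>x. j k x \<partial>\<rho> k) + ln (real K) * measure (\<rho> k) UNIV)"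
        unfolding Sk
      proof (rule sum.cong[OF refl])
        fix k assume "k \<in> {..<K}"
        then have k: "k < K" by simp
        interpret finite_measure "\<rho> k" using \<rho>(1)[OF k] .
        have tz: "integrable (\<rho> k) (\<lambda>x. w (k, i) x * ln (w (k, i) x / qq (k, i)))" if "i < m k" for i
          using tint[of "(k, i)" UNIV] that k by (simp add: I_def r_def)
        have "(\<Sum>i<m k. \<integral>x. w (k, i) x * ln (w (k, i) x / qq (k, i)) \<partial>r (k, i)) =
            (\<integral>x. (\<Sum>i<m k. w (k, i) x * ln (w (k, i) x / qq (k, i))) \<partial>\<rho> k)"
          using tz by (subst Bochner_Integration.integral_sum) (auto simp: r_def)
        also have "\<dots> = (\<integral>x. ln 2 * j k x + ln (real K) \<partial>\<rho> k)"
        proof (rule Bochner_Integration.integral_cong[OF refl])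
          fix x
          \<comment> \<open>Splits the factor \<open>K\<close> in \<open>qq\<close> off the
            logarithm: each unit of mass pays \<open>ln K\<close>, and the pieces have total mass
            one.\<close>
          have "w (k, i) x * ln (w (k, i) x / qq (k, i)) = ln 2 * (W k i x * log 2 (W k i x / q k i)) + w (k, i) x * ln (real K)"
            if i: "i < m k" for i
          proof (cases "w (k, i) x = 0")
            case False
            have z: "(k, i) \<in> I" using i k by (simp add: I_def)
            have "0 < w (k, i) x" using False w(2)[OF z, of x] by simp
            moreover have "0 < q k i" using qq[OF z] K0 by (simp add: qq_def zero_less_divide_iff)
            moreover have "ln 2 * (W k i x * log 2 (W k i x / q k i)) = W k i x * ln (W k i x / q k i)"
              by (simp add: log_def)
            ultimately show ?thesis using K0
              by (simp add: w_def qq_def ln_mult ln_div algebra_simps)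
          qed (simp add: w_def)
          then have "(\<Sum>i<m k. w (k, i) x * ln (w (k, i) x / qq (k, i))) =
              ln 2 * (\<Sum>i<m k. W k i x * log 2 (W k i x / q k i)) + (\<Sum>i<m k. w (k, i) x) * ln (real K)"
            by (simp add: sum.distrib sum_distrib_left sum_distrib_right)
          then show "(\<Sum>i<m k. w (k, i) x * ln (w (k, i) x / qq (k, i))) = ln 2 * j k x + ln (real K)"
            using w1[OF k] P[OF k] by (simp add: P_def)
        qed
        also have "\<dots> = ln 2 * (\<integral>x. j k x \<partial>\<rho> k) + ln (real K) * measure (\<rho> k) UNIV"
          using chan_integrable(1)[OF ch[OF k] region_cube finite_measure_axioms \<rho>(2)[OF k]] sp\<rho>[OF k]
          by simp
        finally show "(\<Sum>i<m k. \<integral>x. w (k, i) x * ln (w (k, i) x / qq (k, i)) \<partial>r (k, i)) =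
          ln 2 * (\<integral>x. j k x \<partial>\<rho> k) + ln (real K) * measure (\<rho> k) UNIV" .
      qed
      also have "\<dots> = ln 2 * (\<Sum>k<K. \<integral>x. j k x \<partial>\<rho> k) + ln (real K) * (\<Sum>k<K. measure (\<rho> k) UNIV)"
        by (simp add: sum.distrib sum_distrib_left)
      also have "(\<Sum>k<K. measure (\<rho> k) UNIV) = 1" using \<mu>A[of UNIV] \<mu>.prob_space sp\<mu> by simp
      finally show ?thesis by (simp add: log_def distrib_left)
    qed
    finally have fin: "(\<Sum>A\<in>\<alpha>. \<Sum>B\<in>\<beta>. measure M {\<omega> \<in> space M. fst \<omega> \<in> A \<and> snd \<omega> \<in> B} *
        ln (measure M {\<omega> \<in> space M. fst \<omega> \<in> A \<and> snd \<omega> \<in> B} /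
          (measure M {\<omega> \<in> space M. fst \<omega> \<in> A} * measure M {\<omega> \<in> space M. snd \<omega> \<in> B}))) / ln 2 \<le>
        (\<Sum>k<K. \<integral>x. j k x \<partial>\<rho> k) + log 2 (real K)"
      by (simp add: divide_le_eq mult.commute)
    show "ereal (finite_mutual_information M (cell \<alpha> \<circ> fst) (cell \<beta> \<circ> snd)) \<le>
        ereal ((\<Sum>k<K. \<integral>x. j k x \<partial>\<rho> k) + log 2 (real K))"
      unfolding FM(1) using fin by (simp add: log_def sum_divide_distrib)
  qed
  moreover have "rate_distortion_cube T \<mu> L \<epsilon> \<le> mutual_info M borel (L1_borel L) fst snd"
    unfolding rate_distortion_cube_def
    using probM fstM dM sndM exp[unfolded g_def rcost_def] by (intro Inf_lower) blast
  ultimately show ?thesis by (rule order_trans[rotated])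
qed

end

subsection \<open>Quantisation\<close>

text \<open>A simple function written as a decision list. Lists over two countable sets form a
  countable family, and the sets in a list need not be disjoint.\<close>

primrec pick :: "('a \<times> 'b set) list \<Rightarrow> 'a \<Rightarrow> 'b \<Rightarrow> 'a" where
  "pick [] d u = d"
| "pick (p # ps) d u = (if u \<in> snd p then fst p else pick ps d u)"

lemma pick_eq:
  assumes "x \<in> set xs" "u \<in> C x"
  shows "\<exists>x\<in>set xs. u \<in> C x \<and> pick (map (\<lambda>x. (x, C x)) xs) d u = x"
  using assms by (induction xs) auto

lemma pick_measurable:
  assumes "\<And>p. p \<in> set ps \<Longrightarrow> snd p \<in> sets M" "d \<in> space N" "\<And>p. p \<in> set ps \<Longrightarrow> fst p \<in> space N"
  shows "pick ps d \<in> measurable M N"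
  using assms
proof (induction ps)
  case Nil
  have "pick [] d = (\<lambda>u. d)" by (simp add: fun_eq_iff)
  then show ?case using Nil by simp
next
  case (Cons p ps)
  then have "pick ps d \<in> measurable M N" by simp
  then have "(\<lambda>u. if u \<in> snd p then fst p else pick ps d u) \<in> measurable M N"
    using Cons.prems by (intro measurable_If_set) auto
  moreover have "pick (p # ps) d = (\<lambda>u. if u \<in> snd p then fst p else pick ps d u)"
    by (simp add: fun_eq_iff)
  ultimately show ?case by simp
qed

text \<open>Outer regularity gives an open set slightly larger than \<open>A\<close>; it is an
  increasing union of finite unions of basic open sets, and these form a countable family fixed in
  advance.\<close>

lemma measure_approx_countable:
  obtains \<C> :: "'b::euclidean_space set set" where "countable \<C>" "\<And>C. C \<in> \<C> \<Longrightarrow> open C"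
    "\<And>A e. A \<in> sets borel \<Longrightarrow> emeasure lborel A < \<infinity> \<Longrightarrow> 0 < (e::real) \<Longrightarrow>
       \<exists>C\<in>\<C>. measure lborel ((A - C) \<union> (C - A)) < e \<and> emeasure lborel C < \<infinity>"
proof -
  obtain B :: "'b set set" where B: "countable B" "topological_basis B" using ex_countable_basis by blast
  define \<C> where "\<C> = Union ` {S. finite S \<and> S \<subseteq> B}"
  have 1: "countable \<C>" unfolding \<C>_def by (intro countable_image countable_Collect_finite_subset B)
  have Bo: "open b" if "b \<in> B" for b using that B(2) topological_basis_open by blast
  then have 2: "open C" if "C \<in> \<C>" for C using that by (auto simp: \<C>_def)
  have "\<exists>C\<in>\<C>. measure lborel ((A - C) \<union> (C - A)) < e \<and> emeasure lborel C < \<infinity>"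
    if A: "A \<in> sets borel" "emeasure lborel A < \<infinity>" and e: "0 < (e::real)" for A e
  proof -
    obtain U where U: "open U" "A \<subseteq> U" "emeasure lborel (U - A) < ennreal (e / 2)"
      using outer_regular_lborel[OF A(1), of "e / 2"] e by auto
    have fU: "emeasure lborel U < \<infinity>"
    proof -
      have "emeasure lborel U = emeasure lborel (A \<union> (U - A))" using U(2) by (simp add: Un_absorb1)
      also have "\<dots> \<le> emeasure lborel A + emeasure lborel (U - A)"
        using A(1) U(1) by (intro emeasure_subadditive) auto
      also have "\<dots> < \<infinity>" using A(2) U(3) by (auto intro: order.strict_trans)
      finally show ?thesis .
    qed
    obtain B' where B': "B' \<subseteq> B" "\<Union>B' = U" using B(2) U(1) by (auto simp: topological_basis_def)
    \<comment> \<open>The empty set is added so that an enumeration exists even if \<open>B'\<close>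
      is empty; it is taken out again when membership in \<open>\<C>\<close> is checked.\<close>
    define b where "b = from_nat_into (insert {} B')"
    have cB': "countable (insert {} B')" using B(1) B'(1) countable_subset by auto
    have rb: "range b = insert {} B'" unfolding b_def by (intro range_from_nat_into) (use cB' in auto)
    define V where "V n = (\<Union>i<n. b i)" for n
    have Vo: "open (V n)" for n
      unfolding V_def using rb B'(1) Bo by (intro open_UN ballI) (metis insertE open_empty rangeI subsetD)
    have UV: "(\<Union>n. V n) = U"
    proof -
      have "(\<Union>n. V n) = \<Union>(range b)" by (auto simp: V_def)
      then show ?thesis using rb B'(2) by simp
    qed
    have "(\<lambda>n. measure lborel (V n)) \<longlonglongrightarrow> measure lborel (\<Union>n. V n)"
    proof (rule Lim_measure_incseq)
      show "incseq V" unfolding V_def by (intro monoI UN_mono) auto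
    qed (use fU UV Vo in auto)
    then have "(\<lambda>n. measure lborel (V n)) \<longlonglongrightarrow> measure lborel U" by (simp only: UV)
    from order_tendstoD(1)[OF this, of "measure lborel U - e / 2"] e
    obtain n where n: "measure lborel U - e / 2 < measure lborel (V n)"
      by (auto simp: eventually_sequentially)
    have VU: "V n \<subseteq> U" using UV by auto
    have VC: "V n \<in> \<C>"
    proof -
      have "V n = \<Union>(b ` {..<n} - {{}})" unfolding V_def by auto
      moreover have "b ` {..<n} - {{}} \<subseteq> B" using rb B'(1) by auto
      ultimately show ?thesis unfolding \<C>_def by blast
    qed
    have fV: "emeasure lborel (V n) < \<infinity>"
      using emeasure_mono[OF VU, of lborel] U(1) fU by (auto intro: order.strict_trans1)
    have m1: "measure lborel (U - A) < e / 2"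
    proof -
      have "emeasure lborel (U - A) = ennreal (measure lborel (U - A))"
        by (rule emeasure_eq_ennreal_measure) (use U(3) in auto)
      then show ?thesis using U(3) by (simp add: ennreal_less_iff)
    qed
    have m2: "measure lborel (U - V n) < e / 2"
      using n fU Vo U(1) VU fV by (subst measure_Diff) auto
    have "measure lborel ((A - V n) \<union> (V n - A)) \<le> measure lborel ((U - A) \<union> (U - V n))"
    proof (rule measure_mono_fmeasurable)
      show "(U - A) \<union> (U - V n) \<in> fmeasurable lborel"
      proof (rule fmeasurableI)
        have "emeasure lborel ((U - A) \<union> (U - V n)) \<le> emeasure lborel U"
          using U(1) by (intro emeasure_mono) auto
        then show "emeasure lborel ((U - A) \<union> (U - V n)) < \<infinity>" using fU by (rule order.strict_trans1)
        show "(U - A) \<union> (U - V n) \<in> sets lborel" using U(1) A(1) Vo by auto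
      qed
    qed (use U VU A Vo in auto)
    also have "\<dots> \<le> measure lborel (U - A) + measure lborel (U - V n)"
      using U(1) A(1) Vo by (intro measure_Un_le) auto
    finally show ?thesis using m1 m2 VC fV by (intro bexI[of _ "V n"]) auto
  qed
  with that[OF 1 2] show thesis by blast
qed

text \<open>Empty levels are removed because \<open>partition_on\<close> admits no empty cell; a
  summand that vanishes on \<open>{}\<close> does not notice.\<close>

definition level_partition :: "('b \<Rightarrow> nat) \<Rightarrow> nat \<Rightarrow> 'b set \<Rightarrow> 'b set set" where
  "level_partition h k \<Omega> = (\<lambda>a. {x \<in> \<Omega>. h x = a}) ` {..<k} - {{}}"

lemma sum_level_partition:
  fixes f :: "'b set \<Rightarrow> real"
  assumes "f {} = 0"
  shows "(\<Sum>A\<in>level_partition h k \<Omega>. f A) = (\<Sum>a<k. f {x \<in> \<Omega>. h x = a})"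
proof -
  have "(\<Sum>A\<in>level_partition h k \<Omega>. f A) = (\<Sum>A\<in>(\<lambda>a. {x \<in> \<Omega>. h x = a}) ` {..<k}. f A)"
    unfolding level_partition_def using assms by (intro sum.mono_neutral_left) auto
  also have "\<dots> = (\<Sum>a<k. (f \<circ> (\<lambda>a. {x \<in> \<Omega>. h x = a})) a)"
  proof (rule sum.reindex_nontrivial)
    fix a b assume "a \<noteq> b" "{x \<in> \<Omega>. h x = a} = {x \<in> \<Omega>. h x = b}"
    then have "{x \<in> \<Omega>. h x = a} = {}" by blast
    then show "f {x \<in> \<Omega>. h x = a} = 0" by (simp only: assms)
  qed simp
  finally show ?thesis by simp
qed

lemma level_partition_in:
  assumes "h \<in> measurable S (count_space UNIV)" "\<And>x. x \<in> space S \<Longrightarrow> h x < k"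
  shows "level_partition h k (space S) \<in> finite_partitions S"
proof -
  have "{x \<in> space S. h x = a} \<in> sets S" for a
    using measurable_sets[OF assms(1), of "{a}"] by (simp add: vimage_def Int_def conj_commute)
  then show ?thesis
    using assms(2) unfolding finite_partitions_def level_partition_def partition_on_def disjoint_def
    by auto
qed

text \<open>The log-sum inequality for the pairs \<open>(a, b)\<close> and \<open>(s, s)\<close>,
  the second of which has logarithm zero. Masses can thus be made positive without raising the
  information.\<close>

lemma log_ratio_mix_le:
  fixes a b s :: real
  assumes "0 \<le> a" "0 \<le> b" "0 < a \<Longrightarrow> 0 < b" "0 < s"
  shows "(a + s) * log 2 ((a + s) / (b + s)) \<le> a * log 2 (a / b)"
proof -
  let ?r = "(a + s) / (b + s)"
  have r: "0 < ?r" using assms by simp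
  have "(a + s) * ln ?r \<le> a * ln (a / b)"
  proof (cases "a = 0")
    case True
    then have "ln ?r \<le> ln 1" using assms r by (intro ln_mono) auto
    then show ?thesis using True assms by (simp add: mult_nonneg_nonpos)
  next
    case False
    then have "0 < a" "0 < b" using assms by auto
    \<comment> \<open>One slope serves both pairs; as \<open>?r\<close> is the ratio of the totals,
      the linear terms of the two tangents cancel.\<close>
    have "a * ln ?r + a - ?r * b \<le> a * ln (a / b)"
      by (rule mult_ln_ge_tangent) (use \<open>0 < a\<close> \<open>0 < b\<close> r in auto)
    moreover have "s * ln ?r + s - ?r * s \<le> s * ln (s / s)"
      by (rule mult_ln_ge_tangent) (use assms r in auto)
    moreover have "?r * b + ?r * s = a + s"
      unfolding distrib_left[symmetric] using assms by simp
    ultimately show ?thesis using assms(4) by (simp add: distrib_right)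
  qed
  then show ?thesis by (simp add: log_def divide_right_mono)
qed

text \<open>Matrices are functions on all index pairs, so that the product topology supplies
  separability; columns from \<open>m\<close> on are unconstrained. Strict positivity makes the
  information continuous in the entries.\<close>

definition stochastic :: "nat \<Rightarrow> (nat \<times> nat \<Rightarrow> real) set" where
  "stochastic m = {z. \<forall>a. (\<forall>i<m. 0 < z (a, i)) \<and> (\<Sum>i<m. z (a, i)) = 1}"

lemma stochastic_dense:
  obtains D where "countable D" "D \<subseteq> stochastic m"
    "\<And>z. z \<in> stochastic m \<Longrightarrow> \<exists>f. (\<forall>n. f n \<in> D) \<and> (\<forall>p. (\<lambda>n. f n p) \<longlonglongrightarrow> z p)"
proof -
  obtain D where D: "countable D" "D \<subseteq> stochastic m" "stochastic m \<subseteq> closure D"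
    using separable by blast
  have "\<exists>f. (\<forall>n. f n \<in> D) \<and> (\<forall>p. (\<lambda>n. f n p) \<longlonglongrightarrow> z p)" if "z \<in> stochastic m" for z
  proof -
    have "z \<in> closure D" using that D(3) by blast
    then obtain f where f: "\<forall>n. f n \<in> D" "f \<longlonglongrightarrow> z" unfolding closure_sequential by blast
    have "(\<lambda>n. f n p) \<longlonglongrightarrow> z p" for p
    proof -
      have "continuous_on UNIV (\<lambda>f :: nat \<times> nat \<Rightarrow> real. f p)" by (rule continuous_on_product_coordinates)
      from continuous_on_tendsto_compose[OF this f(2)] show ?thesis by simp
    qed
    with f(1) show ?thesis by blast
  qed
  with D show thesis using that by blast
qed

context compact_action
begin

text \<open>By compactness a map is within \<open>\<delta>\<close> of one with finitely many values
  in a countable dense set. Its level sets are then replaced by members of a countable family of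
  open sets.\<close>

lemma L1_separable:
  assumes L: "0 < L"
  obtains G where "\<And>n::nat. G n \<in> L1_space L"
    "\<And>F e. F \<in> L1_space L \<Longrightarrow> 0 < e \<Longrightarrow> \<exists>n. L1_dist L (F :: (real ^ 'n \<Rightarrow> 'a) set) (G n) < e"
proof -
  obtain \<C> :: "(real ^ 'n) set set" where \<C>: "countable \<C>" "\<And>C. C \<in> \<C> \<Longrightarrow> open C"
    "\<And>A e. A \<in> sets borel \<Longrightarrow> emeasure lborel A < \<infinity> \<Longrightarrow> 0 < (e::real) \<Longrightarrow>
       \<exists>C\<in>\<C>. measure lborel ((A - C) \<union> (C - A)) < e \<and> emeasure lborel C < \<infinity>"
    using measure_approx_countable by blast
  obtain D :: "'a set" where D: "countable D" "\<And>X. open X \<Longrightarrow> X \<noteq> {} \<Longrightarrow> \<exists>d\<in>D. d \<in> X"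
    using countable_dense_setE by blast
  define \<P> where "\<P> = (\<lambda>ps. L1_class L (pick ps undefined)) ` lists (D \<times> \<C>)"
  have cP: "countable \<P>" unfolding \<P>_def using D(1) \<C>(1) by auto
  have neP: "\<P> \<noteq> {}" unfolding \<P>_def by (auto intro: lists.Nil)
  have pm: "pick ps undefined \<in> borel_measurable borel" if "ps \<in> lists (D \<times> \<C>)" for ps :: "('a \<times> (real ^ 'n) set) list"
    using that \<C>(2) by (intro pick_measurable) (auto simp: lists_eq_set)
  have PL: "P \<in> L1_space L" if P: "P \<in> \<P>" for P
  proof -
    obtain ps where ps: "ps \<in> lists (D \<times> \<C>)" "P = L1_class L (pick ps undefined)"
      using P unfolding \<P>_def by blast
    show ?thesis unfolding ps(2)
      by (intro L1_class_in measurable_restrict_space1) (simp add: pm[OF ps(1)])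
  qed
  have "\<exists>P\<in>\<P>. L1_dist L F P < e" if F: "F \<in> L1_space L" and e: "0 < e" for F e
  proof -
    let ?Ld = "L ^ CARD('n)"
    have Ld: "0 < ?Ld" using L by simp
    obtain y where y: "y \<in> borel_measurable borel" "\<And>u. u \<in> cube L \<Longrightarrow> y u = L1_rep F u"
      using L1_space_borel_rep[OF F] by metis
    \<comment> \<open>Half of the error \<open>e\<close> is granted to the mesh, spread over the
      volume of the cube.\<close>
    define \<delta> where "\<delta> = e / (2 * ?Ld)"
    have \<delta>: "0 < \<delta>" using e Ld by (simp add: \<delta>_def)
    have cov: "UNIV \<subseteq> (\<Union>x\<in>D. ball x \<delta>)"
    proof
      fix x :: 'a
      have "ball x \<delta> \<noteq> {}" using \<delta> by simp
      with D(2)[of "ball x \<delta>"] obtain d where "d \<in> D" "d \<in> ball x \<delta>" by auto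
      then show "x \<in> (\<Union>x\<in>D. ball x \<delta>)" by (auto simp: dist_commute)
    qed
    obtain K where K: "K \<subseteq> D" "finite K" "UNIV \<subseteq> (\<Union>x\<in>K. ball x \<delta>)"
      using compactE_image[OF compact_UNIV _ cov] by auto
    obtain xs where xs: "set xs = K" using K(2) finite_list by blast
    have K0: "0 < card K" using K by (auto simp: card_gt_0_iff)
    define A where "A x = y -` ball x \<delta> \<inter> cube L" for x
    have A: "A x \<in> sets borel" for x
      unfolding A_def using measurable_sets[OF y(1), of "ball x \<delta>"] by auto
    have fA: "emeasure lborel (A x) < \<infinity>" for x
    proof -
      have "emeasure lborel (A x) \<le> emeasure lborel (cube L :: (real ^ 'n) set)"
        by (rule emeasure_mono) (auto simp: A_def)
      then show ?thesis using region_cube[of L] by (simp add: region_def order.strict_trans1)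
    qed
    \<comment> \<open>All exceptional sets together may use a quarter of \<open>e\<close>;
      \<open>diam_space + 1\<close> avoids a division by zero for a one-point space.\<close>
    define \<eta> where "\<eta> = e / (4 * (diam_space + 1) * real (card K))"
    have \<eta>: "0 < \<eta>" using e diam_space_nonneg K0 by (simp add: \<eta>_def)
    have "\<forall>x. \<exists>C\<in>\<C>. measure lborel ((A x - C) \<union> (C - A x)) < \<eta> \<and> emeasure lborel C < \<infinity>"
      using \<C>(3)[OF A fA \<eta>] by blast
    then obtain C where C: "\<And>x. C x \<in> \<C>" "\<And>x. measure lborel ((A x - C x) \<union> (C x - A x)) < \<eta>" "\<And>x. emeasure lborel (C x) < \<infinity>"
      by metis
    define ps where "ps = map (\<lambda>x. (x, C x)) xs"
    have ps: "ps \<in> lists (D \<times> \<C>)" using xs K(1) C(1) by (auto simp: ps_def lists_eq_set)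
    define E where "E x = (A x - C x) \<union> (C x - A x)" for x
    have E: "E x \<in> sets borel" for x unfolding E_def using A \<C>(2)[OF C(1)] by auto
    have fE: "emeasure lborel (E x) < \<infinity>" for x
    proof -
      have "emeasure lborel (E x) \<le> emeasure lborel (A x \<union> C x)"
        using A \<C>(2)[OF C(1)] by (intro emeasure_mono) (auto simp: E_def)
      also have "\<dots> \<le> emeasure lborel (A x) + emeasure lborel (C x)"
        using A \<C>(2)[OF C(1)] by (intro emeasure_subadditive) auto
      also have "\<dots> < \<infinity>" using fA C(3) by auto
      finally show ?thesis .
    qed
    \<comment> \<open>Off the sets \<open>E x\<close>, membership in \<open>C x\<close> and in
      \<open>A x\<close> agree for \<open>x \<in> K\<close>. Whichever entry \<open>pick\<close>
      meets first is then a centre whose ball contains \<open>y u\<close>, although the sets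
      \<open>C x\<close> may overlap.\<close>
    have bound: "dist (y u) (pick ps undefined u) \<le> \<delta> + (\<Sum>x\<in>K. diam_space * indicator (E x) u)"
      if u: "u \<in> cube L" for u
    proof (cases "\<exists>x\<in>K. u \<in> E x")
      case True
      then obtain x where x: "x \<in> K" "u \<in> E x" by auto
      have "diam_space * indicator (E x) u \<le> (\<Sum>x\<in>K. diam_space * indicator (E x) u)"
        using x K(2) diam_space_nonneg by (intro member_le_sum) auto
      then show ?thesis using x dist_le_diam[of "y u" "pick ps undefined u"] \<delta> by simp
    next
      case False
      obtain x where x: "x \<in> K" "y u \<in> ball x \<delta>" using K(3) by blast
      then have "u \<in> A x" using u by (simp add: A_def)
      then have "u \<in> C x" using False x by (auto simp: E_def)
      then obtain x' where x': "x' \<in> K" "u \<in> C x'" "pick ps undefined u = x'"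
        using pick_eq[of x xs u C undefined] x xs by (auto simp: ps_def)
      then have "u \<in> A x'" using False by (auto simp: E_def)
      then have "dist (y u) x' < \<delta>" by (simp add: A_def dist_commute)
      moreover have "0 \<le> (\<Sum>x\<in>K. diam_space * indicator (E x) u)"
        using diam_space_nonneg by (intro sum_nonneg) auto
      ultimately show ?thesis using x' by simp
    qed
    have pL: "pick ps undefined \<in> borel_measurable (cube_measure L)"
      using pm[OF ps] by (intro measurable_restrict_space1) simp
    have PP: "L1_class L (pick ps undefined) \<in> L1_space L" by (rule L1_class_in[OF pL])
    have "L1_dist L F (L1_class L (pick ps undefined)) = (\<integral>u. dist (y u) (pick ps undefined u) \<partial>cube_measure L)"
      unfolding L1_dist_def
    proof (rule integral_cong_AE)
      have yL: "y \<in> borel_measurable (cube_measure L)"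
        using y(1) by (intro measurable_restrict_space1) simp
      show "(\<lambda>u. dist (y u) (pick ps undefined u)) \<in> borel_measurable (cube_measure L)"
        using yL pL by (rule borel_measurable_dist)
      show "(\<lambda>u. dist (L1_rep F u) (L1_rep (L1_class L (pick ps undefined)) u)) \<in> borel_measurable (cube_measure L)"
        using L1_rep_measurable[OF F] L1_rep_measurable[OF PP] by (rule borel_measurable_dist)
      have "AE u in cube_measure L. L1_rep F u = y u"
        using y(2) by (intro AE_I2) (simp add: space_restrict_space)
      with L1_rep_class[OF pL]
      show "AE u in cube_measure L. dist (L1_rep F u) (L1_rep (L1_class L (pick ps undefined)) u) = dist (y u) (pick ps undefined u)"
        by eventually_elim simp
    qed
    also have "\<dots> = (LINT u:cube L|lborel. dist (y u) (pick ps undefined u))"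
      unfolding set_lebesgue_integral_def by (rule integral_restrict_space) simp
    also have "\<dots> \<le> (\<integral>u. indicator (cube L) u * \<delta> + (\<Sum>x\<in>K. diam_space * indicator (E x) u) \<partial>lborel)"
      unfolding set_lebesgue_integral_def
    proof (rule integral_mono)
      have i: "integrable lborel (\<lambda>u :: real ^ 'n. indicator (cube L) u * \<delta> :: real)"
        using region_cube[of L] by (auto simp: region_def)
      show "integrable lborel (\<lambda>u. indicator (cube L) u * \<delta> + (\<Sum>x\<in>K. diam_space * indicator (E x) u))"
        using i fE E by (intro Bochner_Integration.integrable_add Bochner_Integration.integrable_sum) auto
      have "integrable (cube_measure L) (\<lambda>u. dist (y u) (pick ps undefined u))"
        using y(1) pm[OF ps] by (intro dist_integrable_cube measurable_restrict_space1) auto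
      then show "integrable lborel (\<lambda>u. indicator (cube L) u *\<^sub>R dist (y u) (pick ps undefined u))"
        by (subst (asm) integrable_restrict_space) auto
      show "indicator (cube L) u *\<^sub>R dist (y u) (pick ps undefined u) \<le> indicator (cube L) u * \<delta> + (\<Sum>x\<in>K. diam_space * indicator (E x) u)" for u
        using bound[of u] diam_space_nonneg by (cases "u \<in> cube L") (auto intro: sum_nonneg)
    qed
    also have "\<dots> = ?Ld * \<delta> + (\<Sum>x\<in>K. diam_space * measure lborel (E x))"
      using fE E region_cube[of L] L
      by (subst Bochner_Integration.integral_add) (auto simp: region_def measure_cube)
    also have "\<dots> \<le> ?Ld * \<delta> + (\<Sum>x\<in>K. diam_space * \<eta>)"
      using C(2) diam_space_nonneg unfolding E_def by (intro add_left_mono sum_mono mult_left_mono) (auto simp: less_imp_le)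
    also have "\<dots> < e"
    proof -
      have "real (card K) * (diam_space * \<eta>) = diam_space / (diam_space + 1) * (e / 4)"
      proof -
        have "diam_space + 1 \<noteq> 0" using diam_space_nonneg by linarith
        then show ?thesis using K0 by (simp add: \<eta>_def)
      qed
      also have "\<dots> \<le> 1 * (e / 4)"
        using e diam_space_nonneg by (intro mult_right_mono) auto
      finally have "real (card K) * (diam_space * \<eta>) \<le> e / 4" by simp
      moreover have "?Ld * \<delta> = e / 2" using L by (simp add: \<delta>_def)
      ultimately show ?thesis using e by simp
    qed
    finally show ?thesis using ps unfolding \<P>_def by blast
  qed
  then show thesis
    using that[of "from_nat_into \<P>"] PL from_nat_into[OF neP] from_nat_into_surj[OF cP] by metis
qed

text \<open>The half-open cube is enlarged to the closed one, whose product with the space is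
  compact.\<close>

lemma T_uniform:
  assumes e: "0 < e"
  obtains \<delta> where "0 < \<delta>" "\<And>x x' u. dist x x' < \<delta> \<Longrightarrow> u \<in> cube L \<Longrightarrow> dist (T u x) (T u x') < e"
proof -
  let ?K = "cbox 0 (\<chi> i. L) \<times> (UNIV :: 'a set)"
  have "compact ?K" using compact_UNIV by (intro compact_Times) auto
  then have "uniformly_continuous_on ?K (\<lambda>z. T (fst z) (snd z))"
    using continuous_on_subset[OF continuous_T] by (intro compact_uniformly_continuous) auto
  then obtain \<delta> where \<delta>: "0 < \<delta>" "\<And>z z'. z \<in> ?K \<Longrightarrow> z' \<in> ?K \<Longrightarrow> dist z' z < \<delta> \<Longrightarrow>
      dist (T (fst z') (snd z')) (T (fst z) (snd z)) < e"
    using e unfolding uniformly_continuous_on_def by metis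
  show thesis
  proof (rule that[OF \<delta>(1)])
    fix x x' :: 'a and u :: "real ^ 'n" assume d: "dist x x' < \<delta>" and u: "u \<in> cube L"
    have "u \<in> cbox 0 (\<chi> i. L)" using u by (auto simp: cube_def mem_box_cart less_imp_le)
    then show "dist (T u x) (T u x') < e"
      using \<delta>(2)[of "(u, x')" "(u, x)"] d by (simp add: dist_Pair_Pair)
  qed
qed

text \<open>The class is the index of the first sufficiently close point of a finite net. Inputs of
  one class have orbits that stay close over the whole cube, so they may share one row of a
  stochastic matrix.\<close>

lemma classifier:
  assumes e: "0 < e"
  obtains g :: "'a \<Rightarrow> nat" and k where "g \<in> measurable borel (count_space UNIV)" "\<And>x. g x < k"
    "\<And>x x' u. g x = g x' \<Longrightarrow> u \<in> cube L \<Longrightarrow> dist (T u x) (T u x') < e"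
proof -
  obtain \<delta> where \<delta>: "0 < \<delta>" "\<And>x x' u. dist x x' < \<delta> \<Longrightarrow> u \<in> cube L \<Longrightarrow> dist (T u x) (T u x') < e"
    using T_uniform[OF e] by blast
  have cov: "UNIV \<subseteq> (\<Union>x\<in>UNIV. ball x (\<delta> / 2))" using \<delta> by (auto intro!: exI[of _ "_::'a"])
  obtain K :: "'a set" where K: "finite K" "UNIV \<subseteq> (\<Union>x\<in>K. ball x (\<delta> / 2))"
    using compactE_image[OF compact_UNIV _ cov] by auto
  obtain xs where xs: "set xs = K" using K(1) finite_list by blast
  define P where "P i x \<longleftrightarrow> i < length xs \<and> dist (xs ! i) x < \<delta> / 2" for i x
  have ex: "\<exists>i. P i x" for x
  proof -
    obtain c where "c \<in> set xs" "dist c x < \<delta> / 2" using K(2) xs by fastforce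
    then show ?thesis by (auto simp: P_def in_set_conv_nth)
  qed
  define g where "g x = (LEAST i. P i x)" for x
  have gP: "P (g x) x" for x unfolding g_def using ex by (rule LeastI_ex)
  have "(\<lambda>x. P i x) \<in> measurable borel (count_space UNIV)" for i unfolding P_def by measurable
  then have m: "g \<in> measurable borel (count_space UNIV)" unfolding g_def by (rule measurable_Least)
  show thesis
  proof (rule that[OF m, of "length xs"])
    show "g x < length xs" for x using gP[of x] by (simp add: P_def)
    fix x x' :: 'a and u :: "real ^ 'n" assume "g x = g x'" "u \<in> cube L"
    then show "dist (T u x) (T u x') < e"
      using gP[of x] gP[of x'] dist_triangle_half_r[of "xs ! g x" x \<delta> x'] by (intro \<delta>(2)) (auto simp: P_def)
  qed
qed

text \<open>The first index within \<open>e\<close>, not a minimiser: each condition describes a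
  metric ball, so this choice is measurable for \<open>L1_borel L\<close>.\<close>

definition nearest :: "real \<Rightarrow> (nat \<Rightarrow> (real ^ 'n \<Rightarrow> 'a) set) \<Rightarrow> real \<Rightarrow> (real ^ 'n \<Rightarrow> 'a) set \<Rightarrow> nat" where
  "nearest L G e F = (LEAST i. L1_dist L F (G i) < e)"

lemma nearest_measurable:
  assumes G: "\<And>n. G n \<in> L1_space L"
  shows "nearest L G e \<in> measurable (L1_borel L) (count_space UNIV)"
  unfolding nearest_def
proof (rule measurable_Least)
  interpret Metric_space "L1_space L :: (real ^ 'n \<Rightarrow> 'a) set set" "L1_dist L" by (rule Metric_space_L1)
  fix i
  have "{F \<in> space (L1_borel L). L1_dist L F (G i) < e} = mball (G i) e"
    using G by (auto simp: space_L1_borel commute)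
  also have "\<dots> \<in> sets (L1_borel L)" unfolding L1_borel_def by (rule mball_in_sets_borel_of)
  finally show "(\<lambda>F. L1_dist L F (G i) < e) \<in> measurable (L1_borel L) (count_space UNIV)"
    by (simp add: pred_def)
qed

lemma nearest_less:
  assumes "\<exists>n. L1_dist L F (G n) < e"
  shows "L1_dist L F (G (nearest L G e F)) < e"
  unfolding nearest_def using assms by (rule LeastI_ex)

lemma rcost_fixed_measurable:
  assumes "F \<in> L1_space L"
  shows "(\<lambda>x. rcost L x F) \<in> borel_measurable borel"
proof -
  obtain y where y: "y \<in> borel_measurable borel" "\<And>x. rcost L x F = dcost (cube L) x y"
    using L1_space_borel_rep[OF assms] by metis
  show ?thesis unfolding y(2) by (rule dcost_measurable[OF region_cube y(1)])
qed

lemma rcost_quantised_measurable: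
  fixes G :: "nat \<Rightarrow> (real ^ 'n \<Rightarrow> 'a) set"
  assumes G: "\<And>n. G n \<in> L1_space L" and X: "X \<in> borel_measurable M"
    and K: "K \<in> measurable M (count_space UNIV)"
  shows "(\<lambda>\<omega>. rcost L (X \<omega>) (G (K \<omega>))) \<in> borel_measurable M"
proof (rule measurable_compose_countable[where f="\<lambda>i \<omega>. rcost L (X \<omega>) (G i)", OF _ K])
  show "(\<lambda>\<omega>. rcost L (X \<omega>) (G i)) \<in> borel_measurable M" for i
    using measurable_compose[OF X rcost_fixed_measurable[OF G]] .
qed

text \<open>Joint measurability is not evident, since \<open>L1_rep\<close> is an arbitrary choice.
  The function is a uniform limit of its values at quantised outputs, which involve countably many
  codewords only.\<close>

lemma rcost_measurable:
  assumes L: "0 < L" and X: "X \<in> borel_measurable M" and Y: "Y \<in> measurable M (L1_borel L)"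
  shows "(\<lambda>\<omega>. rcost L (X \<omega>) (Y \<omega>)) \<in> borel_measurable M"
proof -
  obtain G where G: "\<And>n::nat. G n \<in> L1_space L"
    "\<And>F e. F \<in> L1_space L \<Longrightarrow> 0 < e \<Longrightarrow> \<exists>n. L1_dist L (F :: (real ^ 'n \<Rightarrow> 'a) set) (G n) < e"
    using L1_separable[OF L] by blast
  let ?e = "\<lambda>n. inverse (real (Suc n))"
  let ?h = "\<lambda>n \<omega>. rcost L (X \<omega>) (G (nearest L G (?e n) (Y \<omega>)))"
  interpret Metric_space "L1_space L :: (real ^ 'n \<Rightarrow> 'a) set set" "L1_dist L" by (rule Metric_space_L1)
  show ?thesis
  proof (rule borel_measurable_LIMSEQ_real)
    show "?h n \<in> borel_measurable M" for n
      using measurable_compose[OF Y nearest_measurable[OF G(1)]]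
      by (rule rcost_quantised_measurable[OF G(1) X])
    fix \<omega> assume "\<omega> \<in> space M"
    then have Y\<omega>: "Y \<omega> \<in> L1_space L" using measurable_space[OF Y] by (simp add: space_L1_borel)
    have "\<bar>?h n \<omega> - rcost L (X \<omega>) (Y \<omega>)\<bar> \<le> ?e n" for n
    proof -
      have "L1_dist L (Y \<omega>) (G (nearest L G (?e n) (Y \<omega>))) < ?e n"
        by (rule nearest_less[OF G(2)[OF Y\<omega>]]) simp
      then show ?thesis
        using rcost_diff_le[OF G(1) Y\<omega>, of "X \<omega>" "nearest L G (?e n) (Y \<omega>)"]
          rcost_diff_le[OF Y\<omega> G(1), of "X \<omega>" "nearest L G (?e n) (Y \<omega>)"]
        by (simp add: commute)
    qed
    then have "(\<lambda>n. ?h n \<omega> - rcost L (X \<omega>) (Y \<omega>)) \<longlonglongrightarrow> 0"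
      by (intro Lim_null_comparison[OF _ LIMSEQ_inverse_real_of_nat]) auto
    then show "(\<lambda>n. ?h n \<omega>) \<longlonglongrightarrow> rcost L (X \<omega>) (Y \<omega>)" by (rule LIM_zero_cancel)
  qed
qed

lemma quantiser:
  fixes G :: "nat \<Rightarrow> (real ^ 'n \<Rightarrow> 'a) set"
  assumes L: "0 < L" and G: "\<And>n. G n \<in> L1_space L"
    "\<And>F e. F \<in> L1_space L \<Longrightarrow> 0 < e \<Longrightarrow> \<exists>n. L1_dist L (F :: (real ^ 'n \<Rightarrow> 'a) set) (G n) < e"
    and M: "prob_space M" and X: "X \<in> borel_measurable M" and Y: "Y \<in> measurable M (L1_borel L)"
    and cost: "(\<integral>\<omega>. rcost L (X \<omega>) (Y \<omega>) \<partial>M) < b"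
  obtains m K where "0 < (m::nat)" "K \<in> measurable (L1_borel L) (count_space UNIV)" "\<And>F. K F < m"
    "(\<integral>\<omega>. rcost L (X \<omega>) (G (K (Y \<omega>))) \<partial>M) < b"
proof -
  interpret prob_space M by fact
  interpret Metric_space "L1_space L :: (real ^ 'n \<Rightarrow> 'a) set set" "L1_dist L" by (rule Metric_space_L1)
  define E0 where "E0 = (\<integral>\<omega>. rcost L (X \<omega>) (Y \<omega>) \<partial>M)"
  \<comment> \<open>A quarter of the slack: one share for quantisation, one for the rare outputs of
    large index, and a strict inequality remains.\<close>
  define e where "e = (b - E0) / 4"
  have e: "0 < e" using cost by (simp add: e_def E0_def)
  define N where "N \<omega> = nearest L G e (Y \<omega>)" for \<omega>
  have Nm: "N \<in> measurable M (count_space UNIV)"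
    unfolding N_def by (rule measurable_compose[OF Y nearest_measurable[OF G(1)]])
  have YL: "Y \<omega> \<in> L1_space L" if "\<omega> \<in> space M" for \<omega>
    using measurable_space[OF Y that] by (simp add: space_L1_borel)
  let ?D = "diam_space * L ^ CARD('n)"
  have D0: "0 \<le> ?D" using diam_space_nonneg L by simp
  have sN: "{\<omega> \<in> space M. m \<le> N \<omega>} \<in> sets M" for m
    using measurable_sets[OF Nm, of "{m..}"] by (simp add: vimage_def Int_def conj_commute)
  have "(\<lambda>m. prob {\<omega> \<in> space M. m \<le> N \<omega>}) \<longlonglongrightarrow> prob (\<Inter>m. {\<omega> \<in> space M. m \<le> N \<omega>})"
    using sN by (intro finite_Lim_measure_decseq) (auto simp: decseq_def)
  moreover have "(\<Inter>m. {\<omega> \<in> space M. m \<le> N \<omega>}) = {}"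
  proof (rule ccontr)
    assume "(\<Inter>m. {\<omega> \<in> space M. m \<le> N \<omega>}) \<noteq> {}"
    then obtain \<omega> where "\<forall>m. m \<le> N \<omega>" by auto
    then have "Suc (N \<omega>) \<le> N \<omega>" by blast
    then show False by simp
  qed
  ultimately have "(\<lambda>m. ?D * prob {\<omega> \<in> space M. m \<le> N \<omega>}) \<longlonglongrightarrow> ?D * 0"
    by (intro tendsto_mult tendsto_const) simp
  from order_tendstoD(2)[OF this, of e] e
  have "eventually (\<lambda>m. ?D * prob {\<omega> \<in> space M. m \<le> N \<omega>} < e) sequentially" by simp
  then obtain m0 where "\<forall>m\<ge>m0. ?D * prob {\<omega> \<in> space M. m \<le> N \<omega>} < e"
    unfolding eventually_sequentially by blast
  then have m: "?D * prob {\<omega> \<in> space M. Suc m0 \<le> N \<omega>} < e" by simp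
  let ?m = "Suc m0"
  \<comment> \<open>Large indices go to the default letter \<open>0\<close>, which exists because
    \<open>?m\<close> is a successor; on them the cost is bounded through the diameter.\<close>
  define K where "K F = (if nearest L G e F < ?m then nearest L G e F else 0)" for F
  have Km: "K \<in> measurable (L1_borel L) (count_space UNIV)"
  proof -
    have "(\<lambda>F. (\<lambda>i. if i < ?m then i else 0) (nearest L G e F)) \<in> measurable (L1_borel L) (count_space UNIV)"
      by (rule measurable_compose[OF nearest_measurable[OF G(1)]]) simp
    then show ?thesis by (simp add: K_def[abs_def])
  qed
  have bnd: "rcost L (X \<omega>) (G (K (Y \<omega>))) \<le>
      rcost L (X \<omega>) (Y \<omega>) + e + ?D * indicator {\<omega> \<in> space M. ?m \<le> N \<omega>} \<omega>" if \<omega>: "\<omega> \<in> space M" for \<omega>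
  proof (cases "?m \<le> N \<omega>")
    case True
    moreover have "rcost L (X \<omega>) (G (K (Y \<omega>))) \<le> ?D" by (rule rcost_le[OF G(1) less_imp_le[OF L]])
    ultimately show ?thesis using rcost_nonneg[of L "X \<omega>" "Y \<omega>"] e \<omega> by simp
  next
    case False
    then have "K (Y \<omega>) = N \<omega>" by (simp add: K_def N_def)
    moreover have "L1_dist L (Y \<omega>) (G (N \<omega>)) < e"
      unfolding N_def by (rule nearest_less[OF G(2)[OF YL[OF \<omega>] e]])
    moreover have "rcost L (X \<omega>) (G (N \<omega>)) \<le> rcost L (X \<omega>) (Y \<omega>) + L1_dist L (Y \<omega>) (G (N \<omega>))"
      by (rule rcost_diff_le[OF G(1) YL[OF \<omega>]])
    ultimately show ?thesis using False by simp
  qed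
  have i1: "integrable M (\<lambda>\<omega>. rcost L (X \<omega>) (Y \<omega>))"
    using rcost_measurable[OF L X Y] rcost_le[OF YL] rcost_nonneg L
    by (intro integrable_const_bound[of _ ?D] AE_I2) auto
  have i2: "integrable M (\<lambda>\<omega>. rcost L (X \<omega>) (G (K (Y \<omega>))))"
    using rcost_quantised_measurable[OF G(1) X measurable_compose[OF Y Km]] rcost_le[OF G(1)] rcost_nonneg L
    by (intro integrable_const_bound[of _ ?D] AE_I2) auto
  have i3: "integrable M (\<lambda>\<omega>. ?D * indicator {\<omega> \<in> space M. ?m \<le> N \<omega>} \<omega>)"
    using sN by (intro integrable_mult_right integrable_real_indicator) (auto simp: emeasure_eq_measure)
  have "(\<integral>\<omega>. rcost L (X \<omega>) (G (K (Y \<omega>))) \<partial>M) \<le>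
      (\<integral>\<omega>. rcost L (X \<omega>) (Y \<omega>) + e + ?D * indicator {\<omega> \<in> space M. ?m \<le> N \<omega>} \<omega> \<partial>M)"
    using bnd by (intro integral_mono i2 Bochner_Integration.integrable_add i1 i3) auto
  also have "\<dots> = E0 + e + ?D * prob {\<omega> \<in> space M. ?m \<le> N \<omega>}"
  proof -
    have "(\<integral>\<omega>. ?D * indicator {\<omega> \<in> space M. ?m \<le> N \<omega>} \<omega> \<partial>M) = ?D * prob {\<omega> \<in> space M. ?m \<le> N \<omega>}"
      using sN[of ?m] by (simp add: Int_absorb2 subset_eq)
    then show ?thesis
      using i1 i3 prob_space by (simp add: E0_def Bochner_Integration.integral_add)
  qed
  also have "\<dots> < b"
  proof -
    have "4 * e = b - E0" by (simp add: e_def)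
    with m e show ?thesis by linarith
  qed
  finally show thesis by (intro that[OF _ Km]) (auto simp: K_def)
qed

text \<open>
  Replacing the conditional law of the codeword given the input by its average over the cells of a
  fine classifier of the input turns an arbitrary coupling into a stochastic matrix.  Row \<open>0\<close> of
  the matrix is the output distribution, row \<open>Suc a\<close> the law of the codeword given the cell \<open>a\<close>.
\<close>

lemma stochastic_matrix_of_coupling:
  fixes h :: "'a \<Rightarrow> nat" and G :: "nat \<Rightarrow> (real ^ 'n \<Rightarrow> 'a) set" and Y :: "'w \<Rightarrow> (real ^ 'n \<Rightarrow> 'a) set"
  assumes L: "0 < L" and G: "\<And>n. G n \<in> L1_space L"
    and M: "prob_space M" and X: "X \<in> borel_measurable M" and Y: "Y \<in> measurable M (L1_borel L)"
    and K: "K \<in> measurable (L1_borel L) (count_space UNIV)" "\<And>F. K F < (m::nat)"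
    and h: "h \<in> measurable borel (count_space UNIV)" "\<And>x. h x < k"
    and close: "\<And>x x' F. h x = h x' \<Longrightarrow> F \<in> L1_space L \<Longrightarrow> rcost L x F \<le> rcost L x' F + \<theta>"
  defines "p \<equiv> \<lambda>a. measure M {\<omega> \<in> space M. h (X \<omega>) = a}"
    and "\<Phi> \<equiv> \<lambda>a i. \<integral>\<omega>. indicator {x. h x = a} (X \<omega>) * rcost L (X \<omega>) (G i) \<partial>M"
  obtains z where "\<And>a i. 0 \<le> z (a, i)" "\<And>a. (\<Sum>i<m. z (a, i)) = 1"
    "\<And>a i. 0 < z (Suc a, i) \<Longrightarrow> 0 < z (0, i)"
    "ereal (\<Sum>a<k. p a * (\<Sum>i<m. z (Suc a, i) * log 2 (z (Suc a, i) / z (0, i)))) \<le> mutual_info M borel (L1_borel L) X Y"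
    "(\<Sum>a<k. \<Sum>i<m. z (Suc a, i) * \<Phi> a i) \<le> (\<integral>\<omega>. rcost L (X \<omega>) (G (K (Y \<omega>))) \<partial>M) + 2 * \<theta>"
proof -
  interpret prob_space M by fact
  have YL: "Y \<omega> \<in> L1_space L" if "\<omega> \<in> space M" for \<omega>
    using measurable_space[OF Y that] by (simp add: space_L1_borel)
  define A where "A \<omega> = h (X \<omega>)" for \<omega>
  define B where "B \<omega> = K (Y \<omega>)" for \<omega>
  have Am: "A \<in> measurable M (count_space UNIV)" unfolding A_def by (rule measurable_compose[OF X h(1)])
  have Bm: "B \<in> measurable M (count_space UNIV)" unfolding B_def by (rule measurable_compose[OF Y K(1)])
  have sA: "{\<omega> \<in> space M. A \<omega> = a} \<in> sets M" for a
    using measurable_sets[OF Am, of "{a}"] by (simp add: vimage_def Int_def conj_commute)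
  have sB: "{\<omega> \<in> space M. B \<omega> = i} \<in> sets M" for i
    using measurable_sets[OF Bm, of "{i}"] by (simp add: vimage_def Int_def conj_commute)
  have sAB: "{\<omega> \<in> space M. A \<omega> = a \<and> B \<omega> = i} \<in> sets M" for a i
  proof -
    have "{\<omega> \<in> space M. A \<omega> = a \<and> B \<omega> = i} = {\<omega> \<in> space M. A \<omega> = a} \<inter> {\<omega> \<in> space M. B \<omega> = i}" by auto
    then show ?thesis using sA sB by (simp only: sets.Int)
  qed
  define cc where "cc a i = prob {\<omega> \<in> space M. A \<omega> = a \<and> B \<omega> = i}" for a i
  define Q where "Q i = prob {\<omega> \<in> space M. B \<omega> = i}" for i
  have p: "p a = prob {\<omega> \<in> space M. A \<omega> = a}" for a by (simp add: p_def A_def)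
  have ccQ: "cc a i \<le> Q i" for a i unfolding cc_def Q_def using sB by (intro finite_measure_mono) auto
  have ccp: "cc a i \<le> p a" for a i unfolding cc_def p using sA by (intro finite_measure_mono) auto
  have cc0: "0 \<le> cc a i" for a i by (simp add: cc_def)
  have p0: "0 \<le> p a" for a by (simp add: p)
  have "(\<Sum>i<m. cc a i) = p a" for a
  proof -
    have "(\<Sum>i<m. cc a i) = prob (\<Union>i<m. {\<omega> \<in> space M. A \<omega> = a \<and> B \<omega> = i})"
      unfolding cc_def using sAB by (intro finite_measure_finite_Union[symmetric]) (auto simp: disjoint_family_on_def)
    also have "(\<Union>i<m. {\<omega> \<in> space M. A \<omega> = a \<and> B \<omega> = i}) = {\<omega> \<in> space M. A \<omega> = a}"
      using K(2) by (auto simp: B_def)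
    finally show ?thesis by (simp add: p)
  qed
  note sum_cc = this
  have sum_Q: "(\<Sum>i<m. Q i) = 1"
  proof -
    have "(\<Sum>i<m. Q i) = prob (\<Union>i<m. {\<omega> \<in> space M. B \<omega> = i})"
      unfolding Q_def using sB by (intro finite_measure_finite_Union[symmetric]) (auto simp: disjoint_family_on_def)
    also have "(\<Union>i<m. {\<omega> \<in> space M. B \<omega> = i}) = space M"
      using K(2) by (auto simp: B_def)
    finally show ?thesis by (simp add: prob_space)
  qed
  \<comment> \<open>Cells of mass zero receive the output law \<open>Q\<close> as their row, so that
    every row is stochastic and row \<open>0\<close> is positive wherever another row is.\<close>
  define z where "z = (\<lambda>(a, i). case a of 0 \<Rightarrow> Q i | Suc a \<Rightarrow> if p a = 0 then Q i else cc a i / p a)"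
  have z0: "z (0, i) = Q i" and zS: "z (Suc a, i) = (if p a = 0 then Q i else cc a i / p a)" for a i
    by (simp_all add: z_def)
  show thesis
  proof (rule that[of z])
    show "0 \<le> z (a, i)" for a i using cc0 p0 by (cases a) (auto simp: z0 zS Q_def)
    show "(\<Sum>i<m. z (a, i)) = 1" for a
    proof (cases a)
      case (Suc a')
      then show ?thesis
        using sum_Q sum_cc[of a'] by (cases "p a' = 0") (simp_all add: zS sum_divide_distrib[symmetric])
    qed (simp add: z0 sum_Q)
    show "0 < z (0, i)" if "0 < z (Suc a, i)" for a i
      using that ccQ[of a i] p0[of a] by (auto simp: z0 zS zero_less_divide_iff split: if_splits)
    \<comment> \<open>The levels of \<open>h\<close> and \<open>K\<close> are admissible finite
      partitions, so the information of the matrix is one of the values in the supremum.\<close>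
    let ?\<alpha> = "level_partition h k (space borel)" and ?\<beta> = "level_partition K m (space (L1_borel L))"
    have \<alpha>: "?\<alpha> \<in> finite_partitions borel" using h by (intro level_partition_in) auto
    have \<beta>: "?\<beta> \<in> finite_partitions (L1_borel L)" using K by (intro level_partition_in) auto
    let ?c = "\<lambda>U V. measure M {\<omega> \<in> space M. X \<omega> \<in> U \<and> Y \<omega> \<in> V}"
    let ?p = "\<lambda>U. measure M {\<omega> \<in> space M. X \<omega> \<in> U}"
    let ?Q = "\<lambda>V. measure M {\<omega> \<in> space M. Y \<omega> \<in> V}"
    have "finite_mutual_information M (cell ?\<alpha> \<circ> X) (cell ?\<beta> \<circ> Y) =
        (\<Sum>U\<in>?\<alpha>. \<Sum>V\<in>?\<beta>. ?c U V * log 2 (?c U V / (?p U * ?Q V)))"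
      by (rule finite_mutual_information_cell(1)[OF M X Y \<alpha> \<beta>])
    also have "\<dots> = (\<Sum>a<k. \<Sum>V\<in>?\<beta>. ?c {x \<in> space borel. h x = a} V *
        log 2 (?c {x \<in> space borel. h x = a} V / (?p {x \<in> space borel. h x = a} * ?Q V)))"
      by (subst sum_level_partition) auto
    also have "\<dots> = (\<Sum>a<k. \<Sum>i<m. ?c {x \<in> space borel. h x = a} {F \<in> space (L1_borel L). K F = i} *
        log 2 (?c {x \<in> space borel. h x = a} {F \<in> space (L1_borel L). K F = i} /
          (?p {x \<in> space borel. h x = a} * ?Q {F \<in> space (L1_borel L). K F = i})))"
      by (subst sum_level_partition) auto
    also have "\<dots> = (\<Sum>a<k. \<Sum>i<m. cc a i * log 2 (cc a i / (p a * Q i)))"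
    proof -
      have "{\<omega> \<in> space M. X \<omega> \<in> {x \<in> space borel. h x = a}} = {\<omega> \<in> space M. A \<omega> = a}" for a
        by (auto simp: A_def)
      moreover have "{\<omega> \<in> space M. Y \<omega> \<in> {F \<in> space (L1_borel L). K F = i}} = {\<omega> \<in> space M. B \<omega> = i}" for i
        using YL by (auto simp: B_def space_L1_borel)
      moreover have "{\<omega> \<in> space M. X \<omega> \<in> {x \<in> space borel. h x = a} \<and> Y \<omega> \<in> {F \<in> space (L1_borel L). K F = i}} =
          {\<omega> \<in> space M. A \<omega> = a \<and> B \<omega> = i}" for a i
        using YL by (auto simp: A_def B_def space_L1_borel)
      ultimately show ?thesis by (simp only: cc_def p Q_def)
    qed
    also have "\<dots> = (\<Sum>a<k. p a * (\<Sum>i<m. z (Suc a, i) * log 2 (z (Suc a, i) / z (0, i))))"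
    proof (rule sum.cong[OF refl])
      fix a
      show "(\<Sum>i<m. cc a i * log 2 (cc a i / (p a * Q i))) =
          p a * (\<Sum>i<m. z (Suc a, i) * log 2 (z (Suc a, i) / z (0, i)))"
      proof (cases "p a = 0")
        case True
        then have "cc a i = 0" for i using ccp[of a i] cc0[of a i] by simp
        then show ?thesis using True by simp
      next
        case False
        then show ?thesis by (simp add: sum_distrib_left zS z0)
      qed
    qed
    finally have fm: "finite_mutual_information M (cell ?\<alpha> \<circ> X) (cell ?\<beta> \<circ> Y) =
      (\<Sum>a<k. p a * (\<Sum>i<m. z (Suc a, i) * log 2 (z (Suc a, i) / z (0, i))))" .
    show "ereal (\<Sum>a<k. p a * (\<Sum>i<m. z (Suc a, i) * log 2 (z (Suc a, i) / z (0, i)))) \<le> mutual_info M borel (L1_borel L) X Y"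
      unfolding fm[symmetric] mutual_info_def
      by (rule SUP_upper2[of "(?\<alpha>, ?\<beta>)"]) (use \<alpha> \<beta> in auto)
    have rm: "(\<lambda>\<omega>. rcost L (X \<omega>) (G i)) \<in> borel_measurable M" for i
      using measurable_compose[OF X rcost_fixed_measurable[OF G]] .
    have rint: "integrable M (\<lambda>\<omega>. indicator S \<omega> * rcost L (X \<omega>) (G i))" if "S \<in> sets M" for S i
      using rm that rcost_nonneg rcost_le[OF G] L diam_space_nonneg
      by (intro integrable_const_bound[of _ "diam_space * L ^ CARD('n)"] AE_I2 borel_measurable_times)
        (auto simp: indicator_def)
    have iint: "integrable M (\<lambda>\<omega>. indicator S \<omega> * (v :: real))" if "S \<in> sets M" for S v
      using that by (intro integrable_mult_left integrable_real_indicator) (auto simp: emeasure_eq_measure)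
    have ieq: "(\<integral>\<omega>. indicator S \<omega> * (v :: real) \<partial>M) = prob S * v" if "S \<in> sets M" for S v
      using that by (simp add: Int_absorb2 sets.sets_into_space)
    let ?SA = "\<lambda>a. {\<omega> \<in> space M. A \<omega> = a}" and ?SAB = "\<lambda>a i. {\<omega> \<in> space M. A \<omega> = a \<and> B \<omega> = i}"
    define \<Psi> where "\<Psi> a i = (\<integral>\<omega>. indicator (?SAB a i) \<omega> * rcost L (X \<omega>) (G i) \<partial>M)" for a i
    have \<Phi>: "\<Phi> a i = (\<integral>\<omega>. indicator (?SA a) \<omega> * rcost L (X \<omega>) (G i) \<partial>M)" for a i
      unfolding \<Phi>_def A_def by (intro Bochner_Integration.integral_cong) (auto simp: indicator_def)
    \<comment> \<open>On the cell all costs are within \<open>\<theta>\<close> of the cost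
      \<open>?v\<close> at a single point. Estimating \<open>\<Phi>\<close> from above and
      \<open>\<Psi>\<close> from below through \<open>?v\<close> loses \<open>\<theta>\<close>
      twice, in proportion to the joint mass.\<close>
    have main: "z (Suc a, i) * \<Phi> a i \<le> \<Psi> a i + cc a i * (2 * \<theta>)" for a i
    proof (cases "p a = 0")
      case True
      then have "?SA a \<in> null_sets M" using sA[of a] by (intro null_setsI) (simp_all add: p emeasure_eq_measure)
      then have "AE \<omega> in M. \<omega> \<notin> ?SA a" by (rule AE_not_in)
      then have "AE \<omega> in M. indicator (?SA a) \<omega> * rcost L (X \<omega>) (G i) = 0" by eventually_elim simp
      then have "\<Phi> a i = 0" unfolding \<Phi> by (rule integral_eq_zero_AE)
      moreover have "0 \<le> \<Psi> a i" unfolding \<Psi>_def using rcost_nonneg by (intro Bochner_Integration.integral_nonneg) auto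
      moreover have "cc a i = 0" using True ccp[of a i] cc0[of a i] by simp
      ultimately show ?thesis by simp
    next
      case False
      then have "?SA a \<noteq> {}" by (metis measure_empty p)
      then obtain \<omega>0 where \<omega>0: "\<omega>0 \<in> space M" "A \<omega>0 = a" by auto
      let ?v = "rcost L (X \<omega>0) (G i)"
      have "\<Phi> a i \<le> (\<integral>\<omega>. indicator (?SA a) \<omega> * (?v + \<theta>) \<partial>M)"
        unfolding \<Phi>
      proof (rule integral_mono[OF rint[OF sA] iint[OF sA]])
        fix \<omega>
        show "indicator (?SA a) \<omega> * rcost L (X \<omega>) (G i) \<le> indicator (?SA a) \<omega> * (?v + \<theta>)"
          using close[OF _ G[of i], of "X \<omega>" "X \<omega>0"] \<omega>0 by (auto simp: indicator_def A_def)
      qed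
      then have u: "\<Phi> a i \<le> p a * (?v + \<theta>)" unfolding ieq[OF sA] p .
      have "(\<integral>\<omega>. indicator (?SAB a i) \<omega> * (?v - \<theta>) \<partial>M) \<le> \<Psi> a i"
        unfolding \<Psi>_def
      proof (rule integral_mono[OF iint[OF sAB] rint[OF sAB]])
        fix \<omega>
        show "indicator (?SAB a i) \<omega> * (?v - \<theta>) \<le> indicator (?SAB a i) \<omega> * rcost L (X \<omega>) (G i)"
          using close[OF _ G[of i], of "X \<omega>0" "X \<omega>"] \<omega>0 by (auto simp: indicator_def A_def)
      qed
      then have l: "cc a i * (?v - \<theta>) \<le> \<Psi> a i" unfolding ieq[OF sAB] cc_def .
      have "z (Suc a, i) * \<Phi> a i \<le> z (Suc a, i) * (p a * (?v + \<theta>))"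
        using u cc0 p0 False by (intro mult_left_mono) (auto simp: zS)
      also have "\<dots> = cc a i * (?v - \<theta>) + cc a i * (2 * \<theta>)" using False by (simp add: zS algebra_simps)
      also have "\<dots> \<le> \<Psi> a i + cc a i * (2 * \<theta>)" using l by simp
      finally show ?thesis .
    qed
    have "(\<Sum>a<k. \<Sum>i<m. z (Suc a, i) * \<Phi> a i) \<le> (\<Sum>a<k. \<Sum>i<m. \<Psi> a i + cc a i * (2 * \<theta>))"
      using main by (intro sum_mono) auto
    also have "\<dots> = (\<Sum>a<k. \<Sum>i<m. \<Psi> a i) + (\<Sum>a<k. p a) * (2 * \<theta>)"
      by (simp add: sum.distrib sum_distrib_right[symmetric] sum_cc)
    also have "(\<Sum>a<k. p a) = 1"
    proof -
      have "(\<Sum>a<k. p a) = prob (\<Union>a<k. ?SA a)"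
        unfolding p using sA by (intro finite_measure_finite_Union[symmetric]) (auto simp: disjoint_family_on_def)
      also have "(\<Union>a<k. ?SA a) = space M" using h(2) by (auto simp: A_def)
      finally show ?thesis by (simp add: prob_space)
    qed
    also have "(\<Sum>a<k. \<Sum>i<m. \<Psi> a i) = (\<integral>\<omega>. (\<Sum>a<k. \<Sum>i<m. indicator (?SAB a i) \<omega> * rcost L (X \<omega>) (G i)) \<partial>M)"
    proof -
      have "(\<integral>\<omega>. (\<Sum>a<k. \<Sum>i<m. indicator (?SAB a i) \<omega> * rcost L (X \<omega>) (G i)) \<partial>M) =
          (\<Sum>a<k. \<integral>\<omega>. (\<Sum>i<m. indicator (?SAB a i) \<omega> * rcost L (X \<omega>) (G i)) \<partial>M)"
        by (intro Bochner_Integration.integral_sum Bochner_Integration.integrable_sum rint[OF sAB])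
      also have "\<dots> = (\<Sum>a<k. \<Sum>i<m. \<Psi> a i)"
        unfolding \<Psi>_def by (intro sum.cong refl Bochner_Integration.integral_sum rint[OF sAB])
      finally show ?thesis by simp
    qed
    also have "\<dots> = (\<integral>\<omega>. rcost L (X \<omega>) (G (K (Y \<omega>))) \<partial>M)"
    proof (rule Bochner_Integration.integral_cong[OF refl])
      fix \<omega> assume \<omega>: "\<omega> \<in> space M"
      have "(\<Sum>a<k. \<Sum>i<m. indicator (?SAB a i) \<omega> * rcost L (X \<omega>) (G i)) =
          (\<Sum>a<k. if a = A \<omega> then (\<Sum>i<m. if i = B \<omega> then rcost L (X \<omega>) (G i) else 0) else 0)"
        using \<omega> by (intro sum.cong refl) (auto simp: indicator_def intro!: sum.neutral sum.cong)
      also have "\<dots> = rcost L (X \<omega>) (G (B \<omega>))"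
        using h(2) K(2) by (simp add: A_def B_def)
      finally show "(\<Sum>a<k. \<Sum>i<m. indicator (?SAB a i) \<omega> * rcost L (X \<omega>) (G i)) = rcost L (X \<omega>) (G (K (Y \<omega>)))"
        by (simp add: B_def)
    qed
    finally show "(\<Sum>a<k. \<Sum>i<m. z (Suc a, i) * \<Phi> a i) \<le> (\<integral>\<omega>. rcost L (X \<omega>) (G (K (Y \<omega>))) \<partial>M) + 2 * \<theta>"
      by simp
  qed
qed

end

subsection \<open>The rate as an infimum over countably many channels\<close>

text \<open>\<open>a * log 2 (a / b)\<close> is not continuous where both entries vanish, so density
  cannot be applied at \<open>z\<close> directly. Mixing with the uniform row makes all entries
  positive, at no lasting cost by \<open>log_ratio_mix_le\<close>; there pointwise convergence of
  the entries suffices.\<close>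

lemma stochastic_matrix_approx:
  fixes z :: "nat \<times> nat \<Rightarrow> real" and p :: "nat \<Rightarrow> real" and \<Phi> :: "nat \<Rightarrow> nat \<Rightarrow> real"
  assumes z: "\<And>a i. 0 \<le> z (a, i)" "\<And>a. (\<Sum>i<m. z (a, i)) = 1"
    "\<And>a i. 0 < z (Suc a, i) \<Longrightarrow> 0 < z (0, i)"
    and p: "\<And>a. 0 \<le> p a"
    and info: "(\<Sum>a<k. p a * (\<Sum>i<m. z (Suc a, i) * log 2 (z (Suc a, i) / z (0, i)))) < A"
    and cost: "(\<Sum>a<k. \<Sum>i<m. z (Suc a, i) * \<Phi> a i) < B"
    and D: "\<And>z. z \<in> stochastic m \<Longrightarrow> \<exists>f. (\<forall>n. f n \<in> D) \<and> (\<forall>p. (\<lambda>n. f n p) \<longlonglongrightarrow> z p)"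
  obtains y where "y \<in> D" "(\<Sum>a<k. p a * (\<Sum>i<m. y (Suc a, i) * log 2 (y (Suc a, i) / y (0, i)))) < A"
    "(\<Sum>a<k. \<Sum>i<m. y (Suc a, i) * \<Phi> a i) < B"
proof -
  let ?I = "\<lambda>z. \<Sum>a<k. p a * (\<Sum>i<m. z (Suc a, i) * log 2 (z (Suc a, i) / z (0, i)))"
  let ?C = "\<lambda>z. \<Sum>a<k. \<Sum>i<m. z (Suc a, i) * \<Phi> a i"
  \<comment> \<open>The denominator \<open>1 + m * s\<close> restores row sums after
    \<open>s\<close> has been added to \<open>m\<close> entries.\<close>
  define w where "w s = (\<lambda>q. (z q + s) / (1 + real m * s))" for s :: real
  have t: "((\<lambda>s. 1 + real m * s) \<longlongrightarrow> 1 + real m * 0) (at_right 0)"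
    by (intro tendsto_intros)
  have "((\<lambda>s. ?C (w s)) \<longlongrightarrow> (\<Sum>a<k. \<Sum>i<m. (z (Suc a, i) + 0) / (1 + real m * 0) * \<Phi> a i)) (at_right 0)"
    unfolding w_def by (intro tendsto_intros t) simp
  then have c: "\<forall>\<^sub>F s in at_right 0. ?C (w s) < B"
    using cost by (intro order_tendstoD(2)) simp_all
  have "((\<lambda>s. ?I z / (1 + real m * s)) \<longlongrightarrow> ?I z / (1 + real m * 0)) (at_right 0)"
    by (intro tendsto_divide tendsto_const t) simp
  then have i: "\<forall>\<^sub>F s in at_right 0. ?I z / (1 + real m * s) < A"
    using info by (intro order_tendstoD(2)) simp_all
  have "\<forall>\<^sub>F s in at_right 0. (0::real) < s" by (simp add: eventually_at_right_less)
  with c i have "\<forall>\<^sub>F s in at_right 0. 0 < s \<and> ?C (w s) < B \<and> ?I z / (1 + real m * s) < A"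
    by eventually_elim simp
  then obtain s where s: "0 < s" "?C (w s) < B" "?I z / (1 + real m * s) < A"
    using eventually_happens[of _ "at_right (0::real)"] by auto
  have ms: "0 < 1 + real m * s" using s(1) by (simp add: add_pos_nonneg)
  have "?I (w s) \<le> ?I z / (1 + real m * s)"
  proof -
    have "w s (Suc a, i) * log 2 (w s (Suc a, i) / w s (0, i)) \<le>
        z (Suc a, i) * log 2 (z (Suc a, i) / z (0, i)) / (1 + real m * s)" for a i
    proof -
      have "w s (Suc a, i) / w s (0, i) = (z (Suc a, i) + s) / (z (0, i) + s)"
        using ms by (simp add: w_def)
      then have "w s (Suc a, i) * log 2 (w s (Suc a, i) / w s (0, i)) =
          (z (Suc a, i) + s) * log 2 ((z (Suc a, i) + s) / (z (0, i) + s)) / (1 + real m * s)"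
        by (simp add: w_def)
      also have "\<dots> \<le> z (Suc a, i) * log 2 (z (Suc a, i) / z (0, i)) / (1 + real m * s)"
        using log_ratio_mix_le[OF z(1) z(1) z(3) s(1)] ms by (intro divide_right_mono) auto
      finally show ?thesis .
    qed
    then have "?I (w s) \<le> (\<Sum>a<k. p a * (\<Sum>i<m. z (Suc a, i) * log 2 (z (Suc a, i) / z (0, i)) / (1 + real m * s)))"
      using p by (intro sum_mono mult_left_mono) auto
    also have "\<dots> = ?I z / (1 + real m * s)"
      by (simp add: sum_divide_distrib[symmetric])
    finally show ?thesis .
  qed
  with s(3) have si: "?I (w s) < A" by simp
  have wpos: "0 < w s q" for q
  proof -
    have "0 \<le> z q" using z(1)[of "fst q" "snd q"] by simp
    then show ?thesis using s(1) ms by (simp add: w_def)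
  qed
  moreover have "(\<Sum>i<m. w s (a, i)) = 1" for a
    using z(2)[of a] ms by (simp add: w_def sum_divide_distrib[symmetric] sum.distrib)
  ultimately have "w s \<in> stochastic m" by (simp add: stochastic_def)
  then obtain f where f: "\<And>n. f n \<in> D" "\<And>q. (\<lambda>n. f n q) \<longlonglongrightarrow> w s q" using D by blast
  have "(\<lambda>n. ?I (f n)) \<longlonglongrightarrow> ?I (w s)"
    using wpos by (intro tendsto_intros f) (auto simp: less_imp_neq[symmetric])
  moreover have "(\<lambda>n. ?C (f n)) \<longlonglongrightarrow> ?C (w s)"
    by (intro tendsto_intros f)
  ultimately have "\<forall>\<^sub>F n in sequentially. ?I (f n) < A \<and> ?C (f n) < B"
    using si s(2) by (intro eventually_conj order_tendstoD(2))
  then obtain n where "?I (f n) < A" "?C (f n) < B" by (auto simp: eventually_sequentially)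
  with f(1) that show thesis by blast
qed

context compact_action
begin

text \<open>The channels are fixed before \<open>\<nu>\<close>, \<open>\<epsilon>\<close> and
  \<open>a\<close>. Each ingredient comes from a countable supply: codewords from a dense sequence,
  classifiers of mesh \<open>1 / (l + 1)\<close>, weights from a dense set of positive
  matrices.\<close>

lemma channel_family:
  assumes L: "0 < L"
  obtains J C where "\<And>n::nat. chan (cube L) (J n) (C n)"
    "\<And>\<nu> \<epsilon> a. sets \<nu> = sets borel \<Longrightarrow> rate_distortion_cube T \<nu> L \<epsilon> < ereal a \<Longrightarrow>
       \<exists>n. (\<integral>x. J n x \<partial>\<nu>) < a \<and> (\<integral>x. C n x \<partial>\<nu>) < \<epsilon> * L ^ CARD('n)"
proof -
  have Ld: "0 < L ^ CARD('n)" using L by simp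
  obtain G where G: "\<And>n::nat. G n \<in> L1_space L"
    "\<And>F e. F \<in> L1_space L \<Longrightarrow> 0 < e \<Longrightarrow> \<exists>n. L1_dist L (F :: (real ^ 'n \<Rightarrow> 'a) set) (G n) < e"
    using L1_separable[OF L] by blast
  have "\<exists>y. y \<in> borel_measurable borel \<and> (\<forall>x. rcost L x (G n) = dcost (cube L) x y)" for n
    using L1_space_borel_rep[OF G(1)] by metis
  then obtain y where y: "\<And>n. y n \<in> borel_measurable borel" "\<And>n x. rcost L x (G n) = dcost (cube L) x (y n)"
    by metis
  have "\<exists>D. countable D \<and> D \<subseteq> stochastic m \<and>
      (\<forall>z \<in> stochastic m. \<exists>f. (\<forall>n. f n \<in> D) \<and> (\<forall>p. (\<lambda>n. f n p) \<longlonglongrightarrow> z p))" for m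
    using stochastic_dense[of m] by metis
  then obtain D where D: "\<And>m. countable (D m)" "\<And>m. D m \<subseteq> stochastic m"
      "\<And>m z. z \<in> stochastic m \<Longrightarrow> \<exists>f. (\<forall>n. f n \<in> D m) \<and> (\<forall>p. (\<lambda>n. f n p) \<longlonglongrightarrow> z p)"
    by metis
  have "\<exists>(h :: 'a \<Rightarrow> nat) k. h \<in> measurable borel (count_space UNIV) \<and> (\<forall>x. h x < k) \<and>
      (\<forall>x x'. \<forall>u \<in> cube L. h x = h x' \<longrightarrow> dist (T u x) (T u x') < inverse (real (Suc l)))" for l
    by (rule classifier[of "inverse (real (Suc l))" L]) (simp, blast)
  then obtain h :: "nat \<Rightarrow> 'a \<Rightarrow> nat" and k where h: "\<And>l. h l \<in> measurable borel (count_space UNIV)"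
      "\<And>l x. h l x < k l"
      "\<And>l x x' u. u \<in> cube L \<Longrightarrow> h l x = h l x' \<Longrightarrow> dist (T u x) (T u x') < inverse (real (Suc l))"
    by metis
  \<comment> \<open>Row \<open>0\<close> of the matrix is the reference law, row
    \<open>Suc a\<close> the weights for inputs of class \<open>a\<close>; the information depends
    on the input through its class alone.\<close>
  define Jf where "Jf l m z x = (\<Sum>i<m. z (Suc (h l x), i) * log 2 (z (Suc (h l x), i) / z (0, i)))"
    for l m :: nat and z :: "nat \<times> nat \<Rightarrow> real" and x
  define Cf where "Cf l m z x = (\<Sum>i<m. z (Suc (h l x), i) * dcost (cube L) x (y i))"
    for l m :: nat and z :: "nat \<times> nat \<Rightarrow> real" and x
  have chf: "chan (cube L) (Jf l m z) (Cf l m z)" if z: "z \<in> stochastic m" for l m z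
  proof (rule chanI[where I="{..<m}" and W="\<lambda>i x. z (Suc (h l x), i)" and q="\<lambda>i. z (0, i)" and y=y])
    show "(\<lambda>x. z (Suc (h l x), i)) \<in> borel_measurable borel" for i
      by (rule measurable_compose[OF h(1)]) simp
  qed (use z y in \<open>auto simp: stochastic_def Jf_def Cf_def less_imp_le\<close>)
  obtain c0 where c0: "chan (cube L) (\<lambda>_. 0) c0" using chan_trivial[OF region_cube] by blast
  \<comment> \<open>The one-letter channel is inserted to make the family nonempty, as its
    enumeration requires.\<close>
  define S where "S = insert (\<lambda>_. 0, c0) ((\<lambda>(l, m, z). (Jf l m z, Cf l m z)) ` (SIGMA l:UNIV. SIGMA m:UNIV. D m))"
  have cS: "countable S" unfolding S_def using D(1) by (intro countable_insert countable_image countable_SIGMA) auto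
  have neS: "S \<noteq> {}" by (simp add: S_def)
  have chS: "chan (cube L) (fst s) (snd s)" if "s \<in> S" for s
    using that c0 chf subsetD[OF D(2)] by (auto simp: S_def)
  show thesis
  proof (rule that[of "\<lambda>n. fst (from_nat_into S n)" "\<lambda>n. snd (from_nat_into S n)"])
    show "chan (cube L) (fst (from_nat_into S n)) (snd (from_nat_into S n))" for n
      by (rule chS[OF from_nat_into[OF neS]])
    fix \<nu> :: "'a measure" and \<epsilon> a
    assume \<nu>: "sets \<nu> = sets borel" and R: "rate_distortion_cube T \<nu> L \<epsilon> < ereal a"
    then obtain M :: "('a \<times> (real ^ 'n \<Rightarrow> 'a) set) measure" and X Y where M: "prob_space M"
      and X: "X \<in> measurable M borel" "distr M borel X = \<nu>" and Y: "Y \<in> measurable M (L1_borel L)"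
      and MI: "mutual_info M borel (L1_borel L) X Y < ereal a"
      and ex: "prob_space.expectation M (\<lambda>\<omega>. 1 / L ^ CARD('n) * rcost L (X \<omega>) (Y \<omega>)) < \<epsilon>"
      unfolding rate_distortion_cube_def Inf_less_iff rcost_def by blast
    interpret M: prob_space M by fact
    have "(\<integral>\<omega>. rcost L (X \<omega>) (Y \<omega>) \<partial>M) < \<epsilon> * L ^ CARD('n)"
      using ex Ld by (simp add: divide_less_eq)
    from quantiser[OF L G M X(1) Y this] obtain m K where K: "0 < (m::nat)" "K \<in> measurable (L1_borel L) (count_space UNIV)" "\<And>F. K F < m"
      and E: "(\<integral>\<omega>. rcost L (X \<omega>) (G (K (Y \<omega>))) \<partial>M) < \<epsilon> * L ^ CARD('n)" by blast
    let ?E = "\<integral>\<omega>. rcost L (X \<omega>) (G (K (Y \<omega>))) \<partial>M"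
    \<comment> \<open>The mesh is below half the remaining slack per unit volume, because passing to
      classes costs \<open>2 * \<theta>\<close>.\<close>
    obtain l where l: "inverse (real (Suc l)) < (\<epsilon> * L ^ CARD('n) - ?E) / (2 * L ^ CARD('n))"
      using reals_Archimedean[of "(\<epsilon> * L ^ CARD('n) - ?E) / (2 * L ^ CARD('n))"] E Ld by auto
    define \<theta> where "\<theta> = inverse (real (Suc l)) * L ^ CARD('n)"
    have \<theta>: "?E + 2 * \<theta> < \<epsilon> * L ^ CARD('n)"
      using l Ld by (simp add: \<theta>_def less_divide_eq algebra_simps)
    have close: "rcost L x F \<le> rcost L x' F + \<theta>" if hx: "h l x = h l x'" and F: "F \<in> L1_space L" for x x' F
    proof -
      interpret finite_measure "cube_measure L :: (real ^ 'n) measure" by (rule finite_cube_measure)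
      note m = T_measurable_cube[of x L] T_measurable_cube[of x' L] L1_rep_measurable[OF F]
      have "rcost L x F \<le> (\<integral>u. inverse (real (Suc l)) + dist (T u x') (L1_rep F u) \<partial>cube_measure L)"
        unfolding rcost_def
      proof (intro integral_mono Bochner_Integration.integrable_add dist_integrable_cube m)
        fix u assume "u \<in> space (cube_measure L :: (real ^ 'n) measure)"
        then have "dist (T u x) (T u x') < inverse (real (Suc l))"
          using h(3)[OF _ hx] by (simp add: space_restrict_space)
        then show "dist (T u x) (L1_rep F u) \<le> inverse (real (Suc l)) + dist (T u x') (L1_rep F u)"
          using dist_triangle[of "T u x" "L1_rep F u" "T u x'"] by linarith
      qed simp
      also have "\<dots> = \<theta> + rcost L x' F"
      proof -
        have "measure (cube_measure L :: (real ^ 'n) measure) (space (cube_measure L)) = L ^ CARD('n)"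
          using measure_cube[OF less_imp_le[OF L], where 'n='n]
          by (simp add: space_restrict_space measure_restrict_space)
        then show ?thesis
          unfolding \<theta>_def rcost_def using dist_integrable_cube[OF m(2,3)]
          by (subst Bochner_Integration.integral_add) simp_all
      qed
      finally show ?thesis by simp
    qed
    define p where "p a = measure M {\<omega> \<in> space M. h l (X \<omega>) = a}" for a
    define \<Phi> where "\<Phi> a i = (\<integral>\<omega>. indicator {x. h l x = a} (X \<omega>) * rcost L (X \<omega>) (G i) \<partial>M)" for a i
    obtain z where z: "\<And>a i. 0 \<le> z (a, i)" "\<And>a. (\<Sum>i<m. z (a, i)) = 1"
      "\<And>a i. 0 < z (Suc a, i) \<Longrightarrow> 0 < z (0, i)"
      "ereal (\<Sum>a<k l. p a * (\<Sum>i<m. z (Suc a, i) * log 2 (z (Suc a, i) / z (0, i)))) \<le> mutual_info M borel (L1_borel L) X Y"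
      "(\<Sum>a<k l. \<Sum>i<m. z (Suc a, i) * \<Phi> a i) \<le> ?E + 2 * \<theta>"
      by (rule stochastic_matrix_of_coupling[OF L G(1) M X(1) Y K(2,3) h(1)[of l] h(2)[of l], folded p_def \<Phi>_def])
        (rule close that; assumption)+
    have pI: "(\<Sum>a<k l. p a * (\<Sum>i<m. z (Suc a, i) * log 2 (z (Suc a, i) / z (0, i)))) < a"
      using le_less_trans[OF z(4) MI] by simp
    have pC: "(\<Sum>a<k l. \<Sum>i<m. z (Suc a, i) * \<Phi> a i) < \<epsilon> * L ^ CARD('n)" using z(5) \<theta> by simp
    have p0: "0 \<le> p a" for a by (simp add: p_def)
    obtain w where w: "w \<in> D m"
      and wI: "(\<Sum>a<k l. p a * (\<Sum>i<m. w (Suc a, i) * log 2 (w (Suc a, i) / w (0, i)))) < a"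
      and wC: "(\<Sum>a<k l. \<Sum>i<m. w (Suc a, i) * \<Phi> a i) < \<epsilon> * L ^ CARD('n)"
      by (rule stochastic_matrix_approx[OF z(1,2) _ p0 pI pC D(3)[of _ m]]) (rule z that; assumption)+
    have ind: "indicator {x. h l x = a} \<in> borel_measurable borel" for a
      using measurable_sets[OF h(1), of "{a}" l] by (intro borel_measurable_indicator) (simp add: vimage_def)
    have ch: "chan (cube L) (Jf l m w) (Cf l m w)" using chf w D(2) by blast
    \<comment> \<open>A function of the class is a finite combination of class indicators; this
      turns integrals over the input into the sums of the matrix lemma.\<close>
    have row: "f (h l x) = (\<Sum>a<k l. indicator {x. h l x = a} x * f a)" for f :: "nat \<Rightarrow> real" and x
    proof -
      have "(\<Sum>a<k l. indicator {x. h l x = a} x * f a) = (\<Sum>a<k l. if a = h l x then f a else 0)"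
        by (intro sum.cong) (auto simp: indicator_def)
      then show ?thesis using h(2)[of l x] by simp
    qed
    have "(\<integral>x. Jf l m w x \<partial>\<nu>) = (\<integral>\<omega>. Jf l m w (X \<omega>) \<partial>M)"
      unfolding X(2)[symmetric] using chan_bounded(1)[OF ch region_cube] by (intro integral_distr X)
    also have "\<dots> = (\<integral>\<omega>. (\<Sum>a<k l. indicator {x. h l x = a} (X \<omega>) * (\<Sum>i<m. w (Suc a, i) * log 2 (w (Suc a, i) / w (0, i)))) \<partial>M)"
      unfolding Jf_def by (intro Bochner_Integration.integral_cong refl row)
    also have "\<dots> = (\<Sum>a<k l. p a * (\<Sum>i<m. w (Suc a, i) * log 2 (w (Suc a, i) / w (0, i))))"
    proof -
      have s: "{\<omega> \<in> space M. h l (X \<omega>) = a} \<in> sets M" for a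
        using measurable_sets[OF measurable_compose[OF X(1) h(1)[of l]], of "{a}"]
        by (simp add: vimage_def Int_def conj_commute)
      have e: "indicator {x. h l x = a} (X \<omega>) * (v::real) = indicator {\<omega> \<in> space M. h l (X \<omega>) = a} \<omega> * v"
        if "\<omega> \<in> space M" for a \<omega> v
        using that by (simp add: indicator_def)
      have "(\<integral>\<omega>. (\<Sum>a<k l. indicator {x. h l x = a} (X \<omega>) * v a) \<partial>M) =
          (\<Sum>a<k l. p a * v a)" for v :: "nat \<Rightarrow> real"
      proof -
        have "(\<integral>\<omega>. (\<Sum>a<k l. indicator {x. h l x = a} (X \<omega>) * v a) \<partial>M) =
          (\<integral>\<omega>. (\<Sum>a<k l. indicator {\<omega> \<in> space M. h l (X \<omega>) = a} \<omega> * v a) \<partial>M)"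
          by (intro Bochner_Integration.integral_cong refl sum.cong e)
        also have "\<dots> = (\<Sum>a<k l. (\<integral>\<omega>. indicator {\<omega> \<in> space M. h l (X \<omega>) = a} \<omega> * v a \<partial>M))"
          using s by (intro Bochner_Integration.integral_sum integrable_mult_left integrable_real_indicator)
            (auto simp: M.emeasure_eq_measure)
        also have "\<dots> = (\<Sum>a<k l. p a * v a)"
          using s by (simp add: p_def Int_absorb2 subset_eq)
        finally show ?thesis .
      qed
      then show ?thesis .
    qed
    finally have JI: "(\<integral>x. Jf l m w x \<partial>\<nu>) < a" using wI by simp
    have "(\<integral>x. Cf l m w x \<partial>\<nu>) = (\<integral>\<omega>. Cf l m w (X \<omega>) \<partial>M)"
      unfolding X(2)[symmetric] using chan_bounded(2)[OF ch region_cube] by (intro integral_distr X)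
    also have "\<dots> = (\<integral>\<omega>. (\<Sum>a<k l. \<Sum>i<m. w (Suc a, i) * (indicator {x. h l x = a} (X \<omega>) * rcost L (X \<omega>) (G i))) \<partial>M)"
    proof (intro Bochner_Integration.integral_cong refl)
      fix \<omega>
      show "Cf l m w (X \<omega>) = (\<Sum>a<k l. \<Sum>i<m. w (Suc a, i) * (indicator {x. h l x = a} (X \<omega>) * rcost L (X \<omega>) (G i)))"
        using row[of "\<lambda>a. \<Sum>i<m. w (Suc a, i) * rcost L (X \<omega>) (G i)" "X \<omega>"]
        by (simp add: Cf_def y(2) sum_distrib_left mult.left_commute)
    qed
    also have "\<dots> = (\<Sum>a<k l. \<Sum>i<m. w (Suc a, i) * \<Phi> a i)"
    proof -
      have i: "integrable M (\<lambda>\<omega>. indicator {x. h l x = a} (X \<omega>) * rcost L (X \<omega>) (G i))" for a i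
        using measurable_compose[OF X(1) rcost_fixed_measurable[OF G(1)]] measurable_compose[OF X(1) ind]
          rcost_nonneg rcost_le[OF G(1)] L diam_space_nonneg
        by (intro M.integrable_const_bound[of _ "diam_space * L ^ CARD('n)"] AE_I2 borel_measurable_times)
          (auto simp: indicator_def)
      have "(\<integral>\<omega>. (\<Sum>a<k l. \<Sum>i<m. w (Suc a, i) * (indicator {x. h l x = a} (X \<omega>) * rcost L (X \<omega>) (G i))) \<partial>M)
        = (\<Sum>a<k l. \<integral>\<omega>. (\<Sum>i<m. w (Suc a, i) * (indicator {x. h l x = a} (X \<omega>) * rcost L (X \<omega>) (G i))) \<partial>M)"
        by (intro Bochner_Integration.integral_sum Bochner_Integration.integrable_sum integrable_mult_right i)
      also have "\<dots> = (\<Sum>a<k l. \<Sum>i<m. \<integral>\<omega>. w (Suc a, i) * (indicator {x. h l x = a} (X \<omega>) * rcost L (X \<omega>) (G i)) \<partial>M)"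
        by (intro sum.cong refl Bochner_Integration.integral_sum integrable_mult_right i)
      finally show ?thesis by (simp add: \<Phi>_def)
    qed
    finally have CI: "(\<integral>x. Cf l m w x \<partial>\<nu>) < \<epsilon> * L ^ CARD('n)" using wC by simp
    have "(Jf l m w, Cf l m w) \<in> S" unfolding S_def using w by force
    then obtain n where "from_nat_into S n = (Jf l m w, Cf l m w)"
      using from_nat_into_surj[OF cS] by blast
    with JI CI show "\<exists>n. (\<integral>x. fst (from_nat_into S n) x \<partial>\<nu>) < a \<and> (\<integral>x. snd (from_nat_into S n) x \<partial>\<nu>) < \<epsilon> * L ^ CARD('n)"
      by (intro exI[of _ n]) simp
  qed
qed

end

text \<open>In each coordinate, this is the share of the side \<open>L\<close> that is covered by
  whole tiles of side \<open>l\<close>.\<close>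

lemma floor_ratio_tendsto:
  fixes l :: real
  assumes "0 < l"
  shows "((\<lambda>L. real (nat \<lfloor>L / l\<rfloor>) * l / L) \<longlongrightarrow> 1) at_top"
proof (rule Lim_transform[OF tendsto_const], rule Lim_null_comparison)
  show "((\<lambda>L. l / L) \<longlongrightarrow> 0) at_top"
    by (intro tendsto_divide_0[OF tendsto_const] filterlim_at_top_imp_at_infinity filterlim_ident)
  show "\<forall>\<^sub>F L in at_top. norm (real (nat \<lfloor>L / l\<rfloor>) * l / L - 1) \<le> l / L"
    using eventually_gt_at_top[of 0]
  proof eventually_elim
    fix L :: real assume L: "0 < L"
    then have q: "0 \<le> L / l" using assms by simp
    then have "0 \<le> \<lfloor>L / l\<rfloor>" by simp
    then have "real (nat \<lfloor>L / l\<rfloor>) = of_int \<lfloor>L / l\<rfloor>" by simp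
    then have "real (nat \<lfloor>L / l\<rfloor>) \<le> L / l" "L / l - 1 \<le> real (nat \<lfloor>L / l\<rfloor>)"
      using of_int_floor_le[of "L / l"] floor_correct[of "L / l"] by linarith+
    then have "real (nat \<lfloor>L / l\<rfloor>) * l \<le> L" "L - l \<le> real (nat \<lfloor>L / l\<rfloor>) * l"
      using assms by (simp_all add: field_simps)
    then have "\<bar>real (nat \<lfloor>L / l\<rfloor>) * l - L\<bar> \<le> l" using assms by linarith
    then have "\<bar>real (nat \<lfloor>L / l\<rfloor>) * l - L\<bar> / L \<le> l / L" by (rule divide_right_mono) (simp add: L less_imp_le)
    moreover have "real (nat \<lfloor>L / l\<rfloor>) * l / L - 1 = (real (nat \<lfloor>L / l\<rfloor>) * l - L) / L"
      using L by (simp add: diff_divide_distrib)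
    ultimately show "norm (real (nat \<lfloor>L / l\<rfloor>) * l / L - 1) \<le> l / L"
      using L by (simp only: real_norm_def abs_divide abs_of_pos)
  qed
qed

text \<open>The one-cell partitions give the value zero, which is enough for a supremum.\<close>

lemma mutual_info_nonneg:
  assumes M: "prob_space M" and X: "X \<in> measurable M S" and Y: "Y \<in> measurable M S'"
  shows "0 \<le> mutual_info M S S' X Y"
proof -
  interpret prob_space M by fact
  obtain \<omega> where "\<omega> \<in> space M" using not_empty by blast
  then have ne: "space S \<noteq> {}" "space S' \<noteq> {}" using measurable_space[OF X] measurable_space[OF Y] by auto
  have p: "{space S} \<in> finite_partitions S" "{space S'} \<in> finite_partitions S'"
    using ne by (auto simp: finite_partitions_def partition_on_def)
  have "{\<omega> \<in> space M. X \<omega> \<in> space S \<and> Y \<omega> \<in> space S'} = space M"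
    "{\<omega> \<in> space M. X \<omega> \<in> space S} = space M" "{\<omega> \<in> space M. Y \<omega> \<in> space S'} = space M"
    using measurable_space[OF X] measurable_space[OF Y] by auto
  then have "finite_mutual_information M (cell {space S} \<circ> X) (cell {space S'} \<circ> Y) = 0"
    unfolding finite_mutual_information_cell(1)[OF M X Y p] by (simp add: prob_space)
  then show ?thesis
    unfolding mutual_info_def by (intro SUP_upper2[of "({space S}, {space S'})"]) (use p in auto)
qed

lemma rate_distortion_cube_nonneg: "0 \<le> rate_distortion_cube T \<mu> L \<epsilon>"
  unfolding rate_distortion_cube_def by (intro Inf_greatest) (auto intro: mutual_info_nonneg)

context compact_action
begin

lemma invariant_measuresD:
  assumes "\<nu> \<in> invariant_measures T"
  shows "prob_space \<nu>" "sets \<nu> = sets borel" "space \<nu> = UNIV" "invariant_finite \<nu>"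
  using assms sets_eq_imp_space_eq[of \<nu> borel]
  by (auto simp: invariant_measures_def invariant_finite_def prob_space.finite_measure)

text \<open>The pieces may use cubes of different sides \<open>l k\<close>; each channel is tiled
  into the same large cube. The share of the collars tends to zero and \<open>log 2 K\<close> is
  divided by the volume, so strict inequalities per unit volume survive.\<close>

lemma rate_distortion_cube_tiled:
  fixes \<rho> :: "nat \<Rightarrow> 'a measure"
  assumes l: "\<And>k. k < K \<Longrightarrow> 0 < l k" and ch: "\<And>k. k < K \<Longrightarrow> chan (cube (l k)) (j k) (c k)"
    and \<rho>: "\<And>k. k < K \<Longrightarrow> invariant_finite (\<rho> k)"
    and \<mu>: "prob_space \<mu>" "sets \<mu> = sets borel"
    and sum: "\<And>A. A \<in> sets borel \<Longrightarrow> emeasure \<mu> A = (\<Sum>k<K. emeasure (\<rho> k) A)"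
    and cost: "(\<Sum>k<K. (\<integral>x. c k x \<partial>\<rho> k) / l k ^ CARD('n)) < \<epsilon>"
    and info: "(\<Sum>k<K. (\<integral>x. j k x \<partial>\<rho> k) / l k ^ CARD('n)) < a"
  shows "\<forall>\<^sub>F L in at_top. rate_distortion_cube T \<mu> L \<epsilon> / ereal (L ^ CARD('n)) < ereal a"
proof -
  define N where "N L k = nat \<lfloor>L / l k\<rfloor>" for L k
  \<comment> \<open>The share of the volume of \<open>cube L\<close> that the tiles of channel
    \<open>k\<close> fill.\<close>
  define \<phi> where "\<phi> L k = (real (N L k) * l k / L) ^ CARD('n)" for L k
  have \<phi>: "((\<lambda>L. \<phi> L k) \<longlongrightarrow> 1) at_top" if "k < K" for k
    using tendsto_power[OF floor_ratio_tendsto[OF l[OF that]], of "CARD('n)"] by (simp add: \<phi>_def N_def)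
  let ?C = "\<lambda>L. \<Sum>k<K. \<phi> L k * ((\<integral>x. c k x \<partial>\<rho> k) / l k ^ CARD('n)) +
      diam_space * (1 - \<phi> L k) * measure (\<rho> k) UNIV"
  let ?J = "\<lambda>L. (\<Sum>k<K. \<phi> L k * ((\<integral>x. j k x \<partial>\<rho> k) / l k ^ CARD('n))) + log 2 (real K) / L ^ CARD('n)"
  have "(?C \<longlongrightarrow> (\<Sum>k<K. 1 * ((\<integral>x. c k x \<partial>\<rho> k) / l k ^ CARD('n)) + diam_space * (1 - 1) * measure (\<rho> k) UNIV)) at_top"
    by (intro tendsto_intros \<phi>) auto
  then have "\<forall>\<^sub>F L in at_top. ?C L < \<epsilon>" using cost by (intro order_tendstoD(2)) auto
  moreover have "((\<lambda>L. log 2 (real K) / L ^ CARD('n)) \<longlongrightarrow> 0) at_top"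
    by (intro tendsto_divide_0[OF tendsto_const] filterlim_at_top_imp_at_infinity filterlim_pow_at_top filterlim_ident) simp
  then have "(?J \<longlongrightarrow> (\<Sum>k<K. 1 * ((\<integral>x. j k x \<partial>\<rho> k) / l k ^ CARD('n))) + 0) at_top"
    by (intro tendsto_intros \<phi>) auto
  then have "\<forall>\<^sub>F L in at_top. ?J L < a" using info by (intro order_tendstoD(2)) auto
  ultimately show ?thesis using eventually_gt_at_top[of 0]
  proof eventually_elim
    case (elim L)
    then have L: "0 < L" and Ld: "0 < L ^ CARD('n)" by simp_all
    have fit: "real (N L k) * l k \<le> L" if "k < K" for k
    proof -
      have "0 \<le> L / l k" using L l[OF that] by simp
      then have "real (N L k) \<le> L / l k" unfolding N_def by simp
      then show ?thesis using l[OF that] by (simp add: field_simps)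
    qed
    have "\<exists>j' c'. chan (cube L) j' c' \<and>
        (\<forall>\<rho>. invariant_finite \<rho> \<longrightarrow> (\<integral>x. j' x \<partial>\<rho>) = real (N L k) ^ CARD('n) * (\<integral>x. j k x \<partial>\<rho>)) \<and>
        (\<forall>\<rho>. invariant_finite \<rho> \<longrightarrow> (\<integral>x. c' x \<partial>\<rho>) \<le> real (N L k) ^ CARD('n) * (\<integral>x. c k x \<partial>\<rho>) +
          diam_space * (L ^ CARD('n) - (real (N L k) * l k) ^ CARD('n)) * measure \<rho> UNIV)" if k: "k < K" for k
      using chan_tile[OF ch[OF k] l[OF k] fit[OF k]] by metis
    then obtain j' c' where ch': "\<And>k. k < K \<Longrightarrow> chan (cube L) (j' k) (c' k)"
      and j': "\<And>k. k < K \<Longrightarrow> (\<integral>x. j' k x \<partial>\<rho> k) = real (N L k) ^ CARD('n) * (\<integral>x. j k x \<partial>\<rho> k)"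
      and c': "\<And>k. k < K \<Longrightarrow> (\<integral>x. c' k x \<partial>\<rho> k) \<le> real (N L k) ^ CARD('n) * (\<integral>x. c k x \<partial>\<rho> k) +
          diam_space * (L ^ CARD('n) - (real (N L k) * l k) ^ CARD('n)) * measure (\<rho> k) UNIV"
      using \<rho> by metis
    have NN: "real (N L k) ^ CARD('n) * v = L ^ CARD('n) * (\<phi> L k * (v / l k ^ CARD('n)))" if "k < K" for k v
      using l[OF that] L by (simp add: \<phi>_def power_divide power_mult_distrib)
    have "(\<Sum>k<K. \<integral>x. c' k x \<partial>\<rho> k) \<le> (\<Sum>k<K. L ^ CARD('n) * (\<phi> L k * ((\<integral>x. c k x \<partial>\<rho> k) / l k ^ CARD('n)) +
      diam_space * (1 - \<phi> L k) * measure (\<rho> k) UNIV))"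
    proof (rule sum_mono)
      fix k assume "k \<in> {..<K}"
      then have k: "k < K" by simp
      have "L ^ CARD('n) - (real (N L k) * l k) ^ CARD('n) = L ^ CARD('n) * (1 - \<phi> L k)"
        using L by (simp add: \<phi>_def power_divide right_diff_distrib)
      with c'[OF k] show "(\<integral>x. c' k x \<partial>\<rho> k) \<le> L ^ CARD('n) * (\<phi> L k * ((\<integral>x. c k x \<partial>\<rho> k) / l k ^ CARD('n)) +
        diam_space * (1 - \<phi> L k) * measure (\<rho> k) UNIV)"
        unfolding NN[OF k] by (simp add: distrib_left mult_ac)
    qed
    also have "\<dots> = L ^ CARD('n) * ?C L" by (simp add: sum_distrib_left)
    also have "\<dots> < L ^ CARD('n) * \<epsilon>" using elim Ld by (intro mult_strict_left_mono)
    finally have cst: "(\<Sum>k<K. \<integral>x. c' k x \<partial>\<rho> k) < \<epsilon> * L ^ CARD('n)" by (simp add: mult.commute)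
    have "rate_distortion_cube T \<mu> L \<epsilon> \<le> ereal ((\<Sum>k<K. \<integral>x. j' k x \<partial>\<rho> k) + log 2 (real K))"
      using \<rho> by (intro rate_distortion_cube_le[OF L ch' _ _ \<mu> sum cst]) (auto simp: invariant_finite_def)
    also have "(\<Sum>k<K. \<integral>x. j' k x \<partial>\<rho> k) + log 2 (real K) = L ^ CARD('n) * ?J L"
      using j' NN L by (simp add: distrib_left sum_distrib_left)
    finally have "rate_distortion_cube T \<mu> L \<epsilon> / ereal (L ^ CARD('n)) \<le> ereal (L ^ CARD('n) * ?J L) / ereal (L ^ CARD('n))"
      using Ld by (intro ereal_divide_right_mono) auto
    also have "\<dots> = ereal (?J L)" using L by simp
    also have "\<dots> < ereal a" using elim by simp
    finally show ?case .
  qed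
qed

lemma rate_distortion_cube_tiled1:
  assumes "0 < l" "chan (cube l) j c" "\<nu> \<in> invariant_measures T"
    "(\<integral>x. c x \<partial>\<nu>) / l ^ CARD('n) < \<epsilon>" "(\<integral>x. j x \<partial>\<nu>) / l ^ CARD('n) < a"
  shows "\<forall>\<^sub>F L in at_top. rate_distortion_cube T \<nu> L \<epsilon> / ereal (L ^ CARD('n)) < ereal a"
  using rate_distortion_cube_tiled[where K=1 and l="\<lambda>_. l" and j="\<lambda>_. j" and c="\<lambda>_. c" and \<rho>="\<lambda>_. \<nu>" and \<mu>=\<nu>]
    assms invariant_measuresD[OF assms(3)] by simp

text \<open>\<open>Lim\<close> carries meaning only once convergence is known. All values lie above
  their infimum; conversely a channel that is nearly optimal at one side is tiled into all large
  cubes, which takes the place of subadditivity.\<close>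

lemma rate_distortion_tendsto:
  assumes \<nu>: "\<nu> \<in> invariant_measures T"
  shows "((\<lambda>L. rate_distortion_cube T \<nu> L \<epsilon> / ereal (L ^ CARD('n))) \<longlongrightarrow> rate_distortion T \<nu> \<epsilon>) at_top"
proof -
  let ?f = "\<lambda>L. rate_distortion_cube T \<nu> L \<epsilon> / ereal (L ^ CARD('n))"
  have lim: "(?f \<longlongrightarrow> (INF L\<in>{0<..}. ?f L)) at_top"
  proof (rule order_tendstoI)
    fix a assume a: "a < (INF L\<in>{0<..}. ?f L)"
    show "\<forall>\<^sub>F L in at_top. a < ?f L"
      using eventually_gt_at_top[of 0]
      by eventually_elim (rule less_le_trans[OF a], rule INF_lower, simp)
  next
    fix a assume "(INF L\<in>{0<..}. ?f L) < a"
    then obtain l where l: "0 < l" "?f l < a" by (auto simp: INF_less_iff)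
    obtain b where b: "?f l < ereal b" "ereal b < a" using ereal_dense2[OF l(2)] by auto
    have ld: "0 < l ^ CARD('n)" using l by simp
    have "rate_distortion_cube T \<nu> l \<epsilon> < ereal (b * l ^ CARD('n))"
      using b(1) ld by (simp add: ereal_divide_less_iff mult.commute)
    moreover obtain J C where "\<And>n::nat. chan (cube l) (J n) (C n)"
      "\<And>\<nu> \<epsilon> a. sets \<nu> = sets borel \<Longrightarrow> rate_distortion_cube T \<nu> l \<epsilon> < ereal a \<Longrightarrow>
       \<exists>n. (\<integral>x. J n x \<partial>\<nu>) < a \<and> (\<integral>x. C n x \<partial>\<nu>) < \<epsilon> * l ^ CARD('n)"
      using channel_family[OF l(1)] by blast
    ultimately obtain j c where "chan (cube l) j c" "(\<integral>x. j x \<partial>\<nu>) < b * l ^ CARD('n)" "(\<integral>x. c x \<partial>\<nu>) < \<epsilon> * l ^ CARD('n)"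
      using invariant_measuresD(2)[OF \<nu>] by blast
    then have "\<forall>\<^sub>F L in at_top. ?f L < ereal b"
      using ld by (intro rate_distortion_cube_tiled1[OF l(1) _ \<nu>]) (auto simp: divide_less_eq)
    then show "\<forall>\<^sub>F L in at_top. ?f L < a" by eventually_elim (rule less_trans[OF _ b(2)])
  qed
  then have eq: "rate_distortion T \<nu> \<epsilon> = (INF L\<in>{0<..}. ?f L)"
    unfolding rate_distortion_def by (intro tendsto_Lim) auto
  show ?thesis unfolding eq by (rule lim)
qed

lemma rate_distortion_less:
  assumes \<nu>: "\<nu> \<in> invariant_measures T"
    and "\<forall>\<^sub>F L in at_top. rate_distortion_cube T \<nu> L \<epsilon> / ereal (L ^ CARD('n)) < a"
  shows "rate_distortion T \<nu> \<epsilon> \<le> a"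
  using tendsto_upperbound[OF rate_distortion_tendsto[OF \<nu>] _ trivial_limit_at_top_linorder] assms(2)
  by (simp add: eventually_mono less_imp_le)

lemma rate_distortion_nonneg:
  assumes \<nu>: "\<nu> \<in> invariant_measures T"
  shows "0 \<le> rate_distortion T \<nu> \<epsilon>"
proof (rule tendsto_lowerbound[OF rate_distortion_tendsto[OF \<nu>] _ trivial_limit_at_top_linorder])
  show "\<forall>\<^sub>F L in at_top. 0 \<le> rate_distortion_cube T \<nu> L \<epsilon> / ereal (L ^ CARD('n))"
    using eventually_gt_at_top[of 0]
  proof eventually_elim
    case (elim L)
    have "0 / ereal (L ^ CARD('n)) \<le> rate_distortion_cube T \<nu> L \<epsilon> / ereal (L ^ CARD('n))"
      using elim rate_distortion_cube_nonneg by (intro ereal_divide_right_mono) auto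
    then show ?case by simp
  qed
qed

text \<open>The form in which the rate is used from here on: its strict sublevels are given by
  countably many conditions on two integrals, each affine in \<open>\<nu>\<close>. Integer sides
  suffice because the rate is a limit over \<open>L\<close>.\<close>

lemma channel_sequence:
  obtains l J C where "\<And>n::nat. 0 < l n" "\<And>n. chan (cube (l n)) (J n) (C n)"
    "\<And>\<nu> \<epsilon> a. \<nu> \<in> invariant_measures T \<Longrightarrow> rate_distortion T \<nu> \<epsilon> < ereal a \<longleftrightarrow>
       (\<exists>n. (\<integral>x. J n x \<partial>\<nu>) / l n ^ CARD('n) < a \<and> (\<integral>x. C n x \<partial>\<nu>) / l n ^ CARD('n) < \<epsilon>)"
proof -
  have "\<exists>J C. (\<forall>n::nat. chan (cube (real (Suc i))) (J n) (C n)) \<and>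
    (\<forall>\<nu> \<epsilon> a. sets \<nu> = sets borel \<longrightarrow> rate_distortion_cube T \<nu> (real (Suc i)) \<epsilon> < ereal a \<longrightarrow>
       (\<exists>n. (\<integral>x. J n x \<partial>\<nu>) < a \<and> (\<integral>x. C n x \<partial>\<nu>) < \<epsilon> * real (Suc i) ^ CARD('n)))" for i
    by (rule channel_family[of "real (Suc i)"]) (simp, blast)
  then obtain J C where ch: "\<And>i n::nat. chan (cube (real (Suc i))) (J i n) (C i n)"
    and ex: "\<And>i \<nu> \<epsilon> a. sets \<nu> = sets borel \<Longrightarrow> rate_distortion_cube T \<nu> (real (Suc i)) \<epsilon> < ereal a \<Longrightarrow>
       \<exists>n. (\<integral>x. J i n x \<partial>\<nu>) < a \<and> (\<integral>x. C i n x \<partial>\<nu>) < \<epsilon> * real (Suc i) ^ CARD('n)"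
    by metis
  define l where "l n = real (Suc (fst (prod_decode n)))" for n
  define J' where "J' n = J (fst (prod_decode n)) (snd (prod_decode n))" for n
  define C' where "C' n = C (fst (prod_decode n)) (snd (prod_decode n))" for n
  have l0: "0 < l n" for n by (simp add: l_def)
  have ch': "chan (cube (l n)) (J' n) (C' n)" for n unfolding l_def J'_def C'_def by (rule ch)
  show thesis
  proof (rule that[of l J' C', OF l0 ch'])
    fix \<nu> \<epsilon> a assume \<nu>: "\<nu> \<in> invariant_measures T"
    show "rate_distortion T \<nu> \<epsilon> < ereal a \<longleftrightarrow>
       (\<exists>n. (\<integral>x. J' n x \<partial>\<nu>) / l n ^ CARD('n) < a \<and> (\<integral>x. C' n x \<partial>\<nu>) / l n ^ CARD('n) < \<epsilon>)"
    proof
      assume "rate_distortion T \<nu> \<epsilon> < ereal a"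
      from order_tendstoD(2)[OF rate_distortion_tendsto[OF \<nu>] this]
      have "\<forall>\<^sub>F L in at_top. rate_distortion_cube T \<nu> L \<epsilon> / ereal (L ^ CARD('n)) < ereal a" .
      then obtain b where b: "\<And>L. b \<le> L \<Longrightarrow> rate_distortion_cube T \<nu> L \<epsilon> / ereal (L ^ CARD('n)) < ereal a"
        by (auto simp: eventually_at_top_linorder)
      obtain i :: nat where i: "b \<le> real i" using real_arch_simple by blast
      let ?L = "real (Suc i)"
      have Ld: "0 < ?L ^ CARD('n)" by simp
      have "rate_distortion_cube T \<nu> ?L \<epsilon> / ereal (?L ^ CARD('n)) < ereal a" using i by (intro b) simp
      then have "rate_distortion_cube T \<nu> ?L \<epsilon> < ereal (a * ?L ^ CARD('n))"
        using Ld by (simp add: ereal_divide_less_iff mult.commute del: of_nat_Suc of_nat_power)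
      from ex[OF invariant_measuresD(2)[OF \<nu>] this] obtain n where
        n: "(\<integral>x. J i n x \<partial>\<nu>) < a * ?L ^ CARD('n)" "(\<integral>x. C i n x \<partial>\<nu>) < \<epsilon> * ?L ^ CARD('n)" by blast
      have d: "prod_decode (prod_encode (i, n)) = (i, n)" by simp
      show "\<exists>n. (\<integral>x. J' n x \<partial>\<nu>) / l n ^ CARD('n) < a \<and> (\<integral>x. C' n x \<partial>\<nu>) / l n ^ CARD('n) < \<epsilon>"
        by (rule exI[of _ "prod_encode (i, n)"]) (use n Ld in \<open>simp add: J'_def C'_def l_def d divide_less_eq del: of_nat_Suc\<close>)
    next
      assume "\<exists>n. (\<integral>x. J' n x \<partial>\<nu>) / l n ^ CARD('n) < a \<and> (\<integral>x. C' n x \<partial>\<nu>) / l n ^ CARD('n) < \<epsilon>"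
      then obtain n where n: "(\<integral>x. J' n x \<partial>\<nu>) / l n ^ CARD('n) < a" "(\<integral>x. C' n x \<partial>\<nu>) / l n ^ CARD('n) < \<epsilon>" by blast
      \<comment> \<open>Room is needed between the information of the channel and \<open>a\<close>,
        since the limit over large cubes retains only a weak inequality.\<close>
      obtain b where b: "(\<integral>x. J' n x \<partial>\<nu>) / l n ^ CARD('n) < b" "b < a" using dense[OF n(1)] by blast
      have "rate_distortion T \<nu> \<epsilon> \<le> ereal b"
        by (rule rate_distortion_less[OF \<nu> rate_distortion_cube_tiled1[OF l0 ch' \<nu> n(2) b(1)]])
      also have "\<dots> < ereal a" using b(2) by simp
      finally show "rate_distortion T \<nu> \<epsilon> < ereal a" .
    qed
  qed
qed

subsection \<open>Covering numbers bound the rate\<close>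

lemma dist_le_dist_cube: "u \<in> cube L \<Longrightarrow> dist (T u x) (T u y) \<le> dist_cube T L x y"
  unfolding dist_cube_def using dist_le_diam by (intro cSUP_upper bdd_aboveI2)

lemma cube_nonempty: "0 < L \<Longrightarrow> (cube L :: (real ^ 'n) set) \<noteq> {}"
  by (auto simp: cube_def intro!: exI[of _ 0])

lemma dist_cube_leI:
  "0 < L \<Longrightarrow> (\<And>u. u \<in> cube L \<Longrightarrow> dist (T u x) (T u y) \<le> b) \<Longrightarrow> dist_cube T L x y \<le> b"
  unfolding dist_cube_def by (intro cSUP_least cube_nonempty)

lemma dist_cube_le_diam_wrt:
  assumes "0 < L" "x \<in> S" "y \<in> S"
  shows "dist_cube T L x y \<le> diam_wrt (dist_cube T L) S"
proof -
  have "bdd_above ((\<lambda>(x, y). dist_cube T L x y) ` (S \<times> S))"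
    using dist_cube_leI[OF assms(1) dist_le_diam] by (intro bdd_aboveI2[of _ _ diam_space]) auto
  from cSUP_upper[OF _ this, of "(x, y)"] assms show ?thesis by (auto simp: diam_wrt_def)
qed

lemma diam_wrt_leI:
  assumes "0 \<le> b" "\<And>x y. x \<in> S \<Longrightarrow> y \<in> S \<Longrightarrow> \<rho> x y \<le> b"
  shows "diam_wrt \<rho> S \<le> b"
  using assms by (auto simp: diam_wrt_def intro!: cSUP_least)

definition fine_cover :: "real \<Rightarrow> real \<Rightarrow> 'a set set \<Rightarrow> bool" where
  "fine_cover L \<epsilon> \<U> \<longleftrightarrow> finite \<U> \<and> (\<forall>U\<in>\<U>. open U \<and> diam_wrt (dist_cube T L) U < \<epsilon>) \<and> \<Union>\<U> = UNIV"

lemma fine_cover_exists: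
  assumes "0 < L" "0 < \<epsilon>"
  shows "\<exists>\<U>. fine_cover L \<epsilon> \<U>"
proof -
  obtain \<delta> where \<delta>: "0 < \<delta>" "\<And>x x' u. dist x x' < \<delta> \<Longrightarrow> u \<in> cube L \<Longrightarrow> dist (T u x) (T u x') < \<epsilon> / 2"
    using T_uniform[of "\<epsilon> / 2" L] assms(2) by auto
  have cov: "UNIV \<subseteq> (\<Union>x\<in>UNIV. ball x (\<delta> / 2))" using \<delta> by (auto intro!: exI[of _ "_::'a"])
  obtain K :: "'a set" where K: "finite K" "UNIV \<subseteq> (\<Union>x\<in>K. ball x (\<delta> / 2))"
    using compactE_image[OF compact_UNIV _ cov] by auto
  have "diam_wrt (dist_cube T L) (ball c (\<delta> / 2)) < \<epsilon>" for c
  proof -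
    have "dist_cube T L x y \<le> \<epsilon> / 2" if "x \<in> ball c (\<delta> / 2)" "y \<in> ball c (\<delta> / 2)" for x y
    proof -
      have "dist x y < \<delta>" using that dist_triangle_half_r[of c x \<delta> y] by simp
      then show ?thesis using \<delta>(2) by (intro dist_cube_leI[OF assms(1)] less_imp_le)
    qed
    then have "diam_wrt (dist_cube T L) (ball c (\<delta> / 2)) \<le> \<epsilon> / 2"
      using assms(2) by (intro diam_wrt_leI) auto
    then show ?thesis using assms(2) by simp
  qed
  then show ?thesis unfolding fine_cover_def using K
    by (intro exI[of _ "(\<lambda>x. ball x (\<delta> / 2)) ` K"]) auto
qed

lemma covering_number_cover:
  assumes "0 < L" "0 < \<epsilon>"
  obtains \<U> where "fine_cover L \<epsilon> \<U>" "card \<U> = covering_number (dist_cube T L) \<epsilon>" "0 < card \<U>"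
proof -
  have "\<exists>\<U>. finite \<U> \<and> card \<U> = covering_number (dist_cube T L) \<epsilon> \<and>
      (\<forall>U\<in>\<U>. open U \<and> diam_wrt (dist_cube T L) U < \<epsilon>) \<and> \<Union>\<U> = UNIV"
    unfolding covering_number_def
    by (rule LeastI_ex) (use fine_cover_exists[OF assms] in \<open>auto simp: fine_cover_def\<close>)
  then obtain \<U> where \<U>: "fine_cover L \<epsilon> \<U>" "card \<U> = covering_number (dist_cube T L) \<epsilon>"
    by (auto simp: fine_cover_def)
  moreover have "0 < card \<U>" using \<U>(1) by (auto simp: fine_cover_def card_gt_0_iff)
  ultimately show thesis using that by blast
qed

lemma covering_number_le: "fine_cover L \<epsilon> \<U> \<Longrightarrow> covering_number (dist_cube T L) \<epsilon> \<le> card \<U>"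
  unfolding covering_number_def fine_cover_def by (intro Least_le) blast

text \<open>Finitely many diameters below \<open>\<epsilon>\<close> have a common bound below
  \<open>\<epsilon>\<close>. This keeps the inequality strict after a supremum over tiles and after
  averaging the distortion.\<close>

lemma fine_cover_mesh:
  assumes "fine_cover L \<epsilon> \<U>" "0 < L" "0 < \<epsilon>"
  obtains b where "0 \<le> b" "b < \<epsilon>"
    "\<And>U x y u. U \<in> \<U> \<Longrightarrow> x \<in> U \<Longrightarrow> y \<in> U \<Longrightarrow> u \<in> cube L \<Longrightarrow> dist (T u x) (T u y) \<le> b"
proof (rule that[of "Max (insert 0 (diam_wrt (dist_cube T L) ` \<U>))"])
  have fin: "finite (insert 0 (diam_wrt (dist_cube T L) ` \<U>))" using assms(1) by (auto simp: fine_cover_def)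
  then show "0 \<le> Max (insert 0 (diam_wrt (dist_cube T L) ` \<U>))" by (intro Max_ge) auto
  show "Max (insert 0 (diam_wrt (dist_cube T L) ` \<U>)) < \<epsilon>"
    using fin assms by (subst Max_less_iff) (auto simp: fine_cover_def)
  fix U x y and u :: "real ^ 'n" assume U: "U \<in> \<U>" "x \<in> U" "y \<in> U" "u \<in> cube L"
  have "dist (T u x) (T u y) \<le> diam_wrt (dist_cube T L) U"
    using dist_le_dist_cube[OF U(4)] dist_cube_le_diam_wrt[OF assms(2) U(2,3)] by (rule order_trans)
  also have "\<dots> \<le> Max (insert 0 (diam_wrt (dist_cube T L) ` \<U>))" using fin U by (intro Max_ge) auto
  finally show "dist (T u x) (T u y) \<le> Max (insert 0 (diam_wrt (dist_cube T L) ` \<U>))" .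
qed

text \<open>A set of the refined cover prescribes which element of \<open>\<U>\<close> the orbit
  visits at each grid point; there are \<open>card \<U> ^ (N ^ CARD('n))\<close>
  prescriptions.\<close>

lemma covering_number_tile:
  assumes l: "0 < l" and L: "0 < L" "L \<le> real N * l" and \<epsilon>: "0 < \<epsilon>"
  shows "covering_number (dist_cube T L) \<epsilon> \<le> covering_number (dist_cube T l) \<epsilon> ^ (N ^ CARD('n))"
proof -
  obtain \<U> where \<U>: "fine_cover l \<epsilon> \<U>" "card \<U> = covering_number (dist_cube T l) \<epsilon>"
    using covering_number_cover[OF l \<epsilon>] by blast
  obtain b where b: "0 \<le> b" "b < \<epsilon>"
    "\<And>U x y u. U \<in> \<U> \<Longrightarrow> x \<in> U \<Longrightarrow> y \<in> U \<Longrightarrow> u \<in> cube l \<Longrightarrow> dist (T u x) (T u y) \<le> b"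
    using fine_cover_mesh[OF \<U>(1) l \<epsilon>] by blast
  have fin: "finite \<U>" using \<U>(1) by (simp add: fine_cover_def)
  let ?G = "grid N l :: (real ^ 'n) set"
  define V where "V f = (\<Inter>v\<in>?G. T v -` f v)" for f :: "real ^ 'n \<Rightarrow> 'a set"
  let ?\<V> = "V ` PiE ?G (\<lambda>_. \<U>)"
  have "fine_cover L \<epsilon> ?\<V>"
    unfolding fine_cover_def
  proof (intro conjI ballI)
    show "finite ?\<V>" using fin by (intro finite_imageI finite_PiE) auto
    show "\<Union>?\<V> = UNIV"
    proof (intro UNIV_eq_I[symmetric])
      fix x
      have "\<forall>v. \<exists>U\<in>\<U>. T v x \<in> U" using \<U>(1) by (auto simp: fine_cover_def)
      then obtain g where g: "\<And>v. g v \<in> \<U>" "\<And>v. T v x \<in> g v" by metis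
      have "restrict g ?G \<in> PiE ?G (\<lambda>_. \<U>)" using g by auto
      moreover have "x \<in> V (restrict g ?G)" using g by (auto simp: V_def)
      ultimately show "x \<in> \<Union>?\<V>" by blast
    qed
    fix W assume "W \<in> ?\<V>"
    then obtain f where f: "\<And>v. v \<in> ?G \<Longrightarrow> f v \<in> \<U>" "W = V f" by (auto simp: PiE_iff)
    have "open (T v -` f v)" if "v \<in> ?G" for v
      using f(1)[OF that] \<U>(1) by (intro open_vimage continuous_T_snd) (auto simp: fine_cover_def)
    then show "open W" unfolding f(2) V_def by (intro open_INT) auto
    have "diam_wrt (dist_cube T L) W \<le> b"
    proof (intro diam_wrt_leI[OF b(1)] dist_cube_leI[OF L(1)])
      fix x y and u :: "real ^ 'n" assume xy: "x \<in> W" "y \<in> W" and u: "u \<in> cube L"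
      have "u \<in> cube (real N * l)" using cube_mono[OF L(2)] u by blast
      then obtain v w where v: "v \<in> ?G" and w: "w \<in> cube l" "u = w + v"
        unfolding cube_tiling(1)[OF l] by (auto simp: add.commute)
      have "T v x \<in> f v" "T v y \<in> f v" using xy v by (auto simp: f(2) V_def)
      from b(3)[OF f(1)[OF v] this w(1)] show "dist (T u x) (T u y) \<le> b"
        by (simp add: w(2) T_add)
    qed
    then show "diam_wrt (dist_cube T L) W < \<epsilon>" using b(2) by simp
  qed
  from covering_number_le[OF this] have "covering_number (dist_cube T L) \<epsilon> \<le> card ?\<V>" .
  also have "\<dots> \<le> card (PiE ?G (\<lambda>_. \<U>))" using fin by (intro card_image_le finite_PiE) auto
  also have "\<dots> = card \<U> ^ (N ^ CARD('n))" by (simp add: card_PiE card_grid[OF l])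
  finally show ?thesis by (simp add: \<U>(2))
qed

lemma metric_entropy_rate_tendsto:
  assumes \<epsilon>: "0 < \<epsilon>"
  shows "((\<lambda>L. ereal (log 2 (real (covering_number (dist_cube T L) \<epsilon>)) / L ^ CARD('n))) \<longlongrightarrow> metric_entropy_rate T \<epsilon>) at_top"
proof -
  let ?h = "\<lambda>L. log 2 (real (covering_number (dist_cube T L) \<epsilon>)) / L ^ CARD('n)"
  have pos: "0 < covering_number (dist_cube T L) \<epsilon>" if "0 < L" for L
    by (rule covering_number_cover[OF that \<epsilon>]) simp
  have lim: "((\<lambda>L. ereal (?h L)) \<longlongrightarrow> (INF L\<in>{0<..}. ereal (?h L))) at_top"
  proof (rule order_tendstoI)
    fix a assume a: "a < (INF L\<in>{0<..}. ereal (?h L))"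
    show "\<forall>\<^sub>F L in at_top. a < ereal (?h L)"
      using eventually_gt_at_top[of 0]
      by eventually_elim (rule less_le_trans[OF a], rule INF_lower, simp)
  next
    fix a assume "(INF L\<in>{0<..}. ereal (?h L)) < a"
    then obtain l where l: "0 < l" "ereal (?h l) < a" by (auto simp: INF_less_iff)
    \<comment> \<open>Rounded up, since here the tiles must cover the large cube; for channels they
      had to fit inside it.\<close>
    define N where "N L = Suc (nat \<lfloor>L / l\<rfloor>)" for L
    have "((\<lambda>L. real (nat \<lfloor>L / l\<rfloor>) * l / L + l / L) \<longlongrightarrow> 1 + 0) at_top"
      by (intro tendsto_add floor_ratio_tendsto l tendsto_divide_0[OF tendsto_const]
          filterlim_at_top_imp_at_infinity filterlim_ident)
    then have "((\<lambda>L. real (N L) * l / L) \<longlongrightarrow> 1) at_top"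
      by (simp add: N_def add_divide_distrib distrib_right add.commute)
    then have "((\<lambda>L. ereal ((real (N L) * l / L) ^ CARD('n) * ?h l)) \<longlongrightarrow> ereal (1 ^ CARD('n) * ?h l)) at_top"
      by (intro tendsto_intros)
    then have "\<forall>\<^sub>F L in at_top. ereal ((real (N L) * l / L) ^ CARD('n) * ?h l) < a"
      using l by (intro order_tendstoD(2)) auto
    then show "\<forall>\<^sub>F L in at_top. ereal (?h L) < a"
      using eventually_gt_at_top[of 0]
    proof eventually_elim
      case (elim L)
      have "L / l < real (N L)"
      proof -
        have "0 \<le> \<lfloor>L / l\<rfloor>" using elim l by simp
        then have "real (N L) = of_int \<lfloor>L / l\<rfloor> + 1" by (simp add: N_def)
        then show ?thesis by linarith
      qed
      then have "L \<le> real (N L) * l" using l by (simp add: field_simps)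
      from covering_number_tile[OF l(1) elim(2) this \<epsilon>]
      have "real (covering_number (dist_cube T L) \<epsilon>) \<le> real (covering_number (dist_cube T l) \<epsilon>) ^ (N L ^ CARD('n))"
        by (simp flip: of_nat_power)
      then have "log 2 (real (covering_number (dist_cube T L) \<epsilon>)) \<le>
          log 2 (real (covering_number (dist_cube T l) \<epsilon>) ^ (N L ^ CARD('n)))"
        using pos[OF elim(2)] by (intro log_mono) auto
      also have "\<dots> = real (N L) ^ CARD('n) * log 2 (real (covering_number (dist_cube T l) \<epsilon>))"
        using pos[OF l(1)] by (simp add: log_nat_power)
      finally have "?h L \<le> (real (N L) * l / L) ^ CARD('n) * ?h l"
        using elim l by (simp add: power_divide power_mult_distrib divide_right_mono)
      then show ?case using elim(1) by (meson ereal_less_eq(3) le_less_trans)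
    qed
  qed
  then have eq: "metric_entropy_rate T \<epsilon> = (INF L\<in>{0<..}. ereal (?h L))"
    unfolding metric_entropy_rate_def by (intro tendsto_Lim) auto
  show ?thesis unfolding eq by (rule lim)
qed

text \<open>A deterministic channel sends the index of the first set of a minimal cover that
  contains the input, and decodes it as the orbit of a fixed point of that set. With a uniform
  reference law the information equals \<open>log 2 ?m\<close> at every input.\<close>

lemma rate_distortion_cube_le_covering:
  assumes \<nu>: "prob_space \<nu>" "sets \<nu> = sets borel" and L: "0 < L" and \<epsilon>: "0 < \<epsilon>"
  shows "rate_distortion_cube T \<nu> L \<epsilon> \<le> ereal (log 2 (real (covering_number (dist_cube T L) \<epsilon>)))"
proof -
  interpret prob_space \<nu> by fact
  have Ld: "0 < L ^ CARD('n)" using L by simp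
  obtain \<U> where \<U>: "fine_cover L \<epsilon> \<U>" "card \<U> = covering_number (dist_cube T L) \<epsilon>" "0 < card \<U>"
    using covering_number_cover[OF L \<epsilon>] by blast
  obtain b where b: "0 \<le> b" "b < \<epsilon>"
    "\<And>U x y u. U \<in> \<U> \<Longrightarrow> x \<in> U \<Longrightarrow> y \<in> U \<Longrightarrow> u \<in> cube L \<Longrightarrow> dist (T u x) (T u y) \<le> b"
    using fine_cover_mesh[OF \<U>(1) L \<epsilon>] by blast
  let ?m = "card \<U>"
  have fin: "finite \<U>" using \<U>(1) by (simp add: fine_cover_def)
  obtain U where U: "bij_betw U {..<?m} \<U>"
    using ex_bij_betw_nat_finite[OF fin] by (auto simp: atLeast0LessThan)
  have UU: "U i \<in> \<U>" if "i < ?m" for i using U that by (auto simp: bij_betw_def)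
  define P where "P i x \<longleftrightarrow> i < ?m \<and> x \<in> U i" for i x
  have ex: "\<exists>i. P i x" for x
  proof -
    have "x \<in> \<Union>(U ` {..<?m})" using \<U>(1) U by (auto simp: bij_betw_def fine_cover_def)
    then show ?thesis by (auto simp: P_def)
  qed
  define h where "h x = (LEAST i. P i x)" for x
  have hP: "h x < ?m" "x \<in> U (h x)" for x
    using LeastI_ex[OF ex, of x] by (simp_all add: h_def P_def)
  have "(\<lambda>x. P i x) \<in> measurable borel (count_space UNIV)" for i
  proof (cases "i < ?m")
    case True
    then have "open (U i)" using UU \<U>(1) by (auto simp: fine_cover_def)
    then show ?thesis using True by (simp add: P_def pred_def)
  qed (simp add: P_def)
  then have hm: "h \<in> measurable borel (count_space UNIV)" unfolding h_def by (rule measurable_Least)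
  \<comment> \<open>For an empty \<open>U i\<close> the choice is arbitrary, but \<open>h\<close>
    never takes such an index.\<close>
  define c where "c i = (SOME x. x \<in> U i)" for i
  have cU: "c (h x) \<in> U (h x)" for x unfolding c_def using hP(2) by (rule someI)
  let ?y = "\<lambda>i u. T u (c i)"
  have y: "?y i \<in> borel_measurable borel" for i by measurable
  define j where "j x = (\<Sum>i<?m. (if h x = i then 1 else 0) * log 2 ((if h x = i then 1 else 0) / (1 / real ?m)))" for x
  define C where "C x = (\<Sum>i<?m. (if h x = i then 1 else 0) * dcost (cube L) x (?y i))" for x
  have ch: "chan (cube L) j C"
  proof (rule chanI[where I="{..<?m}" and W="\<lambda>i x. if h x = i then 1 else 0" and q="\<lambda>_. 1 / real ?m" and y="?y"])
    show "(\<lambda>x. if h x = i then 1 else 0) \<in> borel_measurable borel" for i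
      by (rule measurable_compose[OF hm]) simp
  qed (use \<U>(3) hP y in \<open>auto simp: j_def C_def\<close>)
  have sum1: "(\<Sum>i<?m. (if h x = i then 1 else 0) * f i) = f (h x)" for f :: "nat \<Rightarrow> real" and x
    using hP(1)[of x] by (simp add: if_distrib[where f="\<lambda>a. a * _"] cong: if_cong)
  have jx: "j x = log 2 (real ?m)" for x
  proof -
    have "j x = (\<Sum>i<?m. (if h x = i then 1 else 0) * log 2 (real ?m))"
      unfolding j_def by (intro sum.cong) auto
    then show ?thesis using sum1 by simp
  qed
  have Cx: "C x \<le> b * L ^ CARD('n)" for x
  proof -
    have "C x = dcost (cube L) x (?y (h x))" unfolding C_def by (rule sum1)
    also have "\<dots> \<le> b * L ^ CARD('n)"
    proof -
      have i: "integrable lborel (\<lambda>u :: real ^ 'n. indicator (cube L) u *\<^sub>R b)"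
        using region_cube[of L] by (simp add: region_def)
      have "dcost (cube L) x (?y (h x)) \<le> (\<integral>u. indicator (cube L :: (real ^ 'n) set) u *\<^sub>R b \<partial>lborel)"
        unfolding dcost_def set_lebesgue_integral_def
      proof (rule integral_mono[OF dcost_integrable[OF region_cube y, unfolded set_integrable_def] i])
        fix u :: "real ^ 'n"
        show "indicator (cube L) u *\<^sub>R dist (T u x) (T u (c (h x))) \<le> indicator (cube L) u *\<^sub>R b"
          using b(3)[OF UU[OF hP(1)] hP(2) cU, of u x] by (simp add: indicator_def)
      qed
      also have "\<dots> = b * L ^ CARD('n)"
        using region_cube[of L] L by (simp add: region_def measure_cube)
      finally show ?thesis .
    qed
    finally show ?thesis .
  qed
  have "(\<integral>x. C x \<partial>\<nu>) \<le> (\<integral>x. b * L ^ CARD('n) \<partial>\<nu>)"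
    using Cx by (intro integral_mono chan_integrable[OF ch region_cube finite_measure_axioms \<nu>(2)]) auto
  also have "\<dots> < \<epsilon> * L ^ CARD('n)" using b Ld prob_space by simp
  finally have "rate_distortion_cube T \<nu> L \<epsilon> \<le> ereal ((\<Sum>k<1::nat. \<integral>x. j x \<partial>\<nu>) + log 2 (real 1))"
    using \<nu> by (intro rate_distortion_cube_le[where \<rho>="\<lambda>_. \<nu>" and c="\<lambda>_. C", OF L ch]) (auto simp: finite_measure_axioms)
  then show ?thesis using jx prob_space \<U>(2) by simp
qed

lemma rate_distortion_le_metric_entropy_rate:
  assumes \<nu>: "\<nu> \<in> invariant_measures T" and \<epsilon>: "0 < \<epsilon>"
  shows "rate_distortion T \<nu> \<epsilon> \<le> metric_entropy_rate T \<epsilon>"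
proof (rule tendsto_le[OF trivial_limit_at_top_linorder metric_entropy_rate_tendsto[OF \<epsilon>] rate_distortion_tendsto[OF \<nu>]])
  show "\<forall>\<^sub>F L in at_top. rate_distortion_cube T \<nu> L \<epsilon> / ereal (L ^ CARD('n))
      \<le> ereal (log 2 (real (covering_number (dist_cube T L) \<epsilon>)) / L ^ CARD('n))"
    using eventually_gt_at_top[of 0]
  proof eventually_elim
    case (elim L)
    then have "rate_distortion_cube T \<nu> L \<epsilon> / ereal (L ^ CARD('n)) \<le>
        ereal (log 2 (real (covering_number (dist_cube T L) \<epsilon>))) / ereal (L ^ CARD('n))"
      using \<epsilon> by (intro ereal_divide_right_mono rate_distortion_cube_le_covering invariant_measuresD[OF \<nu>]) auto
    then show ?case using elim by simp
  qed
qed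

lemma rate_distortion_uniform_bound:
  assumes "upper_metric_mdim T < \<infinity>"
  obtains C e where "0 \<le> C" "0 < e" "e < 1"
    "\<And>\<nu> \<epsilon>. \<nu> \<in> invariant_measures T \<Longrightarrow> 0 < \<epsilon> \<Longrightarrow> \<epsilon> < e \<Longrightarrow> rate_distortion T \<nu> \<epsilon> \<le> ereal (C * log 2 (1 / \<epsilon>))"
proof -
  obtain c where c: "upper_metric_mdim T < ereal c" using less_PInf_Ex_of_nat assms by (metis ereal_dense2)
  then have "\<forall>\<^sub>F \<epsilon> in at_right 0. metric_entropy_rate T \<epsilon> / ereal (log 2 (1 / \<epsilon>)) < ereal c"
    unfolding upper_metric_mdim_def by (rule Limsup_lessD)
  then obtain e where e: "0 < e" "\<And>\<epsilon>. 0 < \<epsilon> \<Longrightarrow> \<epsilon> < e \<Longrightarrow> metric_entropy_rate T \<epsilon> / ereal (log 2 (1 / \<epsilon>)) < ereal c"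
    unfolding eventually_at_right_field by blast
  show thesis
  \<comment> \<open>The bound \<open>1 / 2\<close> keeps \<open>log 2 (1 / \<epsilon>)\<close>
    positive, and the maximum with \<open>0\<close> makes the constant nonnegative.\<close>
  proof (rule that[of "max c 0" "min e (1 / 2)"])
    fix \<nu> \<epsilon> assume \<nu>: "\<nu> \<in> invariant_measures T" and \<epsilon>: "0 < \<epsilon>" "\<epsilon> < min e (1 / 2)"
    have lg: "0 < log 2 (1 / \<epsilon>)" using \<epsilon> by simp
    have "rate_distortion T \<nu> \<epsilon> \<le> metric_entropy_rate T \<epsilon>" by (rule rate_distortion_le_metric_entropy_rate[OF \<nu> \<epsilon>(1)])
    also have "\<dots> \<le> ereal (c * log 2 (1 / \<epsilon>))"
      using e(2)[OF \<epsilon>(1)] \<epsilon>(2) lg by (simp add: ereal_divide_less_iff mult.commute less_imp_le)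
    also have "\<dots> \<le> ereal (max c 0 * log 2 (1 / \<epsilon>))" using lg by (simp add: mult_right_mono)
    finally show "rate_distortion T \<nu> \<epsilon> \<le> ereal (max c 0 * log 2 (1 / \<epsilon>))" .
  qed (use e in auto)
qed

end

subsection \<open>Mixtures of invariant measures\<close>

locale action_mixture = compact_action T + prob_space \<Lambda>
  for T :: "real ^ 'n \<Rightarrow> 'a::polish_space \<Rightarrow> 'a" and \<Lambda> :: "'a measure measure" +
  assumes sets_mixing: "sets \<Lambda> = sets (borel_of (weak_star_topology T))"
begin

lemma topspace_weak_star: "topspace (weak_star_topology T) = invariant_measures T"
proof -
  have "\<exists>f U. invariant_measures T = {\<nu> \<in> invariant_measures T. (\<integral>x. f x \<partial>\<nu>) \<in> U} \<and>
      continuous_on UNIV (f :: 'a \<Rightarrow> real) \<and> open U"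
    by (rule exI[of _ "\<lambda>_. 0"], rule exI[of _ UNIV]) auto
  then show ?thesis unfolding weak_star_topology_def topology_generated_by_topspace by blast
qed

lemma space_mixing: "space \<Lambda> = invariant_measures T"
proof -
  have "{U. openin (weak_star_topology T) U} \<subseteq> Pow (topspace (weak_star_topology T))"
    using openin_subset by blast
  then have "space (borel_of (weak_star_topology T)) = topspace (weak_star_topology T)"
    unfolding borel_of_def by (rule space_measure_of)
  then show ?thesis using sets_eq_imp_space_eq[OF sets_mixing] topspace_weak_star by simp
qed

lemma integral_continuous_measurable:
  assumes "continuous_on UNIV (f :: 'a \<Rightarrow> real)"
  shows "(\<lambda>\<nu>. \<integral>x. f x \<partial>\<nu>) \<in> borel_measurable \<Lambda>"
proof (rule borel_measurableI)
  fix U :: "real set" assume U: "open U"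
  have "(\<lambda>\<nu>. \<integral>x. f x \<partial>\<nu>) -` U \<inter> space \<Lambda> = {\<nu> \<in> invariant_measures T. (\<integral>x. f x \<partial>\<nu>) \<in> U}"
    by (auto simp: space_mixing)
  moreover have "openin (weak_star_topology T) {\<nu> \<in> invariant_measures T. (\<integral>x. f x \<partial>\<nu>) \<in> U}"
    unfolding weak_star_topology_def using assms U by (intro topology_generated_by_Basis) blast
  moreover have "{U. openin (weak_star_topology T) U} \<subseteq> Pow (topspace (weak_star_topology T))"
    using openin_subset by blast
  ultimately show "(\<lambda>\<nu>. \<integral>x. f x \<partial>\<nu>) -` U \<inter> space \<Lambda> \<in> sets \<Lambda>"
    unfolding sets_mixing borel_of_def by (auto intro: sigma_sets.Basic)
qed

text \<open>The weak star topology directly controls integrals of continuous functions only; the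
  indicator of an open set is a bounded pointwise limit of the continuous functions
  \<open>f n\<close>.\<close>

lemma emeasure_open_measurable:
  assumes U: "open (U :: 'a set)"
  shows "(\<lambda>\<nu>. emeasure \<nu> U) \<in> borel_measurable \<Lambda>"
\<comment> \<open>The whole space is treated separately because \<open>infdist\<close> to the empty
  set is \<open>0\<close>.\<close>
proof (cases "U = UNIV")
  case True
  have "emeasure \<nu> U = 1" if "\<nu> \<in> space \<Lambda>" for \<nu>
    using that invariant_measuresD[of \<nu>] prob_space.emeasure_space_1[of \<nu>] by (simp add: True space_mixing)
  then show ?thesis by (simp cong: measurable_cong)
next
  case False
  define f where "f n x = min 1 (real n * infdist x (- U))" for n :: nat and x
  have cf: "continuous_on UNIV (f n)" for n
    unfolding f_def by (intro continuous_intros)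
  have f: "0 \<le> f n x" "f n x \<le> 1" for n x by (simp_all add: f_def infdist_nonneg)
  have lim: "(\<lambda>n. f n x) \<longlonglongrightarrow> indicator U x" for x
  proof (cases "x \<in> U")
    case True
    have "0 < infdist x (- U)"
      using True False U infdist_pos_not_in_closed[of "- U" x] by auto
    then obtain N :: nat where N: "1 / infdist x (- U) < real N" using reals_Archimedean2 by blast
    have "f n x = 1" if "N \<le> n" for n
    proof -
      have "1 / infdist x (- U) < real n" using N that by simp
      then show ?thesis using \<open>0 < infdist x (- U)\<close> by (simp add: f_def divide_less_eq)
    qed
    then have "\<forall>\<^sub>F n in sequentially. f n x = indicator U x"
      using True by (auto simp: eventually_sequentially)
    then show ?thesis by (rule tendsto_eventually)
  qed (simp add: f_def)
  have m: "(\<lambda>n. \<integral>x. f n x \<partial>\<nu>) \<longlonglongrightarrow> measure \<nu> U" if "\<nu> \<in> space \<Lambda>" for \<nu>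
  proof -
    note D = invariant_measuresD[OF that[unfolded space_mixing]]
    interpret \<nu>: prob_space \<nu> by (rule D)
    have "f n \<in> borel_measurable \<nu>" for n
      using borel_measurable_continuous_onI[OF cf] by (simp add: measurable_cong_sets[OF D(2) refl])
    then have "(\<lambda>n. \<integral>x. f n x \<partial>\<nu>) \<longlonglongrightarrow> (\<integral>x. indicator U x \<partial>\<nu>)"
      using borel_measurable_indicator[of U \<nu>] U D(2) lim f by (intro integral_dominated_convergence[where w="\<lambda>_. 1"]) auto
    then show ?thesis using D(3) by simp
  qed
  have "(\<lambda>\<nu>. measure \<nu> U) \<in> borel_measurable \<Lambda>"
    by (rule borel_measurable_LIMSEQ_real[OF m integral_continuous_measurable[OF cf]])
  then have "(\<lambda>\<nu>. ennreal (measure \<nu> U)) \<in> borel_measurable \<Lambda>" by measurable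
  moreover have "emeasure \<nu> U = ennreal (measure \<nu> U)" if "\<nu> \<in> space \<Lambda>" for \<nu>
    using that invariant_measuresD(1)[of \<nu>] by (simp add: space_mixing prob_space.finite_measure emeasure_ennreal_finite)
  ultimately show ?thesis by (simp cong: measurable_cong)
qed

text \<open>Bridge from the weak star Borel structure to that of the Giry monad: the open sets are
  an intersection-stable generator of \<open>borel\<close>. It makes integrals measurable in
  \<open>\<nu>\<close> and \<open>\<bind>\<close> available.\<close>

lemma id_measurable: "(\<lambda>\<nu>. \<nu>) \<in> measurable \<Lambda> (prob_algebra borel)"
proof (rule measurable_prob_algebra_generated)
  show "sets borel = sigma_sets UNIV {U :: 'a set. open U}" by (simp add: borel_def)
  show "Int_stable {U :: 'a set. open U}" by (auto simp: Int_stable_def)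
qed (auto simp: space_mixing invariant_measuresD emeasure_open_measurable)

lemma id_measurable_subprob: "(\<lambda>\<nu>. \<nu>) \<in> measurable \<Lambda> (subprob_algebra borel)"
  using id_measurable by (rule measurable_prob_algebraD)

lemma integral_measurable:
  "(f :: 'a \<Rightarrow> real) \<in> borel_measurable borel \<Longrightarrow> (\<lambda>\<nu>. \<integral>x. f x \<partial>\<nu>) \<in> borel_measurable \<Lambda>"
  using measurable_compose[OF id_measurable_subprob integral_measurable_subprob_algebra] .

lemma nn_integral_measurable:
  "f \<in> borel_measurable borel \<Longrightarrow> (\<lambda>\<nu>. \<integral>\<^sup>+x. f x \<partial>\<nu>) \<in> borel_measurable \<Lambda>"
  using measurable_compose[OF id_measurable_subprob nn_integral_measurable_subprob_algebra] .

text \<open>The integral of \<open>\<nu>\<close> over the components in \<open>S\<close>, not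
  normalised. Being formed with \<open>\<bind>\<close>, it is countably additive from the
  start.\<close>

definition mix :: "'a measure set \<Rightarrow> 'a measure" where
  "mix S = density \<Lambda> (indicator S) \<bind> (\<lambda>\<nu>. \<nu>)"

lemma sets_mix: "sets (mix S) = sets borel"
  unfolding mix_def using not_empty invariant_measuresD(2)
  by (intro sets_bind) (auto simp: space_mixing)

lemma space_mix: "space (mix S) = UNIV"
  using sets_eq_imp_space_eq[OF sets_mix] by simp

lemma nn_integral_mix:
  assumes "S \<in> sets \<Lambda>" "f \<in> borel_measurable borel"
  shows "(\<integral>\<^sup>+x. f x \<partial>mix S) = (\<integral>\<^sup>+\<nu>. indicator S \<nu> * (\<integral>\<^sup>+x. f x \<partial>\<nu>) \<partial>\<Lambda>)"
  unfolding mix_def using assms id_measurable_subprob nn_integral_measurable[OF assms(2)]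
  by (subst nn_integral_bind[where B=borel]) (auto simp: nn_integral_density measurable_cong_sets[OF sets_density refl])

lemma emeasure_mix:
  assumes "S \<in> sets \<Lambda>" "A \<in> sets borel"
  shows "emeasure (mix S) A = (\<integral>\<^sup>+\<nu>. indicator S \<nu> * emeasure \<nu> A \<partial>\<Lambda>)"
proof -
  have "emeasure (mix S) A = (\<integral>\<^sup>+x. indicator A x \<partial>mix S)" using assms sets_mix by simp
  also have "\<dots> = (\<integral>\<^sup>+\<nu>. indicator S \<nu> * (\<integral>\<^sup>+x. indicator A x \<partial>\<nu>) \<partial>\<Lambda>)"
    using assms by (intro nn_integral_mix) auto
  also have "\<dots> = (\<integral>\<^sup>+\<nu>. indicator S \<nu> * emeasure \<nu> A \<partial>\<Lambda>)"
    using assms invariant_measuresD(2) by (intro nn_integral_cong) (simp add: space_mixing)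
  finally show ?thesis .
qed

lemma emeasure_UNIV_one: "\<nu> \<in> space \<Lambda> \<Longrightarrow> emeasure \<nu> UNIV = 1"
  using invariant_measuresD[of \<nu>] prob_space.emeasure_space_1[of \<nu>] by (simp add: space_mixing)

lemma finite_measure_mix:
  assumes "S \<in> sets \<Lambda>"
  shows "finite_measure (mix S)"
proof (rule finite_measureI)
  have "emeasure (mix S) UNIV \<le> (\<integral>\<^sup>+\<nu>. 1 \<partial>\<Lambda>)"
    unfolding emeasure_mix[OF assms sets.top[of borel, unfolded space_borel]]
    by (rule nn_integral_mono) (simp add: emeasure_UNIV_one indicator_def)
  then show "emeasure (mix S) (space (mix S)) \<noteq> \<infinity>"
    using emeasure_space_1 by (auto simp: space_mix top_unique)
qed

lemma invariant_finite_mix: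
  assumes S: "S \<in> sets \<Lambda>"
  shows "invariant_finite (mix S)"
  unfolding invariant_finite_def
proof (intro conjI allI finite_measure_mix[OF S] sets_mix)
  fix u
  have Tu: "T u \<in> borel_measurable borel" by measurable
  show "distr (mix S) borel (T u) = mix S"
  proof (rule measure_eqI)
    fix A assume "A \<in> sets (distr (mix S) borel (T u))"
    then have A: "A \<in> sets borel" by simp
    have A': "T u -` A \<in> sets borel" using measurable_sets[OF Tu A] by simp
    have "emeasure (distr (mix S) borel (T u)) A = emeasure (mix S) (T u -` A)"
      using Tu A by (subst emeasure_distr) (auto simp: space_mix measurable_cong_sets[OF sets_mix refl])
    also have "\<dots> = emeasure (mix S) A"
      unfolding emeasure_mix[OF S A] emeasure_mix[OF S A']
    proof (rule nn_integral_cong)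
      fix \<nu> assume \<nu>: "\<nu> \<in> space \<Lambda>"
      note D = invariant_measuresD[OF \<nu>[unfolded space_mixing]]
      have "emeasure \<nu> (T u -` A) = emeasure (distr \<nu> borel (T u)) A"
        using Tu A D(2,3) by (subst emeasure_distr) (auto simp: measurable_cong_sets[OF D(2) refl])
      also have "distr \<nu> borel (T u) = \<nu>" using D(4) by (simp add: invariant_finite_def)
      finally show "indicator S \<nu> * emeasure \<nu> (T u -` A) = indicator S \<nu> * emeasure \<nu> A" by simp
    qed
    finally show "emeasure (distr (mix S) borel (T u)) A = emeasure (mix S) A" .
  qed (simp add: sets_mix)
qed

text \<open>\<open>mixture\<close> only proposes a set function; its agreement with a genuine
  measure rules out the default zero measure of \<open>measure_of\<close>.\<close>

lemma mixture_eq: "mixture \<Lambda> = mix (space \<Lambda>)"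
proof -
  have "mixture \<Lambda> = measure_of (space (mix (space \<Lambda>))) (sets (mix (space \<Lambda>))) (emeasure (mix (space \<Lambda>)))"
    unfolding mixture_def sets_mix space_mix
  proof (rule measure_of_eq)
    fix A :: "'a set" assume "A \<in> sigma_sets UNIV (sets borel)"
    then have "A \<in> sets borel" by (metis sets.sigma_sets_eq space_borel)
    then show "(\<integral>\<^sup>+\<nu>. emeasure \<nu> A \<partial>\<Lambda>) = emeasure (mix (space \<Lambda>)) A"
      by (subst emeasure_mix) (auto intro!: nn_integral_cong)
  qed simp
  then show ?thesis by (simp add: measure_of_of_measure)
qed

lemma mixture_invariant: "mixture \<Lambda> \<in> invariant_measures T"
proof -
  have "emeasure (mix (space \<Lambda>)) UNIV = (\<integral>\<^sup>+\<nu>. 1 \<partial>\<Lambda>)"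
    unfolding emeasure_mix[OF sets.top sets.top[of borel, unfolded space_borel]]
    by (rule nn_integral_cong) (simp add: emeasure_UNIV_one)
  then have "prob_space (mix (space \<Lambda>))"
    using emeasure_space_1 by (intro prob_spaceI) (simp add: space_mix)
  then show ?thesis
    using invariant_finite_mix[OF sets.top] unfolding mixture_eq
    by (simp add: invariant_measures_def invariant_finite_def)
qed

lemma mixture_sum:
  assumes \<kappa>: "\<kappa> \<in> measurable \<Lambda> (count_space UNIV)" "\<And>\<nu>. \<nu> \<in> space \<Lambda> \<Longrightarrow> \<kappa> \<nu> < (K::nat)" and A: "A \<in> sets borel"
  shows "emeasure (mixture \<Lambda>) A = (\<Sum>k<K. emeasure (mix {\<nu> \<in> space \<Lambda>. \<kappa> \<nu> = k}) A)"
proof -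
  have s: "{\<nu> \<in> space \<Lambda>. \<kappa> \<nu> = k} \<in> sets \<Lambda>" for k
    using measurable_sets[OF \<kappa>(1), of "{k}"] by (simp add: vimage_def Int_def conj_commute)
  have e: "(\<lambda>\<nu>. emeasure \<nu> A) \<in> borel_measurable \<Lambda>"
    using measurable_compose[OF id_measurable_subprob measurable_emeasure_subprob_algebra[OF A]] .
  have "(\<Sum>k<K. emeasure (mix {\<nu> \<in> space \<Lambda>. \<kappa> \<nu> = k}) A) =
      (\<integral>\<^sup>+\<nu>. (\<Sum>k<K. indicator {\<nu> \<in> space \<Lambda>. \<kappa> \<nu> = k} \<nu> * emeasure \<nu> A) \<partial>\<Lambda>)"
    unfolding emeasure_mix[OF s A] using s e by (intro nn_integral_sum[symmetric]) auto
  also have "\<dots> = (\<integral>\<^sup>+\<nu>. emeasure \<nu> A \<partial>\<Lambda>)"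
  proof (rule nn_integral_cong)
    fix \<nu> assume \<nu>: "\<nu> \<in> space \<Lambda>"
    have "(\<Sum>k<K. indicator {\<nu> \<in> space \<Lambda>. \<kappa> \<nu> = k} \<nu> * emeasure \<nu> A) = (\<Sum>k<K. if k = \<kappa> \<nu> then emeasure \<nu> A else 0)"
      using \<nu> by (intro sum.cong) (auto simp: indicator_def)
    then show "(\<Sum>k<K. indicator {\<nu> \<in> space \<Lambda>. \<kappa> \<nu> = k} \<nu> * emeasure \<nu> A) = emeasure \<nu> A"
      using \<kappa>(2)[OF \<nu>] by simp
  qed
  also have "\<dots> = emeasure (mixture \<Lambda>) A"
    unfolding mixture_eq using A by (subst emeasure_mix) (auto intro!: nn_integral_cong)
  finally show ?thesis by simp
qed

lemma integral_mix:
  fixes f :: "'a \<Rightarrow> real"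
  assumes S: "S \<in> sets \<Lambda>" and f: "f \<in> borel_measurable borel" "\<And>x. 0 \<le> f x" "\<And>x. f x \<le> B"
  shows "(\<integral>x. f x \<partial>mix S) = (\<integral>\<nu>. indicator S \<nu> * (\<integral>x. f x \<partial>\<nu>) \<partial>\<Lambda>)"
proof -
  have "(\<integral>x. f x \<partial>mix S) = enn2real (\<integral>\<^sup>+x. ennreal (f x) \<partial>mix S)"
    using f by (intro integral_eq_nn_integral) (auto simp: measurable_cong_sets[OF sets_mix refl])
  also have "(\<integral>\<^sup>+x. ennreal (f x) \<partial>mix S) = (\<integral>\<^sup>+\<nu>. indicator S \<nu> * (\<integral>\<^sup>+x. ennreal (f x) \<partial>\<nu>) \<partial>\<Lambda>)"
    using f(1) by (intro nn_integral_mix S) simp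
  also have "\<dots> = (\<integral>\<^sup>+\<nu>. ennreal (indicator S \<nu> * (\<integral>x. f x \<partial>\<nu>)) \<partial>\<Lambda>)"
  proof (rule nn_integral_cong)
    fix \<nu> assume \<nu>: "\<nu> \<in> space \<Lambda>"
    note D = invariant_measuresD[OF \<nu>[unfolded space_mixing]]
    interpret \<nu>: prob_space \<nu> by (rule D)
    have "integrable \<nu> f" using f by (intro \<nu>.integrable_const_bound[of _ B]) (auto simp: measurable_cong_sets[OF D(2) refl])
    then have "(\<integral>\<^sup>+x. ennreal (f x) \<partial>\<nu>) = ennreal (\<integral>x. f x \<partial>\<nu>)" using f(2) by (intro nn_integral_eq_integral) auto
    then show "indicator S \<nu> * (\<integral>\<^sup>+x. ennreal (f x) \<partial>\<nu>) = ennreal (indicator S \<nu> * (\<integral>x. f x \<partial>\<nu>))"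
      by (simp add: indicator_def)
  qed
  also have "enn2real \<dots> = (\<integral>\<nu>. indicator S \<nu> * (\<integral>x. f x \<partial>\<nu>) \<partial>\<Lambda>)"
    using S f integral_measurable[OF f(1)]
    by (intro integral_eq_nn_integral[symmetric] borel_measurable_times) (auto intro!: AE_I2 mult_nonneg_nonneg Bochner_Integration.integral_nonneg)
  finally show ?thesis .
qed

lemma integral_bounded_integrable:
  fixes f :: "'a \<Rightarrow> real"
  assumes f: "f \<in> borel_measurable borel" "\<And>x. 0 \<le> f x" "\<And>x. f x \<le> B"
  shows "integrable \<Lambda> (\<lambda>\<nu>. \<integral>x. f x \<partial>\<nu>)" "\<And>\<nu>. \<nu> \<in> space \<Lambda> \<Longrightarrow> (\<integral>x. f x \<partial>\<nu>) \<le> B" "\<And>\<nu>. 0 \<le> (\<integral>x. f x \<partial>\<nu>)"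
proof -
  show le: "(\<integral>x. f x \<partial>\<nu>) \<le> B" if \<nu>: "\<nu> \<in> space \<Lambda>" for \<nu>
  proof -
    note D = invariant_measuresD[OF \<nu>[unfolded space_mixing]]
    interpret \<nu>: prob_space \<nu> by (rule D)
    have "integrable \<nu> f" using f by (intro \<nu>.integrable_const_bound[of _ B]) (auto simp: measurable_cong_sets[OF D(2) refl])
    then have "(\<integral>x. f x \<partial>\<nu>) \<le> (\<integral>x. B \<partial>\<nu>)" using f(3) by (intro integral_mono) auto
    then show ?thesis using \<nu>.prob_space by simp
  qed
  show ge: "0 \<le> (\<integral>x. f x \<partial>\<nu>)" for \<nu> :: "'a measure" using f(2) by (intro Bochner_Integration.integral_nonneg) auto
  show "integrable \<Lambda> (\<lambda>\<nu>. \<integral>x. f x \<partial>\<nu>)"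
    using integral_measurable[OF f(1)] le ge by (intro integrable_const_bound[of _ B] AE_I2) auto
qed

text \<open>Cutting the mixture along the levels of a selector and integrating piecewise amounts to
  integrating over components with the function selected for each. The divisors \<open>w k\<close>
  are volumes in the applications.\<close>

lemma sum_integral_mix:
  fixes f :: "nat \<Rightarrow> 'a \<Rightarrow> real"
  assumes \<kappa>: "\<kappa> \<in> measurable \<Lambda> (count_space UNIV)" "\<And>\<nu>. \<nu> \<in> space \<Lambda> \<Longrightarrow> \<kappa> \<nu> < (K::nat)"
    and f: "\<And>k. k < K \<Longrightarrow> f k \<in> borel_measurable borel" "\<And>k x. k < K \<Longrightarrow> 0 \<le> f k x" "\<And>k. k < K \<Longrightarrow> \<exists>B. \<forall>x. f k x \<le> B"
  shows "(\<Sum>k<K. (\<integral>x. f k x \<partial>mix {\<nu> \<in> space \<Lambda>. \<kappa> \<nu> = k}) / w k) = (\<integral>\<nu>. (\<integral>x. f (\<kappa> \<nu>) x \<partial>\<nu>) / w (\<kappa> \<nu>) \<partial>\<Lambda>)"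
    and "integrable \<Lambda> (\<lambda>\<nu>. (\<integral>x. f (\<kappa> \<nu>) x \<partial>\<nu>) / w (\<kappa> \<nu>))"
proof -
  let ?S = "\<lambda>k. {\<nu> \<in> space \<Lambda>. \<kappa> \<nu> = k}"
  have s: "?S k \<in> sets \<Lambda>" for k
    using measurable_sets[OF \<kappa>(1), of "{k}"] by (simp add: vimage_def Int_def conj_commute)
  have eq: "(\<Sum>k<K. indicator (?S k) \<nu> * (\<integral>x. f k x \<partial>\<nu>) / w k) = (\<integral>x. f (\<kappa> \<nu>) x \<partial>\<nu>) / w (\<kappa> \<nu>)"
    if "\<nu> \<in> space \<Lambda>" for \<nu>
  proof -
    have "(\<Sum>k<K. indicator (?S k) \<nu> * (\<integral>x. f k x \<partial>\<nu>) / w k) = (\<Sum>k<K. if k = \<kappa> \<nu> then (\<integral>x. f k x \<partial>\<nu>) / w k else 0)"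
      using that by (intro sum.cong) (auto simp: indicator_def)
    then show ?thesis using \<kappa>(2)[OF that] by simp
  qed
  have i: "integrable \<Lambda> (\<lambda>\<nu>. indicator (?S k) \<nu> * (\<integral>x. f k x \<partial>\<nu>) / w k)" if k: "k < K" for k
  proof -
    obtain B where "\<And>x. f k x \<le> B" using f(3)[OF k] by blast
    then have "integrable \<Lambda> (\<lambda>\<nu>. \<integral>x. f k x \<partial>\<nu>)" by (rule integral_bounded_integrable(1)[OF f(1,2)[OF k]])
    from integrable_real_mult_indicator[OF s this] show ?thesis
      by (intro integrable_divide) (simp add: mult.commute)
  qed
  have "integrable \<Lambda> (\<lambda>\<nu>. \<Sum>k<K. indicator (?S k) \<nu> * (\<integral>x. f k x \<partial>\<nu>) / w k)"
    using i by (intro Bochner_Integration.integrable_sum) auto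
  then show "integrable \<Lambda> (\<lambda>\<nu>. (\<integral>x. f (\<kappa> \<nu>) x \<partial>\<nu>) / w (\<kappa> \<nu>))"
    using eq by (subst Bochner_Integration.integrable_cong[OF refl eq[symmetric]])
  have "(\<integral>x. f k x \<partial>mix (?S k)) = (\<integral>\<nu>. indicator (?S k) \<nu> * (\<integral>x. f k x \<partial>\<nu>) \<partial>\<Lambda>)" if k: "k < K" for k
  proof -
    obtain B where "\<And>x. f k x \<le> B" using f(3)[OF k] by blast
    then show ?thesis by (rule integral_mix[OF s f(1,2)[OF k]])
  qed
  then have "(\<Sum>k<K. (\<integral>x. f k x \<partial>mix (?S k)) / w k) = (\<Sum>k<K. \<integral>\<nu>. indicator (?S k) \<nu> * (\<integral>x. f k x \<partial>\<nu>) / w k \<partial>\<Lambda>)"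
    by (intro sum.cong) auto
  also have "\<dots> = (\<integral>\<nu>. (\<Sum>k<K. indicator (?S k) \<nu> * (\<integral>x. f k x \<partial>\<nu>) / w k) \<partial>\<Lambda>)"
    using i by (intro Bochner_Integration.integral_sum[symmetric]) auto
  also have "\<dots> = (\<integral>\<nu>. (\<integral>x. f (\<kappa> \<nu>) x \<partial>\<nu>) / w (\<kappa> \<nu>) \<partial>\<Lambda>)"
    by (rule Bochner_Integration.integral_cong[OF refl eq])
  finally show "(\<Sum>k<K. (\<integral>x. f k x \<partial>mix (?S k)) / w k) = (\<integral>\<nu>. (\<integral>x. f (\<kappa> \<nu>) x \<partial>\<nu>) / w (\<kappa> \<nu>) \<partial>\<Lambda>)" .
qed

lemma chan_sum_integral_mix:
  assumes \<kappa>: "\<kappa> \<in> measurable \<Lambda> (count_space UNIV)" "\<And>\<nu>. \<nu> \<in> space \<Lambda> \<Longrightarrow> \<kappa> \<nu> < (K::nat)"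
    and ch: "\<And>k. k < K \<Longrightarrow> chan (cube (l k)) (j k) (c k)"
  shows "(\<Sum>k<K. (\<integral>x. j k x \<partial>mix {\<nu> \<in> space \<Lambda>. \<kappa> \<nu> = k}) / w k) = (\<integral>\<nu>. (\<integral>x. j (\<kappa> \<nu>) x \<partial>\<nu>) / w (\<kappa> \<nu>) \<partial>\<Lambda>)"
    and "integrable \<Lambda> (\<lambda>\<nu>. (\<integral>x. j (\<kappa> \<nu>) x \<partial>\<nu>) / w (\<kappa> \<nu>))"
    and "(\<Sum>k<K. (\<integral>x. c k x \<partial>mix {\<nu> \<in> space \<Lambda>. \<kappa> \<nu> = k}) / w k) = (\<integral>\<nu>. (\<integral>x. c (\<kappa> \<nu>) x \<partial>\<nu>) / w (\<kappa> \<nu>) \<partial>\<Lambda>)"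
    and "integrable \<Lambda> (\<lambda>\<nu>. (\<integral>x. c (\<kappa> \<nu>) x \<partial>\<nu>) / w (\<kappa> \<nu>))"
proof -
  have u: "\<exists>B. \<forall>x. c k x \<le> B" if "k < K" for k using chan_bounded(6)[OF ch[OF that] region_cube] by blast
  show "(\<Sum>k<K. (\<integral>x. j k x \<partial>mix {\<nu> \<in> space \<Lambda>. \<kappa> \<nu> = k}) / w k) = (\<integral>\<nu>. (\<integral>x. j (\<kappa> \<nu>) x \<partial>\<nu>) / w (\<kappa> \<nu>) \<partial>\<Lambda>)"
    by (intro sum_integral_mix(1) \<kappa> chan_bounded(1,3,4)[OF ch region_cube])
  show "integrable \<Lambda> (\<lambda>\<nu>. (\<integral>x. j (\<kappa> \<nu>) x \<partial>\<nu>) / w (\<kappa> \<nu>))"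
    by (intro sum_integral_mix(2)[where f=j and K=K] \<kappa> chan_bounded(1,3,4)[OF ch region_cube])
  show "(\<Sum>k<K. (\<integral>x. c k x \<partial>mix {\<nu> \<in> space \<Lambda>. \<kappa> \<nu> = k}) / w k) = (\<integral>\<nu>. (\<integral>x. c (\<kappa> \<nu>) x \<partial>\<nu>) / w (\<kappa> \<nu>) \<partial>\<Lambda>)"
    by (intro sum_integral_mix(1) \<kappa> chan_bounded(2,5)[OF ch region_cube] u)
  show "integrable \<Lambda> (\<lambda>\<nu>. (\<integral>x. c (\<kappa> \<nu>) x \<partial>\<nu>) / w (\<kappa> \<nu>))"
    by (intro sum_integral_mix(2)[where f=c and K=K] \<kappa> chan_bounded(2,5)[OF ch region_cube] u)
qed

text \<open>No trace of \<open>K\<close> remains in the conclusion: the cost of naming the channel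
  has vanished in the tiling limit, so \<open>K\<close> may be as large as the truncation
  demands.\<close>

lemma rate_distortion_mixture_select:
  assumes \<kappa>: "\<kappa> \<in> measurable \<Lambda> (count_space UNIV)" "\<And>\<nu>. \<nu> \<in> space \<Lambda> \<Longrightarrow> \<kappa> \<nu> < (K::nat)"
    and l: "\<And>k. k < K \<Longrightarrow> 0 < l k" and ch: "\<And>k. k < K \<Longrightarrow> chan (cube (l k)) (j k) (c k)"
    and cost: "(\<integral>\<nu>. (\<integral>x. c (\<kappa> \<nu>) x \<partial>\<nu>) / l (\<kappa> \<nu>) ^ CARD('n) \<partial>\<Lambda>) < \<epsilon>"
    and info: "(\<integral>\<nu>. (\<integral>x. j (\<kappa> \<nu>) x \<partial>\<nu>) / l (\<kappa> \<nu>) ^ CARD('n) \<partial>\<Lambda>) < a"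
  shows "rate_distortion T (mixture \<Lambda>) \<epsilon> \<le> ereal a"
proof (rule rate_distortion_less[OF mixture_invariant rate_distortion_cube_tiled[OF l ch]])
  let ?S = "\<lambda>k. {\<nu> \<in> space \<Lambda>. \<kappa> \<nu> = k}"
  show "invariant_finite (mix (?S k))" for k
    using measurable_sets[OF \<kappa>(1), of "{k}"] by (intro invariant_finite_mix) (simp add: vimage_def Int_def conj_commute)
  show "prob_space (mixture \<Lambda>)" "sets (mixture \<Lambda>) = sets borel"
    using invariant_measuresD[OF mixture_invariant] by auto
  show "emeasure (mixture \<Lambda>) A = (\<Sum>k<K. emeasure (mix (?S k)) A)" if "A \<in> sets borel" for A
    by (rule mixture_sum[OF \<kappa> that])
  show "(\<Sum>k<K. (\<integral>x. c k x \<partial>mix (?S k)) / l k ^ CARD('n)) < \<epsilon>"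
    "(\<Sum>k<K. (\<integral>x. j k x \<partial>mix (?S k)) / l k ^ CARD('n)) < a"
    using cost info chan_sum_integral_mix[OF \<kappa> ch] by simp_all
qed

lemma rate_distortion_measurable: "(\<lambda>\<nu>. rate_distortion T \<nu> \<epsilon>) \<in> borel_measurable \<Lambda>"
proof (rule borel_measurableI_less)
  fix y :: ereal
  obtain l J C where l: "\<And>n::nat. 0 < l n" and ch: "\<And>n. chan (cube (l n)) (J n) (C n)"
    and iff: "\<And>\<nu> \<epsilon> a. \<nu> \<in> invariant_measures T \<Longrightarrow> rate_distortion T \<nu> \<epsilon> < ereal a \<longleftrightarrow>
       (\<exists>n. (\<integral>x. J n x \<partial>\<nu>) / l n ^ CARD('n) < a \<and> (\<integral>x. C n x \<partial>\<nu>) / l n ^ CARD('n) < \<epsilon>)"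
    using channel_sequence by blast
  note b = chan_bounded[OF ch region_cube]
  note [measurable] = integral_measurable[OF b(1)] integral_measurable[OF b(2)]
  \<comment> \<open>A rational fits strictly between the rate and \<open>y\<close>, also for
    infinite \<open>y\<close>; for each rational the sublevel is a countable union over
    channels.\<close>
  have "{\<nu> \<in> space \<Lambda>. rate_distortion T \<nu> \<epsilon> < y} =
    (\<Union>q\<in>{q::rat. ereal (of_rat q) \<le> y}. \<Union>n. {\<nu> \<in> space \<Lambda>. (\<integral>x. J n x \<partial>\<nu>) / l n ^ CARD('n) < of_rat q \<and>
        (\<integral>x. C n x \<partial>\<nu>) / l n ^ CARD('n) < \<epsilon>})" (is "_ = ?R")
  proof (intro set_eqI iffI)
    fix \<nu> assume \<nu>: "\<nu> \<in> {\<nu> \<in> space \<Lambda>. rate_distortion T \<nu> \<epsilon> < y}"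
    then obtain q :: rat where q: "rate_distortion T \<nu> \<epsilon> < ereal (of_rat q)" "ereal (of_rat q) < y"
      using ereal_dense3 by blast
    with iff[of \<nu> \<epsilon> "of_rat q"] \<nu>
    have "\<exists>n. (\<integral>x. J n x \<partial>\<nu>) / l n ^ CARD('n) < of_rat q \<and> (\<integral>x. C n x \<partial>\<nu>) / l n ^ CARD('n) < \<epsilon>"
      by (simp add: space_mixing)
    with less_imp_le[OF q(2)] \<nu> show "\<nu> \<in> ?R" by blast
  next
    fix \<nu> assume "\<nu> \<in> ?R"
    then obtain q where "\<nu> \<in> space \<Lambda>" "rate_distortion T \<nu> \<epsilon> < ereal (of_rat q)" "ereal (of_rat q) \<le> y"
      using iff by (auto simp: space_mixing)
    then show "\<nu> \<in> {\<nu> \<in> space \<Lambda>. rate_distortion T \<nu> \<epsilon> < y}" by auto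
  qed
  also have "\<dots> \<in> sets \<Lambda>"
    by (intro sets.countable_UN' countableI_type sets.countable_UN) (auto intro: countable_subset)
  finally show "{\<nu> \<in> space \<Lambda>. rate_distortion T \<nu> \<epsilon> < y} \<in> sets \<Lambda>" .
qed

abbreviation rate :: "real \<Rightarrow> 'a measure \<Rightarrow> real" where
  "rate \<epsilon> \<nu> \<equiv> real_of_ereal (rate_distortion T \<nu> \<epsilon>)"

lemma rate_finite:
  assumes "\<forall>\<nu>\<in>invariant_measures T. rate_distortion T \<nu> \<epsilon> \<le> ereal B"
  shows "\<And>\<nu>. \<nu> \<in> invariant_measures T \<Longrightarrow> rate_distortion T \<nu> \<epsilon> = ereal (rate \<epsilon> \<nu>)"
    "\<And>\<nu>. \<nu> \<in> invariant_measures T \<Longrightarrow> 0 \<le> rate \<epsilon> \<nu>"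
    "\<And>\<nu>. \<nu> \<in> invariant_measures T \<Longrightarrow> rate \<epsilon> \<nu> \<le> B"
    "integrable \<Lambda> (rate \<epsilon>)"
proof -
  show 1: "rate_distortion T \<nu> \<epsilon> = ereal (rate \<epsilon> \<nu>)" and 2: "0 \<le> rate \<epsilon> \<nu>" and 3: "rate \<epsilon> \<nu> \<le> B"
    if \<nu>: "\<nu> \<in> invariant_measures T" for \<nu>
    using bspec[OF assms \<nu>] rate_distortion_nonneg[OF \<nu>, of \<epsilon>]
    by (cases "rate_distortion T \<nu> \<epsilon>"; simp)+
  have "norm (rate \<epsilon> \<nu>) \<le> B" if "\<nu> \<in> space \<Lambda>" for \<nu>
    unfolding real_norm_def using 2 3 that by (subst abs_of_nonneg) (auto simp: space_mixing)
  then show "integrable \<Lambda> (rate \<epsilon>)"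
    by (intro integrable_const_bound[of _ B] AE_I2 borel_measurable_real_of_ereal rate_distortion_measurable)
qed

lemma rate_distortion_mixture_le:
  assumes bound: "\<forall>\<nu>\<in>invariant_measures T. rate_distortion T \<nu> \<epsilon> \<le> ereal B"
  shows "rate_distortion T (mixture \<Lambda>) \<epsilon> \<le> ereal (\<integral>\<nu>. rate \<epsilon> \<nu> \<partial>\<Lambda>)"
proof -
  note R = rate_finite[OF bound]
  note [measurable] = borel_measurable_integrable[OF R(4)]
  obtain l J C where l: "\<And>n::nat. 0 < l n" and ch: "\<And>n. chan (cube (l n)) (J n) (C n)"
    and iff: "\<And>\<nu> \<epsilon> a. \<nu> \<in> invariant_measures T \<Longrightarrow> rate_distortion T \<nu> \<epsilon> < ereal a \<longleftrightarrow>
       (\<exists>n. (\<integral>x. J n x \<partial>\<nu>) / l n ^ CARD('n) < a \<and> (\<integral>x. C n x \<partial>\<nu>) / l n ^ CARD('n) < \<epsilon>)"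
    using channel_sequence by blast
  note b = chan_bounded[OF ch region_cube]
  note [measurable] = integral_measurable[OF b(1)] integral_measurable[OF b(2)]
  obtain c0 where c0: "chan (cube 1) (\<lambda>_. 0) c0" using chan_trivial[OF region_cube] by blast
  have "rate_distortion T (mixture \<Lambda>) \<epsilon> \<le> ereal (\<integral>\<nu>. rate \<epsilon> \<nu> \<partial>\<Lambda>) + ereal \<delta>" if \<delta>: "0 < \<delta>" for \<delta> :: real
  proof -
    define P where "P n \<nu> \<longleftrightarrow> (\<integral>x. J n x \<partial>\<nu>) / l n ^ CARD('n) < rate \<epsilon> \<nu> + \<delta> / 2 \<and>
        (\<integral>x. C n x \<partial>\<nu>) / l n ^ CARD('n) < \<epsilon>" for n \<nu>
    define \<kappa> where "\<kappa> \<nu> = (LEAST n. P n \<nu>)" for \<nu>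
    have [measurable]: "(\<lambda>\<nu>. P n \<nu>) \<in> measurable \<Lambda> (count_space UNIV)" for n
      unfolding P_def by measurable
    have \<kappa>m: "\<kappa> \<in> measurable \<Lambda> (count_space UNIV)"
      unfolding \<kappa>_def by (rule measurable_Least) measurable
    have P: "P (\<kappa> \<nu>) \<nu>" if \<nu>: "\<nu> \<in> space \<Lambda>" for \<nu>
    proof -
      have \<nu>': "\<nu> \<in> invariant_measures T" using \<nu> by (simp add: space_mixing)
      have "rate_distortion T \<nu> \<epsilon> < ereal (rate \<epsilon> \<nu> + \<delta> / 2)" using \<delta> by (subst R(1)[OF \<nu>']) simp
      then have "\<exists>n. P n \<nu>" unfolding P_def iff[OF \<nu>'] .
      then show ?thesis unfolding \<kappa>_def by (rule LeastI_ex)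
    qed
    define g where "g \<nu> = (\<integral>x. C (\<kappa> \<nu>) x \<partial>\<nu>) / l (\<kappa> \<nu>) ^ CARD('n)" for \<nu>
    have gm: "g \<in> borel_measurable \<Lambda>"
      unfolding g_def
      by (rule measurable_compose_countable[where f="\<lambda>i \<nu>. (\<integral>x. C i x \<partial>\<nu>) / l i ^ CARD('n)", OF _ \<kappa>m]) measurable
    have g0: "0 \<le> g \<nu>" for \<nu>
      unfolding g_def using b(5) l by (intro divide_nonneg_pos Bochner_Integration.integral_nonneg zero_less_power) auto
    have gi: "integrable \<Lambda> g"
      using gm g0 P unfolding P_def g_def[symmetric]
      by (intro integrable_const_bound[of _ \<epsilon>] AE_I2) (auto simp: less_imp_le)
    \<comment> \<open>The cost is strictly below \<open>\<epsilon>\<close> on every component, hence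
      on average; this slack pays for the truncation.\<close>
    have gE: "(\<integral>\<nu>. g \<nu> \<partial>\<Lambda>) < \<epsilon>"
      using P unfolding P_def g_def[symmetric] by (intro expectation_less gi AE_I2) auto
    have sK: "{\<nu> \<in> space \<Lambda>. m \<le> \<kappa> \<nu>} \<in> sets \<Lambda>" for m
      using measurable_sets[OF \<kappa>m, of "{m..}"] by (simp add: vimage_def Int_def conj_commute)
    have "(\<lambda>m. prob {\<nu> \<in> space \<Lambda>. m \<le> \<kappa> \<nu>}) \<longlonglongrightarrow> prob (\<Inter>m. {\<nu> \<in> space \<Lambda>. m \<le> \<kappa> \<nu>})"
      using sK by (intro finite_Lim_measure_decseq) (auto simp: decseq_def)
    moreover have "(\<Inter>m. {\<nu> \<in> space \<Lambda>. m \<le> \<kappa> \<nu>}) = {}"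
      using Suc_n_not_le_n by blast
    ultimately have "(\<lambda>m. (\<integral>\<nu>. g \<nu> \<partial>\<Lambda>) + diam_space * prob {\<nu> \<in> space \<Lambda>. m \<le> \<kappa> \<nu>}) \<longlonglongrightarrow> (\<integral>\<nu>. g \<nu> \<partial>\<Lambda>) + diam_space * 0"
      by (intro tendsto_add tendsto_mult tendsto_const) simp
    from order_tendstoD(2)[OF this, of \<epsilon>] gE
    obtain m where m: "(\<integral>\<nu>. g \<nu> \<partial>\<Lambda>) + diam_space * prob {\<nu> \<in> space \<Lambda>. m \<le> \<kappa> \<nu>} < \<epsilon>"
      by (auto simp: eventually_sequentially)
    \<comment> \<open>Components of index at least \<open>m\<close> share the extra index
      \<open>m\<close>, which carries the one-letter channel on the unit cube. Its information is
      zero and its cost at most \<open>diam_space\<close>, so the truncation affects the cost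
      alone.\<close>
    define \<kappa>' where "\<kappa>' \<nu> = min (\<kappa> \<nu>) m" for \<nu>
    define l' where "l' k = (if k < m then l k else 1)" for k
    define J' where "J' k = (if k < m then J k else (\<lambda>_. 0))" for k
    define C' where "C' k = (if k < m then C k else c0)" for k
    have \<kappa>': "\<kappa>' \<in> measurable \<Lambda> (count_space UNIV)" "\<kappa>' \<nu> < Suc m" for \<nu>
      unfolding \<kappa>'_def by (rule measurable_compose[OF \<kappa>m]) simp_all
    have l': "0 < l' k" and ch': "chan (cube (l' k)) (J' k) (C' k)" for k
      using l ch c0 by (auto simp: l'_def J'_def C'_def)
    note S = chan_sum_integral_mix[OF \<kappa>' ch', where w="\<lambda>k. l' k ^ CARD('n)"]
    have cc0: "(\<integral>x. c0 x \<partial>\<nu>) \<le> diam_space" if "\<nu> \<in> space \<Lambda>" for \<nu>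
      using integral_bounded_integrable(2)[OF chan_bounded(2,5,6)[OF c0 region_cube] that]
      by (simp add: measure_cube)
    have "(\<integral>\<nu>. (\<integral>x. C' (\<kappa>' \<nu>) x \<partial>\<nu>) / l' (\<kappa>' \<nu>) ^ CARD('n) \<partial>\<Lambda>) \<le>
        (\<integral>\<nu>. g \<nu> + diam_space * indicator {\<nu> \<in> space \<Lambda>. m \<le> \<kappa> \<nu>} \<nu> \<partial>\<Lambda>)"
    proof (rule integral_mono[OF S(4)])
      show "integrable \<Lambda> (\<lambda>\<nu>. g \<nu> + diam_space * indicator {\<nu> \<in> space \<Lambda>. m \<le> \<kappa> \<nu>} \<nu>)"
        using gi sK by (intro Bochner_Integration.integrable_add integrable_mult_right integrable_real_indicator)
          (auto simp: emeasure_eq_measure)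
      fix \<nu> assume \<nu>: "\<nu> \<in> space \<Lambda>"
      show "(\<integral>x. C' (\<kappa>' \<nu>) x \<partial>\<nu>) / l' (\<kappa>' \<nu>) ^ CARD('n) \<le> g \<nu> + diam_space * indicator {\<nu> \<in> space \<Lambda>. m \<le> \<kappa> \<nu>} \<nu>"
      proof (cases "m \<le> \<kappa> \<nu>")
        case True
        then show ?thesis using \<nu> cc0[OF \<nu>] g0[of \<nu>] by (simp add: \<kappa>'_def C'_def l'_def)
      qed (use \<nu> in \<open>simp add: \<kappa>'_def C'_def l'_def g_def\<close>)
    qed
    also have "\<dots> = (\<integral>\<nu>. g \<nu> \<partial>\<Lambda>) + diam_space * prob {\<nu> \<in> space \<Lambda>. m \<le> \<kappa> \<nu>}"
    proof -
      have "integrable \<Lambda> (\<lambda>\<nu>. diam_space * indicator {\<nu> \<in> space \<Lambda>. m \<le> \<kappa> \<nu>} \<nu>)"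
        using sK[of m] by (intro integrable_mult_right integrable_real_indicator) (auto simp: emeasure_eq_measure)
      then show ?thesis using gi sK[of m] by (simp add: Int_absorb2 subset_eq)
    qed
    also note m
    finally have cost: "(\<integral>\<nu>. (\<integral>x. C' (\<kappa>' \<nu>) x \<partial>\<nu>) / l' (\<kappa>' \<nu>) ^ CARD('n) \<partial>\<Lambda>) < \<epsilon>" .
    have "(\<integral>\<nu>. (\<integral>x. J' (\<kappa>' \<nu>) x \<partial>\<nu>) / l' (\<kappa>' \<nu>) ^ CARD('n) \<partial>\<Lambda>) \<le> (\<integral>\<nu>. rate \<epsilon> \<nu> + \<delta> / 2 \<partial>\<Lambda>)"
    proof (rule integral_mono[OF S(2)])
      show "integrable \<Lambda> (\<lambda>\<nu>. rate \<epsilon> \<nu> + \<delta> / 2)" using R(4) by simp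
      fix \<nu> assume \<nu>: "\<nu> \<in> space \<Lambda>"
      show "(\<integral>x. J' (\<kappa>' \<nu>) x \<partial>\<nu>) / l' (\<kappa>' \<nu>) ^ CARD('n) \<le> rate \<epsilon> \<nu> + \<delta> / 2"
        using P[OF \<nu>] R(2)[of \<nu>] \<nu> \<delta> by (cases "m \<le> \<kappa> \<nu>") (auto simp: \<kappa>'_def J'_def l'_def P_def space_mixing)
    qed
    also have "\<dots> = (\<integral>\<nu>. rate \<epsilon> \<nu> \<partial>\<Lambda>) + \<delta> / 2" using R(4) prob_space by simp
    also have "\<dots> < (\<integral>\<nu>. rate \<epsilon> \<nu> \<partial>\<Lambda>) + \<delta>" using \<delta> by simp
    finally have "rate_distortion T (mixture \<Lambda>) \<epsilon> \<le> ereal ((\<integral>\<nu>. rate \<epsilon> \<nu> \<partial>\<Lambda>) + \<delta>)"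
      by (rule rate_distortion_mixture_select[OF \<kappa>' l' ch' cost])
    then show ?thesis by simp
  qed
  then show ?thesis by (rule ereal_le_epsilon2)
qed

text \<open>
  A channel that is good for the mixture is good for most components: those on which its cost
  exceeds \<open>K\<close> times the average are controlled by Markov's inequality and the uniform bound \<open>B\<close>.
\<close>

lemma rate_distortion_mixture_ge:
  assumes K: "0 < K" and \<epsilon>: "0 < \<epsilon>"
    and bound: "\<forall>\<nu>\<in>invariant_measures T. rate_distortion T \<nu> (K * \<epsilon>) \<le> ereal B" and B: "0 \<le> B"
    and a: "rate_distortion T (mixture \<Lambda>) \<epsilon> < ereal a"
  shows "(\<integral>\<nu>. rate (K * \<epsilon>) \<nu> \<partial>\<Lambda>) \<le> a + B / K"
proof -
  note R = rate_finite[OF bound]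
  obtain l J C where l: "\<And>n::nat. 0 < l n" and ch: "\<And>n. chan (cube (l n)) (J n) (C n)"
    and iff: "\<And>\<nu> \<epsilon> a. \<nu> \<in> invariant_measures T \<Longrightarrow> rate_distortion T \<nu> \<epsilon> < ereal a \<longleftrightarrow>
       (\<exists>n. (\<integral>x. J n x \<partial>\<nu>) / l n ^ CARD('n) < a \<and> (\<integral>x. C n x \<partial>\<nu>) / l n ^ CARD('n) < \<epsilon>)"
    using channel_sequence by blast
  obtain n where n: "(\<integral>x. J n x \<partial>mixture \<Lambda>) / l n ^ CARD('n) < a" "(\<integral>x. C n x \<partial>mixture \<Lambda>) / l n ^ CARD('n) < \<epsilon>"
    using a iff[OF mixture_invariant] by blast
  let ?\<eta> = "\<lambda>\<nu>. (\<integral>x. J n x \<partial>\<nu>) / l n ^ CARD('n)" and ?\<gamma> = "\<lambda>\<nu>. (\<integral>x. C n x \<partial>\<nu>) / l n ^ CARD('n)"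
  have ld: "0 < l n ^ CARD('n)" using l by simp
  note b = chan_bounded[OF ch region_cube, of n]
  obtain BJ where BJ: "\<And>x. J n x \<le> BJ" using b(4) by blast
  have i: "integrable \<Lambda> ?\<eta>" "integrable \<Lambda> ?\<gamma>"
    using integral_bounded_integrable(1)[OF b(1,3) BJ] integral_bounded_integrable(1)[OF b(2,5,6)] by simp_all
  have E: "(\<integral>\<nu>. ?\<eta> \<nu> \<partial>\<Lambda>) = ?\<eta> (mixture \<Lambda>)" "(\<integral>\<nu>. ?\<gamma> \<nu> \<partial>\<Lambda>) = ?\<gamma> (mixture \<Lambda>)"
    unfolding mixture_eq integral_mix[OF sets.top b(1,3) BJ] integral_mix[OF sets.top b(2,5,6)]
    by (simp_all cong: Bochner_Integration.integral_cong)
  \<comment> \<open>Markov's inequality in pointwise form: either the channel is admissible for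
    \<open>\<nu>\<close> at level \<open>K * \<epsilon>\<close>, or its relative cost
    \<open>?\<gamma> \<nu> / (K * \<epsilon>)\<close> is at least one and the last term outweighs
    the bound \<open>B\<close>.\<close>
  have "rate (K * \<epsilon>) \<nu> \<le> ?\<eta> \<nu> + B / (K * \<epsilon>) * ?\<gamma> \<nu>" if "\<nu> \<in> space \<Lambda>" for \<nu>
  proof -
    have \<nu>: "\<nu> \<in> invariant_measures T" using that by (simp add: space_mixing)
    have p: "0 \<le> ?\<eta> \<nu>" "0 \<le> ?\<gamma> \<nu>"
      using b(3,5) ld by (auto intro!: divide_nonneg_pos Bochner_Integration.integral_nonneg)
    show ?thesis
    proof (cases "?\<gamma> \<nu> < K * \<epsilon>")
      case True
      have "rate (K * \<epsilon>) \<nu> \<le> ?\<eta> \<nu>"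
      proof (rule dense_ge)
        fix z assume "?\<eta> \<nu> < z"
        then have "rate_distortion T \<nu> (K * \<epsilon>) < ereal z" using True iff[OF \<nu>] by blast
        then show "rate (K * \<epsilon>) \<nu> \<le> z" by (subst (asm) R(1)[OF \<nu>]) simp
      qed
      moreover have "0 \<le> B / (K * \<epsilon>) * ?\<gamma> \<nu>"
        by (rule mult_nonneg_nonneg[OF divide_nonneg_pos[OF B mult_pos_pos[OF K \<epsilon>]] p(2)])
      ultimately show ?thesis by linarith
    next
      case False
      then have "1 \<le> ?\<gamma> \<nu> / (K * \<epsilon>)" using K \<epsilon> by (simp only: not_less le_divide_eq_1_pos mult_pos_pos)
      from mult_left_mono[OF this B] have "B \<le> B / (K * \<epsilon>) * ?\<gamma> \<nu>" by (simp add: mult_ac)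
      then show ?thesis using R(3)[OF \<nu>] p(1) by linarith
    qed
  qed
  then have "(\<integral>\<nu>. rate (K * \<epsilon>) \<nu> \<partial>\<Lambda>) \<le> (\<integral>\<nu>. ?\<eta> \<nu> + B / (K * \<epsilon>) * ?\<gamma> \<nu> \<partial>\<Lambda>)"
    using i R(4) by (intro integral_mono Bochner_Integration.integrable_add integrable_mult_right)
  also have "\<dots> = ?\<eta> (mixture \<Lambda>) + B / (K * \<epsilon>) * ?\<gamma> (mixture \<Lambda>)"
    using i by (subst Bochner_Integration.integral_add) (simp_all only: E integrable_mult_right integral_mult_right_zero)
  also have "\<dots> \<le> a + B / (K * \<epsilon>) * \<epsilon>"
    using n B K \<epsilon> by (intro add_mono mult_left_mono) auto
  also have "B / (K * \<epsilon>) * \<epsilon> = B / K" using \<epsilon> by simp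
  finally show ?thesis .
qed

end

subsection \<open>Limits along powers of one half\<close>

text \<open>The term \<open>C / 2 ^ k\<close> is the Markov loss for \<open>K = 2 ^ k\<close>, and
  \<open>C * real k / real (m + k)\<close> pays for the change of normalisation from
  \<open>m\<close> to \<open>m + k\<close>. First \<open>k\<close> is fixed large, then
  \<open>m\<close> tends to infinity.\<close>

lemma liminf_le_of_shifted:
  fixes x y :: "nat \<Rightarrow> real"
  assumes le: "\<And>m k. n\<^sub>0 \<le> m \<Longrightarrow> x m - C * real k / real (m + k) - C / 2 ^ k \<le> y (m + k)"
  shows "liminf (\<lambda>n. ereal (x n)) \<le> liminf (\<lambda>n. ereal (y n))"
  unfolding le_Liminf_iff[of "liminf (\<lambda>n. ereal (x n))"]
proof (intro allI impI)
  fix z assume "z < liminf (\<lambda>n. ereal (x n))"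
  then obtain b where b: "z < ereal b" "ereal b < liminf (\<lambda>n. ereal (x n))" using ereal_dense2 by blast
  obtain c where c: "ereal b < ereal c" "ereal c < liminf (\<lambda>n. ereal (x n))" using ereal_dense2[OF b(2)] by blast
  have bc: "0 < (c - b) / 2" using c(1) by simp
  have "(\<lambda>k. C * (1 / 2) ^ k) \<longlonglongrightarrow> C * 0"
    by (intro tendsto_mult tendsto_const LIMSEQ_power_zero) simp
  then have "\<forall>\<^sub>F k in sequentially. C * (1 / 2) ^ k < (c - b) / 2"
    by (rule order_tendstoD(2)) (use bc in \<open>simp only: mult_zero_right\<close>)
  then obtain k where "C * (1 / 2) ^ k < (c - b) / 2"
    using eventually_happens'[OF sequentially_bot] by blast
  then have k: "C / 2 ^ k < (c - b) / 2" by (simp only: power_one_over divide_inverse mult_1_left power_inverse)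
  have "filterlim (\<lambda>m. real (m + k)) at_top sequentially"
    by (rule filterlim_compose[OF filterlim_real_sequentially filterlim_add_const_nat_at_top])
  then have "(\<lambda>m. C * real k / real (m + k)) \<longlonglongrightarrow> 0"
    by (intro tendsto_divide_0[OF tendsto_const] filterlim_at_top_imp_at_infinity)
  then have "\<forall>\<^sub>F m in sequentially. C * real k / real (m + k) < (c - b) / 2" using bc by (rule order_tendstoD(2))
  moreover have "\<forall>\<^sub>F m in sequentially. ereal c < ereal (x m)"
    using c(2) le_Liminf_iff[of "liminf (\<lambda>n. ereal (x n))" sequentially "\<lambda>n. ereal (x n)"] by blast
  ultimately have "\<forall>\<^sub>F m in sequentially. z < ereal (y (m + k))"
    using eventually_ge_at_top[of n\<^sub>0]
  proof eventually_elim
    case (elim m)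
    have "b < v" if "t - p - q \<le> v" "p < (c - b) / 2" "c < t" "q < (c - b) / 2" for p q t v
      using that by simp
    from this[OF le[OF elim(3)] elim(1) _ k] elim(2) have "b < y (m + k)" by simp
    then have "ereal b < ereal (y (m + k))" by simp
    with b(1) show ?case by (rule less_trans)
  qed
  then show "\<forall>\<^sub>F n in sequentially. z < ereal (y n)" by (subst (asm) eventually_sequentially_seg)
qed

text \<open>Between consecutive powers the antitone \<open>g\<close> is squeezed. Changing the
  denominator from \<open>n\<close> to \<open>n + 1\<close> costs at most \<open>C / n\<close>,
  because \<open>g\<close> grows at most like \<open>C * log 2 (1 / x)\<close>.\<close>

lemma dyadic_limits:
  fixes g :: "real \<Rightarrow> real"
  assumes e: "0 < e" "e < 1" and C: "0 \<le> C"
    and mono: "\<And>x y. 0 < x \<Longrightarrow> x \<le> y \<Longrightarrow> y < e \<Longrightarrow> g y \<le> g x"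
    and g: "\<And>x. 0 < x \<Longrightarrow> x < e \<Longrightarrow> 0 \<le> g x" "\<And>x. 0 < x \<Longrightarrow> x < e \<Longrightarrow> g x \<le> C * log 2 (1 / x)"
  shows "Limsup (at_right 0) (\<lambda>x. ereal (g x / log 2 (1 / x))) = limsup (\<lambda>n. ereal (g ((1 / 2) ^ n) / real n))"
    and "Liminf (at_right 0) (\<lambda>x. ereal (g x / log 2 (1 / x))) = liminf (\<lambda>n. ereal (g ((1 / 2) ^ n) / real n))"
proof -
  let ?h = "\<lambda>x. g x / log 2 (1 / x)" and ?\<psi> = "\<lambda>n. g ((1 / 2) ^ n) / real n"
  define N where "N x = nat \<lfloor>log 2 (1 / x)\<rfloor>" for x :: real
  have log2: "log 2 (1 / (1 / 2) ^ n) = real n" for n :: nat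
    by (simp add: power_one_over log_nat_power)
  have half: "filterlim (\<lambda>n. (1 / 2) ^ n :: real) (at_right 0) sequentially"
    unfolding filterlim_at by (auto intro!: LIMSEQ_power_zero)
  have Ntop: "filterlim N sequentially (at_right 0)"
    unfolding filterlim_at_top
  proof
    fix Z :: nat
    have "\<forall>\<^sub>F x in at_right 0. x < (1 / 2) ^ Z \<and> (0::real) < x"
      unfolding eventually_at_right_field by (auto intro!: exI[of _ "(1 / 2) ^ Z"])
    then show "\<forall>\<^sub>F x in at_right 0. Z \<le> N x"
    proof eventually_elim
      case (elim x)
      then have "log 2 (1 / (1 / 2) ^ Z) \<le> log 2 (1 / x)" by (intro log_mono divide_left_mono) auto
      then show ?case unfolding log2 N_def by (rule le_nat_floor)
    qed
  qed
  \<comment> \<open>With \<open>e / 2\<close> the power of one half just above \<open>x\<close>, at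
    most \<open>2 * x\<close>, still lies below \<open>e\<close>.\<close>
  have small: "\<forall>\<^sub>F x in at_right 0. 0 < x \<and> x < e / 2"
    unfolding eventually_at_right_field using e by (auto intro!: exI[of _ "e / 2"])
  have sq: "\<forall>\<^sub>F x in at_right 0. ?\<psi> (N x) - C / real (N x) \<le> ?h x \<and> ?h x \<le> ?\<psi> (Suc (N x)) + C / real (N x)"
    using small
  proof eventually_elim
    case (elim x)
    then have x: "0 < x" "x < e" "x < 1 / 2" using e by auto
    let ?n = "N x" and ?l = "log 2 (1 / x)"
    have l1: "1 < ?l"
    proof -
      have "log 2 2 < log 2 (1 / x)" using x by (subst log_less_cancel_iff) (auto simp: field_simps)
      then show ?thesis by simp
    qed
    then have n: "real ?n \<le> ?l" "?l < real ?n + 1" "1 \<le> ?n"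
      by (auto simp: N_def le_nat_floor)
    have p: "?l = - log 2 x" using x by (simp add: log_divide)
    have x_le: "x \<le> (1 / 2) ^ ?n"
    proof -
      have "log 2 x \<le> - real ?n" using n(1) unfolding p by linarith
      then have "x \<le> 2 powr (- real ?n)" by (rule iffD1[OF log_le_iff[OF _ x(1)], rotated]) simp
      also have "2 powr (- real ?n) = (1 / 2) ^ ?n" unfolding powr_minus by (subst powr_realpow) (simp_all only: power_one_over divide_inverse mult_1_left power_inverse zero_less_numeral)
      finally show ?thesis .
    qed
    have x_ge: "(1 / 2) ^ Suc ?n \<le> x"
    proof -
      have "- real (Suc ?n) \<le> log 2 x" using n(2) unfolding p by simp
      then have "2 powr (- real (Suc ?n)) \<le> x" by (rule iffD1[OF le_log_iff[OF _ x(1)], rotated]) simp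
      moreover have "2 powr (- real (Suc ?n)) = (1 / 2) ^ Suc ?n" unfolding powr_minus by (subst powr_realpow) (simp_all only: power_one_over divide_inverse mult_1_left power_inverse zero_less_numeral)
      ultimately show ?thesis by (simp only:)
    qed
    then have "(1 / 2) ^ ?n \<le> 2 * x" by simp
    then have ne: "(1 / 2) ^ ?n < e" using elim by simp
    have Sne: "(1 / 2) ^ Suc ?n < e" using x_ge x by simp
    have G: "g ((1 / 2) ^ ?n) \<le> C * real ?n" "g ((1 / 2) ^ Suc ?n) \<le> C * real (Suc ?n)"
      using g(2)[OF _ ne] g(2)[OF _ Sne] unfolding log2 by simp_all
    have n0: "0 < real ?n" using n(3) by simp
    have split: "v / real ?n = v / real (Suc ?n) + v / (real ?n * real (Suc ?n))" for v
    proof -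
      have "v / real ?n = v * real (Suc ?n) / (real ?n * real (Suc ?n))" by (simp del: of_nat_Suc)
      also have "v * real (Suc ?n) = v * real ?n + v" by (simp add: distrib_left)
      finally show ?thesis using n0 by (simp add: add_divide_distrib del: of_nat_Suc)
    qed
    have "?h x \<le> g ((1 / 2) ^ Suc ?n) / real ?n"
      using mono[OF _ x_ge x(2)] n(1) n0 g(1)[OF x(1,2)] by (intro frac_le) auto
    also have "\<dots> = ?\<psi> (Suc ?n) + g ((1 / 2) ^ Suc ?n) / (real ?n * real (Suc ?n))"
      by (rule split)
    also have "\<dots> \<le> ?\<psi> (Suc ?n) + C * real (Suc ?n) / (real ?n * real (Suc ?n))"
      using G(2) n0 by (intro add_left_mono divide_right_mono) auto
    also have "C * real (Suc ?n) / (real ?n * real (Suc ?n)) = C / real ?n"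
      by (simp del: of_nat_Suc)
    finally have up: "?h x \<le> ?\<psi> (Suc ?n) + C / real ?n" .
    have "?\<psi> ?n - C / real ?n \<le> ?\<psi> ?n - C / real (Suc ?n)"
      using C n0 by (intro diff_left_mono divide_left_mono) auto
    also have "\<dots> \<le> ?\<psi> ?n - g ((1 / 2) ^ ?n) / (real ?n * real (Suc ?n))"
    proof (rule diff_left_mono)
      have "g ((1 / 2) ^ ?n) / (real ?n * real (Suc ?n)) \<le> C * real ?n / (real ?n * real (Suc ?n))"
        using G(1) n0 by (intro divide_right_mono) auto
      then show "g ((1 / 2) ^ ?n) / (real ?n * real (Suc ?n)) \<le> C / real (Suc ?n)" using n0 by simp
    qed
    also have "\<dots> = g ((1 / 2) ^ ?n) / real (Suc ?n)" by (subst split) simp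
    also have "\<dots> \<le> ?h x"
      using mono[OF x(1) x_le ne] n(2) l1 g(1)[OF _ ne] by (intro frac_le) (use g(1)[OF x(1,2)] in auto)
    finally show ?case using up by blast
  qed
  have CN: "(\<lambda>n. C / real n) \<longlonglongrightarrow> 0"
    by (intro tendsto_divide_0[OF tendsto_const] filterlim_at_top_imp_at_infinity filterlim_real_sequentially)
  have hpsi: "?h ((1 / 2) ^ n) = ?\<psi> n" for n unfolding log2 ..
  show "Limsup (at_right 0) (\<lambda>x. ereal (?h x)) = limsup (\<lambda>n. ereal (?\<psi> n))"
  proof (rule antisym)
    show "Limsup (at_right 0) (\<lambda>x. ereal (?h x)) \<le> limsup (\<lambda>n. ereal (?\<psi> n))"
      unfolding Limsup_le_iff[of _ _ "limsup (\<lambda>n. ereal (?\<psi> n))"]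
    proof (intro allI impI)
      fix y assume "limsup (\<lambda>n. ereal (?\<psi> n)) < y"
      then obtain c where c: "limsup (\<lambda>n. ereal (?\<psi> n)) < ereal c" "ereal c < y" using ereal_dense2 by blast
      obtain b where b: "limsup (\<lambda>n. ereal (?\<psi> n)) < ereal b" "ereal b < ereal c" using ereal_dense2[OF c(1)] by blast
      have "\<forall>\<^sub>F n in sequentially. ereal (?\<psi> (Suc n)) < ereal b"
        using Limsup_lessD[OF b(1)] by (subst eventually_sequentially_Suc)
      moreover have "\<forall>\<^sub>F n in sequentially. C / real n < c - b"
        using b(2) by (intro order_tendstoD(2)[OF CN]) simp
      ultimately have "\<forall>\<^sub>F n in sequentially. ?\<psi> (Suc n) + C / real n < c" by eventually_elim simp
      from eventually_compose_filterlim[OF this Ntop]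
      have "\<forall>\<^sub>F x in at_right 0. ?\<psi> (Suc (N x)) + C / real (N x) < c" .
      with sq show "\<forall>\<^sub>F x in at_right 0. ereal (?h x) < y"
      proof eventually_elim
        case (elim x)
        then have "ereal (?h x) < ereal c" by simp
        with c(2) show ?case by (rule less_trans[rotated])
      qed
    qed
    show "limsup (\<lambda>n. ereal (?\<psi> n)) \<le> Limsup (at_right 0) (\<lambda>x. ereal (?h x))"
      unfolding Limsup_le_iff[of _ _ "Limsup (at_right 0) (\<lambda>x. ereal (?h x))"]
    proof (intro allI impI)
      fix y assume "Limsup (at_right 0) (\<lambda>x. ereal (?h x)) < y"
      from eventually_compose_filterlim[OF Limsup_lessD[OF this] half]
      show "\<forall>\<^sub>F n in sequentially. ereal (?\<psi> n) < y" by (simp only: hpsi)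
    qed
  qed
  show "Liminf (at_right 0) (\<lambda>x. ereal (?h x)) = liminf (\<lambda>n. ereal (?\<psi> n))"
  proof (rule antisym)
    show "liminf (\<lambda>n. ereal (?\<psi> n)) \<le> Liminf (at_right 0) (\<lambda>x. ereal (?h x))"
      unfolding le_Liminf_iff[of "liminf (\<lambda>n. ereal (?\<psi> n))"]
    proof (intro allI impI)
      fix y assume "y < liminf (\<lambda>n. ereal (?\<psi> n))"
      then obtain c where c: "y < ereal c" "ereal c < liminf (\<lambda>n. ereal (?\<psi> n))" using ereal_dense2 by blast
      obtain b where b: "ereal c < ereal b" "ereal b < liminf (\<lambda>n. ereal (?\<psi> n))" using ereal_dense2[OF c(2)] by blast
      have "\<forall>\<^sub>F n in sequentially. ereal b < ereal (?\<psi> n)"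
        using b(2) le_Liminf_iff[of "liminf (\<lambda>n. ereal (?\<psi> n))" sequentially "\<lambda>n. ereal (?\<psi> n)"] by blast
      moreover have "\<forall>\<^sub>F n in sequentially. C / real n < b - c"
        using b(1) by (intro order_tendstoD(2)[OF CN]) simp
      ultimately have "\<forall>\<^sub>F n in sequentially. c < ?\<psi> n - C / real n" by eventually_elim simp
      from eventually_compose_filterlim[OF this Ntop]
      have "\<forall>\<^sub>F x in at_right 0. c < ?\<psi> (N x) - C / real (N x)" .
      with sq show "\<forall>\<^sub>F x in at_right 0. y < ereal (?h x)"
      proof eventually_elim
        case (elim x)
        then have "ereal c < ereal (?h x)" by simp
        with c(1) show ?case by (rule less_trans)
      qed
    qed
    show "Liminf (at_right 0) (\<lambda>x. ereal (?h x)) \<le> liminf (\<lambda>n. ereal (?\<psi> n))"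
      unfolding le_Liminf_iff[of "Liminf (at_right 0) (\<lambda>x. ereal (?h x))"]
    proof (intro allI impI)
      fix y assume "y < Liminf (at_right 0) (\<lambda>x. ereal (?h x))"
      then have "\<forall>\<^sub>F x in at_right 0. y < ereal (?h x)"
        using le_Liminf_iff[of "Liminf (at_right 0) (\<lambda>x. ereal (?h x))" "at_right 0" "\<lambda>x. ereal (?h x)"] by blast
      from eventually_compose_filterlim[OF this half]
      show "\<forall>\<^sub>F n in sequentially. y < ereal (?\<psi> n)" by (simp only: hpsi)
    qed
  qed
qed

text \<open>Fatou's lemma lives in \<open>ennreal\<close>, the dimension in \<open>ereal\<close>;
  \<open>e2ennreal\<close> is monotone and continuous, so it commutes with upper and lower
  limits.\<close>

lemma limsup_ennreal: "limsup (\<lambda>n. ennreal (x n)) = e2ennreal (limsup (\<lambda>n. ereal (x n)))"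
  by (subst Limsup_compose_continuous_mono[symmetric, where f=e2ennreal])
    (auto simp: mono_def e2ennreal_mono continuous_on_e2ennreal e2ennreal_ereal)

lemma liminf_ennreal: "liminf (\<lambda>n. ennreal (x n)) = e2ennreal (liminf (\<lambda>n. ereal (x n)))"
  by (subst Liminf_compose_continuous_mono[symmetric, where f=e2ennreal])
    (auto simp: mono_def e2ennreal_mono continuous_on_e2ennreal e2ennreal_ereal)

section \<open>The dimension of the mixture between the two bounds\<close>

context compact_action
begin

lemma rate_distortion_antimono:
  assumes \<nu>: "\<nu> \<in> invariant_measures T" and "\<epsilon> \<le> \<epsilon>'"
  shows "rate_distortion T \<nu> \<epsilon>' \<le> rate_distortion T \<nu> \<epsilon>"
proof (rule tendsto_le[OF trivial_limit_at_top_linorder rate_distortion_tendsto[OF \<nu>] rate_distortion_tendsto[OF \<nu>]])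
  have "rate_distortion_cube T \<nu> L \<epsilon>' \<le> rate_distortion_cube T \<nu> L \<epsilon>" for L
    unfolding rate_distortion_cube_def using less_le_trans[OF _ assms(2)]
    by (intro Inf_superset_mono) blast
  then show "\<forall>\<^sub>F L in at_top. rate_distortion_cube T \<nu> L \<epsilon>' / ereal (L ^ CARD('n)) \<le>
      rate_distortion_cube T \<nu> L \<epsilon> / ereal (L ^ CARD('n))"
    using eventually_mono[OF eventually_gt_at_top[of "0::real"]] by (simp add: ereal_divide_right_mono)
qed

end

context action_mixture
begin

lemma rdim_mixture:
  assumes mdim: "upper_metric_mdim T < \<infinity>" and ae: "AE \<nu> in \<Lambda>. rdim_exists T \<nu>"
  shows "rdim_exists T (mixture \<Lambda>)" "rdim T \<in> borel_measurable \<Lambda>"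
    "rdim T (mixture \<Lambda>) = enn2ereal (\<integral>\<^sup>+\<nu>. e2ennreal (rdim T \<nu>) \<partial>\<Lambda>)"
proof -
  obtain C e where C: "0 \<le> C" and e: "0 < e" "e < 1"
    and bnd: "\<And>\<nu> \<epsilon>. \<nu> \<in> invariant_measures T \<Longrightarrow> 0 < \<epsilon> \<Longrightarrow> \<epsilon> < e \<Longrightarrow> rate_distortion T \<nu> \<epsilon> \<le> ereal (C * log 2 (1 / \<epsilon>))"
    using rate_distortion_uniform_bound[OF mdim] by blast
  have bnd': "\<forall>\<nu>\<in>invariant_measures T. rate_distortion T \<nu> \<epsilon> \<le> ereal (C * log 2 (1 / \<epsilon>))" if "0 < \<epsilon>" "\<epsilon> < e" for \<epsilon>
    using bnd that by blast
  note R = rate_finite[OF bnd']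
  define \<psi> where "\<psi> n \<nu> = rate ((1 / 2) ^ n) \<nu> / real n" for n :: nat and \<nu>
  have ev: "\<forall>\<^sub>F \<epsilon> in at_right 0. rate_distortion T \<nu> \<epsilon> / ereal (log 2 (1 / \<epsilon>)) = ereal (rate \<epsilon> \<nu> / log 2 (1 / \<epsilon>))"
    if \<nu>: "\<nu> \<in> invariant_measures T" for \<nu>
  proof -
    have "\<forall>\<^sub>F \<epsilon> in at_right 0. 0 < \<epsilon> \<and> \<epsilon> < e"
      unfolding eventually_at_right_field using e by auto
    then show ?thesis
    proof eventually_elim
      case (elim \<epsilon>)
      then have "0 < log 2 (1 / \<epsilon>)" using e by simp
      moreover obtain r where "rate_distortion T \<nu> \<epsilon> = ereal r" using R(1)[OF _ _ \<nu>] elim by blast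
      ultimately show ?case by simp
    qed
  qed
  have dy: "upper_rdim T \<nu> = limsup (\<lambda>n. ereal (\<psi> n \<nu>))" "lower_rdim T \<nu> = liminf (\<lambda>n. ereal (\<psi> n \<nu>))"
    if \<nu>: "\<nu> \<in> invariant_measures T" for \<nu>
  proof -
    have m: "rate y \<nu> \<le> rate x \<nu>" if "0 < x" "x \<le> y" "y < e" for x y
    proof -
      have "ereal (rate y \<nu>) \<le> ereal (rate x \<nu>)"
        using rate_distortion_antimono[OF \<nu> that(2)] R(1)[OF _ _ \<nu>, of x] R(1)[OF _ _ \<nu>, of y] that by simp
      then show ?thesis by simp
    qed
    note D = dyadic_limits[OF e C m R(2)[OF _ _ \<nu>] R(3)[OF _ _ \<nu>]]
    show "upper_rdim T \<nu> = limsup (\<lambda>n. ereal (\<psi> n \<nu>))"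
      unfolding upper_rdim_def Limsup_eq[OF ev[OF \<nu>]] \<psi>_def by (rule D)
    show "lower_rdim T \<nu> = liminf (\<lambda>n. ereal (\<psi> n \<nu>))"
      unfolding lower_rdim_def Liminf_eq[OF ev[OF \<nu>]] \<psi>_def by (rule D)
  qed
  have \<psi>m [measurable]: "\<psi> n \<in> borel_measurable \<Lambda>" for n
    unfolding \<psi>_def using rate_distortion_measurable by (intro borel_measurable_divide borel_measurable_real_of_ereal) auto
  show meas: "rdim T \<in> borel_measurable \<Lambda>"
  proof -
    have "(\<lambda>\<nu>. limsup (\<lambda>n. ereal (\<psi> n \<nu>))) \<in> borel_measurable \<Lambda>" by measurable
    moreover have "rdim T \<nu> = limsup (\<lambda>n. ereal (\<psi> n \<nu>))" if "\<nu> \<in> space \<Lambda>" for \<nu>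
      using dy(1)[of \<nu>] that by (simp add: rdim_def space_mixing)
    ultimately show ?thesis by (simp cong: measurable_cong)
  qed
  have "(\<lambda>n. (1 / 2) ^ n :: real) \<longlonglongrightarrow> 0" by (rule LIMSEQ_power_zero) simp
  from order_tendstoD(2)[OF this e(1)] obtain n1 where n1: "\<And>n. n1 \<le> n \<Longrightarrow> (1 / 2 :: real) ^ n < e"
    by (auto simp: eventually_sequentially)
  define n0 where "n0 = max n1 1"
  have n0: "(1 / 2 :: real) ^ n < e" "0 < n" if "n0 \<le> n" for n using n1 that by (auto simp: n0_def)
  have log2: "log 2 (1 / (1 / 2) ^ n) = real n" for n :: nat
    by (simp add: power_one_over log_nat_power)
  have pos: "(0::real) < (1 / 2) ^ n" for n :: nat by simp
  have \<psi>b: "0 \<le> \<psi> n \<nu>" "\<psi> n \<nu> \<le> C" if "n0 \<le> n" "\<nu> \<in> invariant_measures T" for n \<nu>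
    using R(2,3)[OF pos n0(1)[OF that(1)] that(2)] n0(2)[OF that(1)]
    unfolding \<psi>_def log2 by (simp_all add: divide_le_eq)
  have \<psi>i: "integrable \<Lambda> (\<psi> n)" if "n0 \<le> n" for n
    unfolding \<psi>_def using R(4)[OF pos n0(1)[OF that]] by simp
  define x where "x n = (\<integral>\<nu>. \<psi> n \<nu> \<partial>\<Lambda>)" for n
  let ?\<mu> = "mixture \<Lambda>"
  note \<mu> = mixture_invariant
  \<comment> \<open>Early terms, for which \<open>(1 / 2) ^ n\<close> may not yet be below
    \<open>e\<close>, are set to zero, so that the domination by \<open>C\<close> holds for every
    \<open>n\<close>.\<close>
  define u where "u n \<nu> = (if n < n0 then 0 else ennreal (\<psi> n \<nu>))" for n \<nu>
  have um [measurable]: "u n \<in> borel_measurable \<Lambda>" for n unfolding u_def by (cases "n < n0") auto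
  have ueq: "\<forall>\<^sub>F n in sequentially. u n \<nu> = ennreal (\<psi> n \<nu>)" for \<nu>
    using eventually_ge_at_top[of n0] by eventually_elim (simp add: u_def)
  have ux: "\<forall>\<^sub>F n in sequentially. (\<integral>\<^sup>+\<nu>. u n \<nu> \<partial>\<Lambda>) = ennreal (x n)"
    using eventually_ge_at_top[of n0]
  proof eventually_elim
    case (elim n)
    have "(\<integral>\<^sup>+\<nu>. u n \<nu> \<partial>\<Lambda>) = (\<integral>\<^sup>+\<nu>. ennreal (\<psi> n \<nu>) \<partial>\<Lambda>)" using elim by (simp add: u_def)
    also have "\<dots> = ennreal (x n)"
      unfolding x_def using \<psi>b(1)[OF elim] by (intro nn_integral_eq_integral \<psi>i[OF elim] AE_I2) (simp add: space_mixing)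
    finally show ?case .
  qed
  let ?I = "\<integral>\<^sup>+\<nu>. e2ennreal (rdim T \<nu>) \<partial>\<Lambda>"
  have up: "e2ennreal (upper_rdim T ?\<mu>) \<le> ?I"
  proof -
    have "e2ennreal (upper_rdim T ?\<mu>) = limsup (\<lambda>n. ennreal (\<psi> n ?\<mu>))"
      unfolding dy(1)[OF \<mu>] limsup_ennreal ..
    also have "\<dots> \<le> limsup (\<lambda>n. \<integral>\<^sup>+\<nu>. u n \<nu> \<partial>\<Lambda>)"
    proof (rule Limsup_mono)
      show "\<forall>\<^sub>F n in sequentially. ennreal (\<psi> n ?\<mu>) \<le> (\<integral>\<^sup>+\<nu>. u n \<nu> \<partial>\<Lambda>)"
        using ux eventually_ge_at_top[of n0]
      proof eventually_elim
        case (elim n)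
        have "ereal (rate ((1 / 2) ^ n) ?\<mu>) \<le> ereal (\<integral>\<nu>. rate ((1 / 2) ^ n) \<nu> \<partial>\<Lambda>)"
          using rate_distortion_mixture_le[OF bnd'[OF pos n0(1)[OF elim(2)]]] R(1)[OF pos n0(1)[OF elim(2)] \<mu>] by simp
        then have "\<psi> n ?\<mu> \<le> x n"
          unfolding \<psi>_def x_def by (simp add: divide_right_mono)
        then show ?case using elim by (simp add: ennreal_leI)
      qed
    qed
    also have "\<dots> \<le> (\<integral>\<^sup>+\<nu>. limsup (\<lambda>n. u n \<nu>) \<partial>\<Lambda>)"
    proof (rule nn_integral_limsup[where w="\<lambda>_. ennreal C"])
      show "AE \<nu> in \<Lambda>. u n \<nu> \<le> ennreal C" for n
        using \<psi>b(2) by (intro AE_I2) (auto simp: u_def space_mixing ennreal_leI)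
      show "(\<integral>\<^sup>+\<nu>. ennreal C \<partial>\<Lambda>) < \<infinity>" using emeasure_space_1 by simp
    qed measurable
    also have "\<dots> = ?I"
    proof (rule nn_integral_cong)
      fix \<nu> assume "\<nu> \<in> space \<Lambda>"
      then have "\<nu> \<in> invariant_measures T" by (simp add: space_mixing)
      then show "limsup (\<lambda>n. u n \<nu>) = e2ennreal (rdim T \<nu>)"
        unfolding Limsup_eq[OF ueq] limsup_ennreal rdim_def by (simp add: dy)
    qed
    finally show ?thesis .
  qed
  have lo: "?I \<le> e2ennreal (lower_rdim T ?\<mu>)"
  proof -
    \<comment> \<open>The existence hypothesis enters here: \<open>rdim\<close> is defined as the
      upper limit, and almost everywhere it equals the lower limit that Fatou's lemma needs.\<close>
    have "?I = (\<integral>\<^sup>+\<nu>. liminf (\<lambda>n. u n \<nu>) \<partial>\<Lambda>)"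
    proof (rule nn_integral_cong_AE)
      from ae AE_space[of \<Lambda>] show "AE \<nu> in \<Lambda>. e2ennreal (rdim T \<nu>) = liminf (\<lambda>n. u n \<nu>)"
      proof eventually_elim
        case (elim \<nu>)
        then show ?case
          unfolding Liminf_eq[OF ueq] liminf_ennreal rdim_def by (simp add: rdim_exists_def dy(2) space_mixing)
      qed
    qed
    also have "\<dots> \<le> liminf (\<lambda>n. \<integral>\<^sup>+\<nu>. u n \<nu> \<partial>\<Lambda>)" by (rule nn_integral_liminf) measurable
    also have "\<dots> = e2ennreal (liminf (\<lambda>n. ereal (x n)))" unfolding Liminf_eq[OF ux] liminf_ennreal ..
    also have "\<dots> \<le> e2ennreal (liminf (\<lambda>n. ereal (\<psi> n ?\<mu>)))"
    proof (intro e2ennreal_mono liminf_le_of_shifted)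
      fix m k assume m: "n0 \<le> m"
      let ?r = "rate ((1 / 2) ^ (m + k)) ?\<mu>"
      have mk: "n0 \<le> m + k" using m by simp
      have K: "(2::real) ^ k * (1 / 2) ^ (m + k) = (1 / 2) ^ m" by (simp add: power_add power_one_over)
      have bm: "\<forall>\<nu>\<in>invariant_measures T. rate_distortion T \<nu> (2 ^ k * (1 / 2) ^ (m + k)) \<le> ereal (C * real m)"
        using bnd'[OF pos n0(1)[OF m]] unfolding K log2 .
      have "(\<integral>\<nu>. rate ((1 / 2) ^ m) \<nu> \<partial>\<Lambda>) - C * real m / 2 ^ k \<le> ?r"
      proof (rule dense_ge)
        fix a assume "?r < a"
        then have "rate_distortion T ?\<mu> ((1 / 2) ^ (m + k)) < ereal a"
          by (subst R(1)[OF pos n0(1)[OF mk] \<mu>]) simp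
        from rate_distortion_mixture_ge[OF _ pos bm _ this] C
        show "(\<integral>\<nu>. rate ((1 / 2) ^ m) \<nu> \<partial>\<Lambda>) - C * real m / 2 ^ k \<le> a" unfolding K by simp
      qed
      moreover have "(\<integral>\<nu>. rate ((1 / 2) ^ m) \<nu> \<partial>\<Lambda>) = real m * x m"
        using n0(2)[OF m] by (simp add: x_def \<psi>_def)
      ultimately have r: "real m * x m - C * real m / 2 ^ k \<le> ?r" by simp
      have mk0: "0 < real (m + k)" unfolding of_nat_0_less_iff by (rule n0(2)[OF mk])
      \<comment> \<open>For the change of denominator: \<open>m * x m\<close> falls short of
        \<open>(m + k) * x m\<close> by \<open>k * x m\<close>, which is at most
        \<open>C * k\<close>.\<close>
      have "x m \<le> (\<integral>\<nu>. C \<partial>\<Lambda>)"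
        unfolding x_def using \<psi>b(2)[OF m] by (intro integral_mono \<psi>i[OF m]) (auto simp: space_mixing)
      then have xC: "x m \<le> C" using prob_space by simp
      have "(x m - C * real k / real (m + k) - C / 2 ^ k) * real (m + k) =
          real m * x m + (x m - C) * real k - C / 2 ^ k * real (m + k)"
        using mk0 by (simp add: left_diff_distrib) (simp add: algebra_simps)
      also have "\<dots> \<le> real m * x m - C / 2 ^ k * real m"
      proof -
        have "(x m - C) * real k \<le> 0" using xC by (intro mult_nonpos_nonneg) auto
        moreover have "C / 2 ^ k * real m \<le> C / 2 ^ k * real (m + k)" using C by (intro mult_left_mono) auto
        ultimately show ?thesis by linarith
      qed
      also have "\<dots> \<le> ?r" using r by simp
      finally show "x m - C * real k / real (m + k) - C / 2 ^ k \<le> \<psi> (m + k) ?\<mu>"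
        unfolding \<psi>_def using mk0 by (simp only: pos_le_divide_eq)
    qed
    finally show ?thesis unfolding dy(2)[OF \<mu>] .
  qed
  have le: "lower_rdim T ?\<mu> \<le> upper_rdim T ?\<mu>"
    unfolding dy[OF \<mu>] by (rule Liminf_le_Limsup) simp
  \<comment> \<open>Nonnegativity permits the return from \<open>ennreal\<close> to
    \<open>ereal\<close>, as \<open>e2ennreal\<close> cuts negative values to zero.\<close>
  have "\<forall>\<^sub>F n in sequentially. 0 \<le> ereal (\<psi> n ?\<mu>)"
    using eventually_ge_at_top[of n0] by eventually_elim (simp add: \<psi>b(1)[OF _ \<mu>])
  then have ge: "0 \<le> lower_rdim T ?\<mu>" unfolding dy[OF \<mu>] by (rule Liminf_bounded)
  have "e2ennreal (upper_rdim T ?\<mu>) = ?I" "e2ennreal (lower_rdim T ?\<mu>) = ?I"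
    using up lo e2ennreal_mono[OF le] by (auto intro: antisym order_trans)
  then have "upper_rdim T ?\<mu> = enn2ereal ?I" "lower_rdim T ?\<mu> = enn2ereal ?I"
    using ge le by (metis enn2ereal_e2ennreal order_trans)+
  then show "rdim_exists T ?\<mu>" "rdim T ?\<mu> = enn2ereal ?I"
    by (simp_all add: rdim_exists_def rdim_def)
qed

end

text \<open>On invariant measures the dimension is an upper limit of nonnegative rates divided by
  positive logarithms, so \<open>e2ennreal\<close> truncates nothing and the integral is the
  intended one.\<close>

theorem corollary1p3:
  fixes T :: "real ^ 'n \<Rightarrow> 'a::polish_space \<Rightarrow> 'a"
    and \<Lambda> :: "'a measure measure"
    and \<mu> :: "'a measure"
  assumes "compact (UNIV :: 'a set)"
    and "continuous_action T"
    and "upper_metric_mdim T < \<infinity>"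
    and "prob_space \<Lambda>"
    and "sets \<Lambda> = sets (borel_of (weak_star_topology T))"
    and "\<mu> = mixture \<Lambda>"
    and "AE \<nu> in \<Lambda>. rdim_exists T \<nu>"
  shows "\<mu> \<in> invariant_measures T
    \<and> rdim_exists T \<mu>
    \<and> rdim T \<in> borel_measurable \<Lambda>
    \<and> rdim T \<mu> = enn2ereal (\<integral>\<^sup>+ \<nu>. e2ennreal (rdim T \<nu>) \<partial>\<Lambda>)"
proof -
  interpret action_mixture T \<Lambda>
    by (intro action_mixture.intro compact_action.intro action_mixture_axioms.intro assms)
  show ?thesis
    unfolding assms(6) using mixture_invariant rdim_mixture[OF assms(3,7)] by blast
qed

end
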